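(* Let $X$ be a (real) inner product space with inner product $\langle\cdot|\cdot\rangle$ and let $U:\mathcal P(\Sigma_{\mathsf G}^{\mathbb N})\to X$ be continuous with respect to the weak topology. Fix a Hölder continuous function $\varphi:\Sigma_{\mathsf G}^{\mathbb N}\to\mathbb R$ with $\varphi<0$. For $q\in X$ let $\tau(q)=\sigma_{\mathrm{ab}}\big(\zeta_q^{\mathrm{co},U}(\varphi;\cdot)\big)$. (1) The function $\tau$ is convex, and if there is a Hölder continuous function $\psi:\Sigma_{\mathsf G}^{\mathbb N}\to\mathbb R$ such that $U\mu=\frac{\int\psi\,d\mu}{\int\varphi\,d\mu}$ for all $\mu$ (so that $X=\mathbb R$), then $\tau$ is real analytic. (2) Fix a point $\alpha\in X$ and let $f(\alpha)$ be the unique real number such that $$\limsup_{r\searrow 0}\sigma_{\mathrm{rad}}\big(\zeta_{B(\alpha,r)}^{\mathrm{dyn},U}(f(\alpha)\,\varphi;\cdot)\big)=1 .$$ Then $$f(\alpha)\le\tau^*(\alpha).$$ If, in addition, $X=\mathbb R^M$ and there is $q\in\mathbb R^M$ such that $\tau$ is differentiable at $q$ with $\alpha=-\nabla\tau(q)$, then $$f(\alpha)=\tau^*(\alpha).$$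
   Context: Symbolic setting. $\mathsf G=(\mathsf V,\mathsf E)$ is a finite strongly connected directed multigraph with vertex set $\mathsf V$ and (nonempty) edge set $\mathsf E$; $\operatorname{i}(e)$ and $\operatorname{t}(e)$ denote the initial and terminal vertex of $e\in\mathsf E$. $\Sigma_{\mathsf G}^n$ is the set of strings $e_1\ldots e_n$ of edges with $\operatorname{t}(e_k)=\operatorname{i}(e_{k+1})$ for $1\le k<n$; $\Sigma_{\mathsf G}^{\mathbb N}$ is the set of infinite strings $e_1e_2\ldots$ with $\operatorname{t}(e_k)=\operatorname{i}(e_{k+1})$ for all $k$, with the product topology. For $\mathbf i\in\Sigma_{\mathsf G}^n$, $|\mathbf i|=n$ and $[\mathbf i]$ is the cylinder of all $\mathbf j\in\Sigma_{\mathsf G}^{\mathbb N}$ whose first $n$ letters form $\mathbf i$. $S$ is the shift map on $\Sigma_{\mathsf G}^{\mathbb N}$. Hölder continuity is with respect to a metric $\mathsf d_\gamma(\mathbf i,\mathbf j)=\gamma^{|\mathbf i\wedge\mathbf j|}$ ($\mathbf i\ne\mathbf j$), $\gamma\in(0,1)$, where $\mathbf i\wedge\mathbf j$ is the longest common prefix. $\mathcal P(\Sigma_{\mathsf G}^{\mathbb N})$ is the set of Borel probability measures on $\Sigma_{\mathsf G}^{\mathbb N}$ with the weak topology. $L_n\mathbf u=\frac1n\sum_{k=0}^{n-1}\delta_{S^k\mathbf u}$ and $UL_n[\mathbf i]=\{U(L_n\mathbf u):\mathbf u\in[\mathbf i]\}$. Fine zeta-function. For $C\subseteq X$ and continuous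 $\varphi:\Sigma_{\mathsf G}^{\mathbb N}\to\mathbb R$, $$\zeta_C^{\mathrm{dyn},U}(\varphi;z)=\sum_n\frac{z^n}{n}\Bigg(\sum_{\mathbf i\in\Sigma_{\mathsf G}^n,\;UL_n[\mathbf i]\subseteq C}\ \sup_{\mathbf u\in[\mathbf i]}\exp\sum_{k=0}^{n-1}\varphi(S^k\mathbf u)\Bigg),\qquad z\in\mathbb C,$$ and $\sigma_{\mathrm{rad}}$ denotes the radius of convergence of a power series. $B(\alpha,r)$ is the ball with centre $\alpha$ and radius $r$. Coarse zeta-function. For $q\in X$, $$\zeta_q^{\mathrm{co},U}(\varphi;s)=\sum_n\sum_{\mathbf i\in\Sigma_{\mathsf G}^n}\exp\Bigg(\Big(\sup_{\mathbf u\in[\mathbf i]}\langle q|UL_n\mathbf u\rangle+s\Big)\sup_{\mathbf u\in[\mathbf i]}\sum_{k=0}^{n-1}\varphi(S^k\mathbf u)\Bigg),\qquad s\in\mathbb C,$$ and $\sigma_{\mathrm{ab}}$ denotes the abscissa of convergence, i.e. the infimum of all $t\in\mathbb R$ such that the series converges for all $s$ with $\operatorname{Re}s>t$. Legendre transform. For $g:X\to\mathbb R$, $g^*(x)=\inf_{y\in X}(\langle x|y\rangle+g(y))\in[-\infty,\infty]$.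
   Formalization: A real f(α) need not exist for every α (if U is constantly 0 and α=5, the limsup is infinite for every t); unique existence is asserted when the limsup is finite for some t, and f(α)≤τ*(α) for any such f(α); in the gradient case existence is proved outright. *)

theory Defs
  imports "HOL-Probability.Probability" "Graph_Theory.Graph_Theory"
begin

section \<open>The shift space of a directed multigraph\<close>

text \<open>
  For an arc \<open>e\<close> of a digraph \<open>G\<close>, \<open>tail G e\<close> is its initial and \<open>head G e\<close> its terminal vertex.
  Infinite strings are functions on \<open>nat\<close>, so the first letter has index \<open>0\<close>.
\<close>

definition words :: "('v, 'e) pre_digraph \<Rightarrow> nat \<Rightarrow> 'e list set" where
  "words G n = {w. length w = n \<and> set w \<subseteq> arcs G \<and>
     (\<forall>k. Suc k < n \<longrightarrow> head G (w ! k) = tail G (w ! Suc k))}"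

definition shift_space :: "('v, 'e) pre_digraph \<Rightarrow> (nat \<Rightarrow> 'e) set" where
  "shift_space G = {u. (\<forall>k. u k \<in> arcs G) \<and> (\<forall>k. head G (u k) = tail G (u (Suc k)))}"

definition shift_top :: "('v, 'e) pre_digraph \<Rightarrow> (nat \<Rightarrow> 'e) topology" where
  "shift_top G =
     subtopology (product_topology (\<lambda>_. discrete_topology (arcs G)) UNIV) (shift_space G)"

definition cylinder :: "('v, 'e) pre_digraph \<Rightarrow> 'e list \<Rightarrow> (nat \<Rightarrow> 'e) set" where
  "cylinder G w = {u \<in> shift_space G. \<forall>k < length w. u k = w ! k}"

definition shift :: "(nat \<Rightarrow> 'e) \<Rightarrow> nat \<Rightarrow> 'e" where
  "shift u = (\<lambda>k. u (Suc k))"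

definition birkhoff :: "((nat \<Rightarrow> 'e) \<Rightarrow> real) \<Rightarrow> nat \<Rightarrow> (nat \<Rightarrow> 'e) \<Rightarrow> real" where
  "birkhoff \<phi> n u = (\<Sum>k<n. \<phi> ((shift ^^ k) u))"

text \<open>
  For \<open>u \<noteq> v\<close> the least index at which \<open>u\<close> and \<open>v\<close> differ (counting from \<open>0\<close>) is the length of
  their longest common prefix.
\<close>

definition shift_dist :: "real \<Rightarrow> (nat \<Rightarrow> 'e) \<Rightarrow> (nat \<Rightarrow> 'e) \<Rightarrow> real" where
  "shift_dist \<gamma> u v = (if u = v then 0 else \<gamma> ^ (LEAST n. u n \<noteq> v n))"

definition hoelder :: "('v, 'e) pre_digraph \<Rightarrow> real \<Rightarrow> ((nat \<Rightarrow> 'e) \<Rightarrow> real) \<Rightarrow> bool" where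
  "hoelder G \<gamma> \<phi> \<longleftrightarrow> (\<exists>C \<theta>. 0 < \<theta> \<and>
     (\<forall>u \<in> shift_space G. \<forall>v \<in> shift_space G. \<bar>\<phi> u - \<phi> v\<bar> \<le> C * shift_dist \<gamma> u v powr \<theta>))"


section \<open>Borel probability measures and the weak topology\<close>

definition shift_borel :: "('v, 'e) pre_digraph \<Rightarrow> (nat \<Rightarrow> 'e) measure" where
  "shift_borel G = sigma (shift_space G) {A. openin (shift_top G) A}"

definition shift_probs :: "('v, 'e) pre_digraph \<Rightarrow> (nat \<Rightarrow> 'e) measure set" where
  "shift_probs G = {\<mu>. sets \<mu> = sets (shift_borel G) \<and> prob_space \<mu>}"

text \<open>
  The coarsest topology on \<open>shift_probs G\<close> that makes \<open>\<mu> \<mapsto> \<integral>f d\<mu>\<close> continuous for every continuous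
  \<open>f\<close>; no boundedness of \<open>f\<close> is required because the shift space of a finite graph is compact.
\<close>

definition weak_top :: "('v, 'e) pre_digraph \<Rightarrow> (nat \<Rightarrow> 'e) measure topology" where
  "weak_top G = topology_generated_by
     {{\<mu> \<in> shift_probs G. integral\<^sup>L \<mu> f \<in> W} | f W.
        continuous_map (shift_top G) euclideanreal f \<and> open W}"

definition empirical :: "('v, 'e) pre_digraph \<Rightarrow> nat \<Rightarrow> (nat \<Rightarrow> 'e) \<Rightarrow> (nat \<Rightarrow> 'e) measure" where
  "empirical G n u = measure_of (shift_space G) (sets (shift_borel G))
     (\<lambda>A. ennreal (1 / real n) * (\<Sum>k<n. emeasure (return (shift_borel G) ((shift ^^ k) u)) A))"


section \<open>The fine zeta-function\<close>

definition fine_coeff ::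
  "('v, 'e) pre_digraph \<Rightarrow> ((nat \<Rightarrow> 'e) measure \<Rightarrow> 'x) \<Rightarrow> 'x set \<Rightarrow>
    ((nat \<Rightarrow> 'e) \<Rightarrow> real) \<Rightarrow> nat \<Rightarrow> complex" where
  "fine_coeff G U C \<phi> n = (if n = 0 then 0 else
     complex_of_real (1 / real n *
       (\<Sum>w \<in> {w \<in> words G n. (\<lambda>u. U (empirical G n u)) ` cylinder G w \<subseteq> C}.
          SUP u \<in> cylinder G w. exp (birkhoff \<phi> n u))))"

definition fine_radius ::
  "('v, 'e) pre_digraph \<Rightarrow> ((nat \<Rightarrow> 'e) measure \<Rightarrow> 'x) \<Rightarrow> 'x set \<Rightarrow>
    ((nat \<Rightarrow> 'e) \<Rightarrow> real) \<Rightarrow> ereal" where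
  "fine_radius G U C \<phi> = conv_radius (fine_coeff G U C \<phi>)"

text \<open>
  The quantity whose value \<open>1\<close> singles out \<open>t = f(\<alpha>)\<close>. It is infinite for every \<open>t\<close> if, for small
  \<open>r\<close>, only finitely many words contribute to the zeta-function of \<open>ball \<alpha> r\<close>.
\<close>

definition fine_limsup ::
  "('v, 'e) pre_digraph \<Rightarrow> ((nat \<Rightarrow> 'e) measure \<Rightarrow> 'x::metric_space) \<Rightarrow>
    ((nat \<Rightarrow> 'e) \<Rightarrow> real) \<Rightarrow> 'x \<Rightarrow> real \<Rightarrow> ereal" where
  "fine_limsup G U \<phi> \<alpha> t =
     Limsup (at_right 0) (\<lambda>r. fine_radius G U (ball \<alpha> r) (\<lambda>u. t * \<phi> u))"


section \<open>The coarse zeta-function\<close>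

definition coarse_term ::
  "('v, 'e) pre_digraph \<Rightarrow> ((nat \<Rightarrow> 'e) measure \<Rightarrow> 'x::real_inner) \<Rightarrow>
    ((nat \<Rightarrow> 'e) \<Rightarrow> real) \<Rightarrow> 'x \<Rightarrow> complex \<Rightarrow> nat \<Rightarrow> complex" where
  "coarse_term G U \<phi> q s n =
     (\<Sum>w \<in> words G n.
        exp ((complex_of_real (SUP u \<in> cylinder G w. inner q (U (empirical G n u))) + s)
             * complex_of_real (SUP u \<in> cylinder G w. birkhoff \<phi> n u)))"

text \<open>The series starts at length \<open>1\<close>, since \<open>empirical G 0 u\<close> is not a probability measure.\<close>

definition coarse_abscissa ::
  "('v, 'e) pre_digraph \<Rightarrow> ((nat \<Rightarrow> 'e) measure \<Rightarrow> 'x::real_inner) \<Rightarrow>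
    ((nat \<Rightarrow> 'e) \<Rightarrow> real) \<Rightarrow> 'x \<Rightarrow> ereal" where
  "coarse_abscissa G U \<phi> q =
     Inf (ereal ` {t. \<forall>s. t < Re s \<longrightarrow> summable (\<lambda>n. coarse_term G U \<phi> q s (Suc n))})"

definition tau ::
  "('v, 'e) pre_digraph \<Rightarrow> ((nat \<Rightarrow> 'e) measure \<Rightarrow> 'x::real_inner) \<Rightarrow>
    ((nat \<Rightarrow> 'e) \<Rightarrow> real) \<Rightarrow> 'x \<Rightarrow> real" where
  "tau G U \<phi> q = real_of_ereal (coarse_abscissa G U \<phi> q)"


section \<open>Legendre transform and real analyticity\<close>

definition legendre :: "('x::real_inner \<Rightarrow> real) \<Rightarrow> 'x \<Rightarrow> ereal" where
  "legendre g x = (INF y. ereal (inner x y + g y))"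

definition real_analytic :: "(real \<Rightarrow> real) \<Rightarrow> bool" where
  "real_analytic f \<longleftrightarrow>
     (\<forall>x0. \<exists>r > 0. \<exists>a. \<forall>x. \<bar>x - x0\<bar> < r \<longrightarrow> (\<lambda>n. a n * (x - x0) ^ n) sums f x)"

end

theory Submission
  imports Defs "HOL-Complex_Analysis.Complex_Analysis" "HOL-Library.Diagonal_Subsequence"
begin

text \<open>
  Weak compactness of the probability measures makes \<open>U\<close> bounded and makes its oscillation over the empirical
  measures of a cylinder of length \<open>n\<close> tend to \<open>0\<close>. Hence suprema over cylinders may be replaced by values at
  arbitrary points up to \<open>o(1)\<close>, and convexity of \<open>\<tau>\<close> follows from convexity of \<open>exp\<close>. Words whose empirical
  means lie in a small ball around \<open>\<alpha>\<close> have \<open>\<langle>q|UL\<^sub>nu\<rangle>\<close> close to \<open>\<langle>q|\<alpha>\<rangle>\<close>, which compares the two zeta-functions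
  and gives \<open>f(\<alpha>) \<le> \<tau>*(\<alpha>)\<close>. If \<open>\<tau>\<close> is differentiable at \<open>q\<close> with gradient \<open>- \<alpha>\<close>, an exponential tilt of \<open>q\<close>
  shows that the words outside the ball are negligible, so that equality holds.

  For the analyticity of \<open>\<tau>\<close>, the number \<open>\<tau>(q)\<close> is the parameter \<open>s\<close> for which the transfer operator of
  \<open>q \<psi> + s \<phi>\<close> has a positive eigenfunction with eigenvalue \<open>1\<close>. Averaging the first \<open>m\<close> powers of the operator,
  normalised by the eigenfunction at some \<open>q\<^sub>0\<close>, gives a Markov operator that contracts Lipschitz seminorms even if
  the graph is periodic. For complex \<open>q\<close> near \<open>q\<^sub>0\<close> the pair of eigenfunction and parameter is the limit of a
  uniformly contracting Newton-type iteration whose iterates are holomorphic in \<open>q\<close>; no spectral theory is needed.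
\<close>


section \<open>Exponential estimates and averaging operators\<close>

text \<open>Two scales of error shape the proof. For a merely continuous \<open>U\<close>, replacing
  a supremum over a cylinder by a value costs a factor \<open>exp (o(n))\<close>. Birkhoff sums of
  \<open>\<phi>\<close> lie between \<open>- n * F\<close> and \<open>- n * c\<close>, so an
  arbitrarily small change of \<open>s\<close> absorbs it. That is enough for convexity and the
  Legendre inequalities, but not for analyticity. There the quotient form of \<open>U\<close> makes
  its oscillation on a cylinder O(1/n), and the coarse terms agree with transfer operator sums up to
  a bounded factor.

  The obstacle to analyticity is that a periodic graph produces further spectrum of modulus 1.
  Averaging powers avoids it without losing the parameter: \<open>\<phi> < 0\<close> makes the
  operators strictly decreasing in \<open>s\<close>, so two positive eigenfunctions of the averaged
  operator with the same eigenvalue belong to the same \<open>s\<close>. The same negativity keeps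
  the divisor of the Newton step away from 0. The invariant measure that this divisor would
  naturally involve is replaced by a high iterate of the Markov operator evaluated at one point, a
  finite sum for which holomorphy, reality and passage to the limit are elementary.\<close>

lemma norm_exp_diff_le:
  fixes z w :: complex
  assumes "norm z \<le> 1" "norm w \<le> 1"
  shows "norm (exp z - exp w) \<le> 3 * norm (z - w)"
proof -
  have "norm (exp z - exp w) \<le> exp 1 * norm (z - w)"
  proof (rule field_differentiable_bound[of "cball 0 1" exp exp])
    fix u :: complex assume "u \<in> cball 0 1"
    then show "norm (exp u) \<le> exp 1"
      using norm_exp[of u] by (auto intro: order_trans)
  qed (use assms in \<open>auto intro!: derivative_eq_intros\<close>)
  also have "\<dots> \<le> 3 * norm (z - w)"
    using exp_le by (intro mult_right_mono) auto
  finally show ?thesis .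
qed

text \<open>This is the mean value estimate for \<open>exp z - z\<close>, whose derivative
  \<open>exp u - 1\<close> the preceding lemma bounds. The constant 3 stands for
  \<open>exp 1\<close>; the numerical constants in the estimates of the weights descend from
  it.\<close>

lemma norm_exp_diff_linear_le:
  fixes z :: complex
  assumes "norm z \<le> 1"
  shows "norm (exp z - 1 - z) \<le> 3 * (norm z)\<^sup>2"
proof -
  have "norm ((exp z - z) - (exp 0 - 0)) \<le> (3 * norm z) * norm (z - 0)"
  proof (rule field_differentiable_bound[of "cball 0 (norm z)" "\<lambda>z. exp z - z" "\<lambda>u. exp u - 1"])
    fix u :: complex assume u: "u \<in> cball 0 (norm z)"
    have "norm (exp u - exp 0) \<le> 3 * norm (u - 0)"
      by (rule norm_exp_diff_le) (use u assms in auto)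
    then show "norm (exp u - 1) \<le> 3 * norm z"
      using u by simp
  qed (auto intro!: derivative_eq_intros)
  then show ?thesis by (simp add: power2_eq_square algebra_simps)
qed

text \<open>A Markov operator with inverse branches \<open>T i\<close> and probabilities
  \<open>p i x\<close>. \<open>D\<close> models a metric truncated at 1: below 1 two points admit
  the same branches and are compared branch by branch, while at distance 1 only suprema are
  compared. The contraction is a hypothesis here and is proved for the shift space in
  \<open>local_solution\<close>.\<close>

locale averaging_system =
  fixes X :: "'x set" and D :: "'x \<Rightarrow> 'x \<Rightarrow> real"
    and I :: "'x \<Rightarrow> 'i set" and T :: "'i \<Rightarrow> 'x \<Rightarrow> 'x" and p :: "'i \<Rightarrow> 'x \<Rightarrow> real"
    and P \<rho> :: real and x0 :: 'x
  assumes x0: "x0 \<in> X"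
    and T_in: "x \<in> X \<Longrightarrow> i \<in> I x \<Longrightarrow> T i x \<in> X"
    and p_nonneg: "x \<in> X \<Longrightarrow> i \<in> I x \<Longrightarrow> 0 \<le> p i x"
    and p_sum: "x \<in> X \<Longrightarrow> (\<Sum>i\<in>I x. p i x) = 1"
    and D_nonneg: "0 \<le> D x y" and D_le: "D x y \<le> 1"
    and I_eq: "x \<in> X \<Longrightarrow> y \<in> X \<Longrightarrow> D x y < 1 \<Longrightarrow> I y = I x"
    and D_T: "x \<in> X \<Longrightarrow> y \<in> X \<Longrightarrow> D x y < 1 \<Longrightarrow> i \<in> I x \<Longrightarrow> D (T i x) (T i y) \<le> D x y"
    and P_nonneg: "0 \<le> P"
    and p_lip: "x \<in> X \<Longrightarrow> y \<in> X \<Longrightarrow> D x y < 1 \<Longrightarrow> (\<Sum>i\<in>I x. \<bar>p i x - p i y\<bar>) \<le> P * D x y"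
    and \<rho>: "0 \<le> \<rho>" "\<rho> < 1"
    and contraction: "\<And>(g :: 'x \<Rightarrow> complex) B x y.
        0 \<le> B \<Longrightarrow> \<forall>x\<in>X. \<forall>y\<in>X. cmod (g x - g y) \<le> B * D x y \<Longrightarrow> x \<in> X \<Longrightarrow> y \<in> X \<Longrightarrow>
        cmod ((\<Sum>i\<in>I x. p i x * g (T i x)) - (\<Sum>i\<in>I y. p i y * g (T i y))) \<le> \<rho> * B * D x y"
begin

section \<open>Weighted averages, Lipschitz bounds and approximate invariant means\<close>

definition lip :: "real \<Rightarrow> ('x \<Rightarrow> complex) \<Rightarrow> bool" where
  "lip B g \<longleftrightarrow> 0 \<le> B \<and> (\<forall>x\<in>X. \<forall>y\<in>X. cmod (g x - g y) \<le> B * D x y)"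

definition wop :: "('i \<Rightarrow> 'x \<Rightarrow> complex) \<Rightarrow> ('x \<Rightarrow> complex) \<Rightarrow> 'x \<Rightarrow> complex" where
  "wop m g x = (\<Sum>i\<in>I x. complex_of_real (p i x) * (m i x * g (T i x)))"

definition avg :: "('x \<Rightarrow> complex) \<Rightarrow> 'x \<Rightarrow> complex" where
  "avg = wop (\<lambda>_ _. 1)"

text \<open>A substitute for integration against the invariant measure of \<open>avg\<close>: on
  Lipschitz functions the iterates flatten at the rate \<open>\<rho> ^ k\<close>, so
  \<open>mean k\<close> is invariant under \<open>avg\<close> up to an error of that order.\<close>

definition mean :: "nat \<Rightarrow> ('x \<Rightarrow> complex) \<Rightarrow> complex" where
  "mean k g = (avg ^^ k) g x0"

lemma lip_bound: "lip B g \<Longrightarrow> x \<in> X \<Longrightarrow> y \<in> X \<Longrightarrow> cmod (g x - g y) \<le> B"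
  unfolding lip_def using D_le[of x y] mult_left_le[of "D x y" B] by force

lemma lip_add: "lip B g \<Longrightarrow> lip C h \<Longrightarrow> lip (B + C) (\<lambda>x. g x + h x)"
  unfolding lip_def
proof (safe)
  fix x y assume "\<forall>x\<in>X. \<forall>y\<in>X. cmod (g x - g y) \<le> B * D x y" "\<forall>x\<in>X. \<forall>y\<in>X. cmod (h x - h y) \<le> C * D x y"
    and "x \<in> X" "y \<in> X"
  then have "cmod (g x - g y) \<le> B * D x y" "cmod (h x - h y) \<le> C * D x y" by auto
  moreover have "g x + h x - (g y + h y) = (g x - g y) + (h x - h y)" by simp
  ultimately show "cmod (g x + h x - (g y + h y)) \<le> (B + C) * D x y"
    using norm_triangle_ineq[of "g x - g y" "h x - h y"] by (simp add: algebra_simps)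
qed auto

lemma lip_mono: "lip B g \<Longrightarrow> B \<le> C \<Longrightarrow> lip C g"
  unfolding lip_def by (meson D_nonneg mult_right_mono order_trans)

lemma lip_add_const: "lip B (\<lambda>x. g x + c) \<longleftrightarrow> lip B g"
  unfolding lip_def by simp

lemma wop_add: "wop m (\<lambda>x. g x + h x) x = wop m g x + wop m h x"
  and wop_diff: "wop m (\<lambda>x. g x - h x) x = wop m g x - wop m h x"
  and wop_diff_weight: "wop (\<lambda>i x. m i x - m' i x) g x = wop m g x - wop m' g x"
  by (simp_all add: wop_def algebra_simps sum.distrib sum_subtractf)

lemma wop_cong: "x \<in> X \<Longrightarrow> (\<And>y. y \<in> X \<Longrightarrow> g y = h y) \<Longrightarrow> wop m g x = wop m h x"
  unfolding wop_def by (intro sum.cong) (auto simp: T_in)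

lemma p_sum_complex: "x \<in> X \<Longrightarrow> (\<Sum>i\<in>I x. complex_of_real (p i x)) = 1"
  using p_sum by (metis of_real_1 of_real_sum)

lemma avg_const: "x \<in> X \<Longrightarrow> avg (\<lambda>_. c) x = c"
  unfolding avg_def wop_def by (simp add: p_sum_complex flip: sum_distrib_right)

lemma wop_bound:
  assumes "x \<in> X" "0 \<le> a" "\<And>i x. x \<in> X \<Longrightarrow> i \<in> I x \<Longrightarrow> cmod (m i x) \<le> a"
    and "\<And>x. x \<in> X \<Longrightarrow> cmod (g x) \<le> G"
  shows "cmod (wop m g x) \<le> a * G"
proof -
  have "cmod (wop m g x) \<le> (\<Sum>i\<in>I x. p i x * (a * G))"
    unfolding wop_def
  proof (rule sum_norm_le)
    fix i assume i: "i \<in> I x"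
    have "cmod (m i x) * cmod (g (T i x)) \<le> a * G"
      using assms i T_in by (intro mult_mono) auto
    then show "cmod (p i x * (m i x * g (T i x))) \<le> p i x * (a * G)"
      using p_nonneg[OF assms(1) i] by (simp add: norm_mult mult_left_mono)
  qed
  then show ?thesis
    using p_sum[OF assms(1)] by (simp flip: sum_distrib_right)
qed

lemma avg_bound: "x \<in> X \<Longrightarrow> (\<And>x. x \<in> X \<Longrightarrow> cmod (g x) \<le> G) \<Longrightarrow> cmod (avg g x) \<le> G"
  unfolding avg_def using wop_bound[of x 1 "\<lambda>_ _. 1" g G] by simp

text \<open>For near points the product rule gives \<open>(P + 1) * G + L\<close>. The 2 in
  \<open>P + 2\<close> pays for points with \<open>D x y = 1\<close>, where the two values are
  simply bounded by \<open>a * G\<close> each.\<close>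

lemma wop_lip:
  assumes a: "0 \<le> a" and m: "\<And>i x. x \<in> X \<Longrightarrow> i \<in> I x \<Longrightarrow> cmod (m i x) \<le> a"
    and m_lip: "\<And>i x y. x \<in> X \<Longrightarrow> y \<in> X \<Longrightarrow> D x y < 1 \<Longrightarrow> i \<in> I x \<Longrightarrow> cmod (m i x - m i y) \<le> a * D x y"
    and G: "\<And>x. x \<in> X \<Longrightarrow> cmod (g x) \<le> G" and L: "lip L g"
  shows "lip (a * ((P + 2) * G + L)) (wop m g)"
  unfolding lip_def
proof (intro conjI ballI)
  have G0: "0 \<le> G" using G[OF x0] norm_ge_zero order_trans by blast
  have L0: "0 \<le> L" using L by (simp add: lip_def)
  show "0 \<le> a * ((P + 2) * G + L)"
    using a G0 L0 P_nonneg by simp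
  fix x y assume x: "x \<in> X" and y: "y \<in> X"
  show "cmod (wop m g x - wop m g y) \<le> a * ((P + 2) * G + L) * D x y"
  proof (cases "D x y < 1")
    case False
    then have D1: "D x y = 1" using D_le[of x y] by simp
    have "cmod (wop m g x - wop m g y) \<le> a * G + a * G"
      using wop_bound[of _ a m g G, OF _ a m G] x y norm_triangle_ineq4[of "wop m g x" "wop m g y"]
      by (smt (verit))
    also have "\<dots> \<le> a * ((P + 2) * G + L)"
      using a G0 L0 P_nonneg by (simp add: algebra_simps)
    finally show ?thesis by (simp add: D1)
  next
    case True
    have Iy: "I y = I x" using I_eq x y True by simp
    \<comment> \<open>The points have the same branches, so \<open>p\<close>, then \<open>m\<close>,
      then \<open>g\<close> can be moved from \<open>x\<close> to \<open>y\<close>, one factor at a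
      time.\<close>
    have "wop m g x - wop m g y = (\<Sum>i\<in>I x. (p i x - p i y) * (m i x * g (T i x))
        + p i y * ((m i x - m i y) * g (T i x)) + p i y * (m i y * (g (T i x) - g (T i y))))"
      unfolding wop_def Iy sum_subtractf[symmetric] by (intro sum.cong) (auto simp: algebra_simps)
    then have "cmod (wop m g x - wop m g y) = cmod (\<Sum>i\<in>I x. (p i x - p i y) * (m i x * g (T i x))
        + p i y * ((m i x - m i y) * g (T i x)) + p i y * (m i y * (g (T i x) - g (T i y))))"
      by (rule arg_cong)
    also have "\<dots> \<le> (\<Sum>i\<in>I x. \<bar>p i x - p i y\<bar> * (a * G) + p i y * (a * D x y * G) + p i y * (a * (L * D x y)))"
    proof (rule sum_norm_le)
      fix i assume i: "i \<in> I x"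
      have Tx: "T i x \<in> X" and Ty: "T i y \<in> X" using T_in i Iy x y by auto
      have py: "0 \<le> p i y" using p_nonneg[OF y] i Iy by simp
      have "cmod (m i x * g (T i x)) \<le> a * G"
        using a m[OF x i] G[OF Tx] by (simp add: norm_mult mult_mono)
      then have 1: "cmod ((p i x - p i y) * (m i x * g (T i x))) \<le> \<bar>p i x - p i y\<bar> * (a * G)"
        by (simp add: norm_mult mult_left_mono flip: of_real_diff)
      have "cmod ((m i x - m i y) * g (T i x)) \<le> a * D x y * G"
        unfolding norm_mult using m_lip[OF x y True i] G[OF Tx] a D_nonneg[of x y] by (intro mult_mono) auto
      then have 2: "cmod (p i y * ((m i x - m i y) * g (T i x))) \<le> p i y * (a * D x y * G)"
        using py by (simp add: norm_mult mult_left_mono)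
      have "cmod (g (T i x) - g (T i y)) \<le> L * D (T i x) (T i y)"
        using L Tx Ty by (simp add: lip_def)
      also have "\<dots> \<le> L * D x y" using D_T[OF x y True i] L0 by (rule mult_left_mono)
      finally have "cmod (m i y * (g (T i x) - g (T i y))) \<le> a * (L * D x y)"
        unfolding norm_mult using m[OF y] i Iy a by (intro mult_mono) auto
      then have 3: "cmod (p i y * (m i y * (g (T i x) - g (T i y)))) \<le> p i y * (a * (L * D x y))"
        using py by (simp add: norm_mult mult_left_mono)
      show "cmod ((p i x - p i y) * (m i x * g (T i x)) + p i y * ((m i x - m i y) * g (T i x))
          + p i y * (m i y * (g (T i x) - g (T i y))))
        \<le> \<bar>p i x - p i y\<bar> * (a * G) + p i y * (a * D x y * G) + p i y * (a * (L * D x y))"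
        by (intro norm_triangle_le add_mono 1 2 3)
    qed
    also have "\<dots> = (\<Sum>i\<in>I x. \<bar>p i x - p i y\<bar>) * (a * G) + (\<Sum>i\<in>I y. p i y) * (a * D x y * G)
        + (\<Sum>i\<in>I y. p i y) * (a * (L * D x y))"
      unfolding Iy sum.distrib sum_distrib_right[symmetric] ..
    also have "\<dots> \<le> P * D x y * (a * G) + a * D x y * G + a * (L * D x y)"
      unfolding p_sum[OF y] using p_lip[OF x y True] a G0 by (auto intro!: add_mono mult_right_mono)
    also have "\<dots> \<le> a * ((P + 2) * G + L) * D x y"
      using a G0 D_nonneg[of x y] by (simp add: algebra_simps)
    finally show ?thesis .
  qed
qed

lemma avg_lip: "lip B g \<Longrightarrow> lip (\<rho> * B) (avg g)"
  using contraction[of B g] \<rho> by (auto simp: lip_def avg_def wop_def)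

lemma avg_pow_lip: "lip B g \<Longrightarrow> lip (\<rho> ^ k * B) ((avg ^^ k) g)"
  by (induction k) (auto dest: avg_lip simp: mult.assoc)

lemma avg_pow_bound: "(\<And>x. x \<in> X \<Longrightarrow> cmod (g x) \<le> G) \<Longrightarrow> x \<in> X \<Longrightarrow> cmod ((avg ^^ k) g x) \<le> G"
  by (induction k arbitrary: x) (auto intro: avg_bound)

lemma avg_pow_linear:
  "x \<in> X \<Longrightarrow> (avg ^^ k) (\<lambda>x. g x + h x) x = (avg ^^ k) g x + (avg ^^ k) h x"
  "x \<in> X \<Longrightarrow> (avg ^^ k) (\<lambda>x. g x - h x) x = (avg ^^ k) g x - (avg ^^ k) h x"
  "x \<in> X \<Longrightarrow> (avg ^^ k) (\<lambda>_. c) x = c"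
  "x \<in> X \<Longrightarrow> (avg ^^ k) (\<lambda>x. c * g x) x = c * (avg ^^ k) g x"
proof (induction k arbitrary: x)
  case (Suc k)
  {
    case 1 then show ?case
      using wop_cong[OF 1 Suc(1), where m = "\<lambda>_ _. 1"] by (simp add: avg_def wop_add)
  next
    case 2 then show ?case
      using wop_cong[OF 2 Suc(2), where m = "\<lambda>_ _. 1"] by (simp add: avg_def wop_diff)
  next
    case 3 then show ?case
      using wop_cong[OF 3 Suc(3), where m = "\<lambda>_ _. 1"] avg_const[OF 3] by (simp add: avg_def)
  next
    case 4
    have "wop (\<lambda>_ _. 1) (\<lambda>x. c * (avg ^^ k) g x) x = c * wop (\<lambda>_ _. 1) ((avg ^^ k) g) x"
      by (simp add: wop_def sum_distrib_left algebra_simps)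
    then show ?case
      using wop_cong[OF 4 Suc(4), where m = "\<lambda>_ _. 1"] by (simp add: avg_def)
  }
qed auto

lemma mean_linear:
  "mean k (\<lambda>x. g x + h x) = mean k g + mean k h"
  "mean k (\<lambda>x. g x - h x) = mean k g - mean k h"
  "mean k (\<lambda>_. c) = c"
  "mean k (\<lambda>x. c * g x) = c * mean k g"
  using avg_pow_linear[OF x0] by (auto simp: mean_def)

lemma mean_cong: "(\<And>x. x \<in> X \<Longrightarrow> g x = h x) \<Longrightarrow> mean k g = mean k h"
proof -
  assume a: "\<And>x. x \<in> X \<Longrightarrow> g x = h x"
  have "x \<in> X \<Longrightarrow> (avg ^^ k) g x = (avg ^^ k) h x" for x
  proof (induction k arbitrary: x)
    case (Suc k)
    show ?case using wop_cong[OF Suc(2) Suc(1)] by (simp add: avg_def)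
  qed (auto simp: a)
  then show ?thesis using x0 by (simp add: mean_def)
qed

lemma mean_bound: "(\<And>x. x \<in> X \<Longrightarrow> cmod (g x) \<le> G) \<Longrightarrow> cmod (mean k g) \<le> G"
  unfolding mean_def by (intro avg_pow_bound x0)

text \<open>\<open>mean k\<close> fixes constants and is bounded by the supremum, so it may be
  applied to \<open>g\<close> minus its value at \<open>x\<close>. In particular a function of mean
  0 is bounded by its Lipschitz constant.\<close>

lemma lip_mean_bound:
  assumes "lip B g" "x \<in> X" shows "cmod (g x - mean k g) \<le> B"
proof -
  have "cmod (mean k (\<lambda>y. g y - g x)) \<le> B"
    by (rule mean_bound) (use assms lip_bound in blast)
  then show ?thesis by (simp add: mean_linear norm_minus_commute)
qed

text \<open>With \<open>h\<close> the k-th iterate of \<open>g\<close>, the difference is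
  \<open>avg h - h\<close> at the base point, and averaging moves a value by at most the oscillation
  of \<open>h\<close>.\<close>

lemma mean_avg:
  assumes "lip B g" shows "cmod (mean k (avg g) - mean k g) \<le> \<rho> ^ k * B"
proof -
  have h: "lip (\<rho> ^ k * B) ((avg ^^ k) g)" using avg_pow_lip[OF assms] .
  have "avg ((avg ^^ k) g) x0 - (avg ^^ k) g x0 = avg (\<lambda>y. (avg ^^ k) g y - (avg ^^ k) g x0) x0"
    using avg_const[OF x0, of "(avg ^^ k) g x0"] by (simp add: avg_def wop_diff)
  also have "cmod \<dots> \<le> \<rho> ^ k * B"
    by (rule avg_bound[OF x0]) (use lip_bound[OF h _ x0] in auto)
  finally show ?thesis by (simp add: mean_def funpow_swap1)
qed

end

text \<open>In the application \<open>\<Psi>\<close> and \<open>\<Phi>\<close> are Birkhoff sums of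
  \<open>\<psi>\<close> and \<open>\<phi>\<close> along a branch. The bound
  \<open>\<Phi> i x \<le> - c\<close> makes the mean respond to the second parameter at a definite
  rate.\<close>

locale perturbed_averaging_system = averaging_system +
  fixes \<Psi> \<Phi> :: "'b \<Rightarrow> 'a \<Rightarrow> real" and M c :: real
  assumes M1: "1 \<le> M" and c: "0 < c"
    and \<Psi>_bound: "x \<in> X \<Longrightarrow> i \<in> I x \<Longrightarrow> \<bar>\<Psi> i x\<bar> \<le> M"
    and \<Phi>_bound: "x \<in> X \<Longrightarrow> i \<in> I x \<Longrightarrow> \<bar>\<Phi> i x\<bar> \<le> M"
    and \<Phi>_neg: "x \<in> X \<Longrightarrow> i \<in> I x \<Longrightarrow> \<Phi> i x \<le> - c"
    and \<Psi>_lip: "x \<in> X \<Longrightarrow> y \<in> X \<Longrightarrow> D x y < 1 \<Longrightarrow> i \<in> I x \<Longrightarrow> \<bar>\<Psi> i x - \<Psi> i y\<bar> \<le> M * D x y"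
    and \<Phi>_lip: "x \<in> X \<Longrightarrow> y \<in> X \<Longrightarrow> D x y < 1 \<Longrightarrow> i \<in> I x \<Longrightarrow> \<bar>\<Phi> i x - \<Phi> i y\<bar> \<le> M * D x y"
begin

definition expo :: "complex \<Rightarrow> complex \<Rightarrow> 'b \<Rightarrow> 'a \<Rightarrow> complex" where
  "expo \<omega> \<sigma> i x = \<omega> * \<Psi> i x + \<sigma> * \<Phi> i x"

abbreviation pop :: "complex \<Rightarrow> complex \<Rightarrow> ('a \<Rightarrow> complex) \<Rightarrow> 'a \<Rightarrow> complex" where
  "pop \<omega> \<sigma> \<equiv> wop (\<lambda>i x. exp (expo \<omega> \<sigma> i x))"

lemma expo_bound:
  assumes "cmod \<omega> \<le> r" "cmod \<sigma> \<le> r" "x \<in> X" "i \<in> I x"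
  shows "cmod (expo \<omega> \<sigma> i x) \<le> 2 * M * r"
proof -
  have "cmod (expo \<omega> \<sigma> i x) \<le> cmod \<omega> * \<bar>\<Psi> i x\<bar> + cmod \<sigma> * \<bar>\<Phi> i x\<bar>"
    unfolding expo_def by (rule order_trans[OF norm_triangle_ineq]) (simp add: norm_mult)
  also have "\<dots> \<le> r * M + r * M"
    using assms \<Psi>_bound[OF assms(3,4)] \<Phi>_bound[OF assms(3,4)] M1 order_trans[OF norm_ge_zero assms(1)]
    by (intro add_mono mult_mono) auto
  finally show ?thesis by simp
qed

lemma expo_lip:
  assumes "cmod \<omega> \<le> r" "cmod \<sigma> \<le> r" "x \<in> X" "y \<in> X" "D x y < 1" "i \<in> I x"
  shows "cmod (expo \<omega> \<sigma> i x - expo \<omega> \<sigma> i y) \<le> 2 * M * r * D x y"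
proof -
  have "expo \<omega> \<sigma> i x - expo \<omega> \<sigma> i y = \<omega> * of_real (\<Psi> i x - \<Psi> i y) + \<sigma> * of_real (\<Phi> i x - \<Phi> i y)"
    by (simp add: expo_def algebra_simps)
  also have "cmod \<dots> \<le> cmod \<omega> * \<bar>\<Psi> i x - \<Psi> i y\<bar> + cmod \<sigma> * \<bar>\<Phi> i x - \<Phi> i y\<bar>"
    by (rule order_trans[OF norm_triangle_ineq]) (simp add: norm_mult flip: of_real_diff)
  also have "\<dots> \<le> r * (M * D x y) + r * (M * D x y)"
    using assms \<Psi>_lip[OF assms(3-)] \<Phi>_lip[OF assms(3-)] M1 order_trans[OF norm_ge_zero assms(1)]
    by (intro add_mono mult_mono) auto
  finally show ?thesis by simp
qed

context
  fixes r :: real and \<omega> :: complex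
  assumes r: "0 < r" "2 * M * r \<le> 1" and \<omega>: "cmod \<omega> \<le> r"
begin

text \<open>The condition \<open>2 * M * r \<le> 1\<close> is imposed for this bound: in the unit
  disc \<open>exp\<close> is 3-Lipschitz and its linearisation has a quadratic error.\<close>

lemma expo_le_1: "cmod \<sigma> \<le> r \<Longrightarrow> x \<in> X \<Longrightarrow> i \<in> I x \<Longrightarrow> cmod (expo \<omega> \<sigma> i x) \<le> 1"
  using expo_bound[OF \<omega>] r(2) by (meson order_trans)

lemma exp_weight:
  assumes "cmod \<sigma> \<le> r"
  shows "x \<in> X \<Longrightarrow> i \<in> I x \<Longrightarrow> cmod (exp (expo \<omega> \<sigma> i x) - 1) \<le> 6 * M * r"
    and "x \<in> X \<Longrightarrow> y \<in> X \<Longrightarrow> D x y < 1 \<Longrightarrow> i \<in> I x \<Longrightarrow>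
      cmod ((exp (expo \<omega> \<sigma> i x) - 1) - (exp (expo \<omega> \<sigma> i y) - 1)) \<le> 6 * M * r * D x y"
proof -
  assume x: "x \<in> X" and i: "i \<in> I x"
  show "cmod (exp (expo \<omega> \<sigma> i x) - 1) \<le> 6 * M * r"
    using norm_exp_diff_le[OF expo_le_1[OF assms x i], of 0] expo_bound[OF \<omega> assms x i] by simp
  assume y: "y \<in> X" and d: "D x y < 1"
  have "i \<in> I y" using I_eq[OF x y d] i by simp
  then show "cmod ((exp (expo \<omega> \<sigma> i x) - 1) - (exp (expo \<omega> \<sigma> i y) - 1)) \<le> 6 * M * r * D x y"
    using norm_exp_diff_le[OF expo_le_1[OF assms x i] expo_le_1[OF assms y, of i]] expo_lip[OF \<omega> assms x y d i]
    by simp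
qed

lemma pop_diff_lip:
  assumes "cmod \<sigma> \<le> r" "\<And>x. x \<in> X \<Longrightarrow> cmod (g x) \<le> G" "lip L g"
  shows "lip (6 * M * r * ((P + 2) * G + L)) (\<lambda>x. pop \<omega> \<sigma> g x - avg g x)"
    and "x \<in> X \<Longrightarrow> cmod (pop \<omega> \<sigma> g x - avg g x) \<le> 6 * M * r * G"
proof -
  have *: "(\<lambda>x. pop \<omega> \<sigma> g x - avg g x) = wop (\<lambda>i x. exp (expo \<omega> \<sigma> i x) - 1) g"
    by (simp add: fun_eq_iff wop_diff_weight avg_def)
  show "lip (6 * M * r * ((P + 2) * G + L)) (\<lambda>x. pop \<omega> \<sigma> g x - avg g x)"
    unfolding * by (rule wop_lip) (use exp_weight[OF assms(1)] assms r M1 in auto)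
  show "x \<in> X \<Longrightarrow> cmod (pop \<omega> \<sigma> g x - avg g x) \<le> 6 * M * r * G"
    unfolding fun_cong[OF *] by (rule wop_bound) (use exp_weight[OF assms(1)] assms r M1 in auto)
qed

text \<open>Changing \<open>\<sigma>\<close> multiplies the weight by
  \<open>exp ((\<sigma>1 - \<sigma>2) * \<Phi> i x)\<close>. The third estimate isolates the part
  linear in the change, which a Newton step can cancel. Its remainder
  \<open>9 * (M * S)^2 + 6 * M * r * (M * S)\<close> yields the constant 24 because
  \<open>S \<le> 2 * r\<close>.\<close>

lemma exp_weight2:
  assumes \<sigma>1: "cmod \<sigma>1 \<le> r" and \<sigma>2: "cmod \<sigma>2 \<le> r"
  defines "S \<equiv> cmod (\<sigma>1 - \<sigma>2)"
  shows "x \<in> X \<Longrightarrow> i \<in> I x \<Longrightarrow> cmod (exp (expo \<omega> \<sigma>1 i x) - exp (expo \<omega> \<sigma>2 i x)) \<le> 3 * M * S"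
    and "x \<in> X \<Longrightarrow> y \<in> X \<Longrightarrow> D x y < 1 \<Longrightarrow> i \<in> I x \<Longrightarrow>
      cmod ((exp (expo \<omega> \<sigma>1 i x) - exp (expo \<omega> \<sigma>2 i x)) - (exp (expo \<omega> \<sigma>1 i y) - exp (expo \<omega> \<sigma>2 i y)))
        \<le> 18 * M * S * D x y"
    and "x \<in> X \<Longrightarrow> i \<in> I x \<Longrightarrow>
      cmod (exp (expo \<omega> \<sigma>1 i x) - exp (expo \<omega> \<sigma>2 i x) - (\<sigma>1 - \<sigma>2) * \<Phi> i x) \<le> 24 * M\<^sup>2 * r * S"
proof -
  assume x: "x \<in> X" and i: "i \<in> I x"
  have S0: "0 \<le> S" by (simp add: S_def)
  have S2: "S \<le> 2 * r" using norm_triangle_ineq4[of \<sigma>1 \<sigma>2] \<sigma>1 \<sigma>2 by (simp add: S_def)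
  define \<delta> where "\<delta> = \<sigma>1 - \<sigma>2"
  have diff: "expo \<omega> \<sigma>1 i x - expo \<omega> \<sigma>2 i x = \<delta> * \<Phi> i x" for i x
    by (simp add: expo_def \<delta>_def algebra_simps)
  have d\<Phi>: "cmod (\<delta> * \<Phi> i x) \<le> M * S" if "x \<in> X" "i \<in> I x" for i x
    using \<Phi>_bound[OF that] S0 by (simp add: norm_mult S_def \<delta>_def mult.commute mult_right_mono)
  show e1: "cmod (exp (expo \<omega> \<sigma>1 i x) - exp (expo \<omega> \<sigma>2 i x)) \<le> 3 * M * S"
    using norm_exp_diff_le[OF expo_le_1[OF \<sigma>1 x i] expo_le_1[OF \<sigma>2 x i]] d\<Phi>[OF x i] by (simp add: diff)
  have MS1: "M * S \<le> 1"
    using mult_left_mono[OF S2, of M] M1 r by linarith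
  have d\<Phi>1: "cmod (\<delta> * \<Phi> i x) \<le> 1" if "x \<in> X" "i \<in> I x" for i x
    using d\<Phi>[OF that] MS1 by linarith
  have e: "exp (expo \<omega> \<sigma>1 i x) = exp (expo \<omega> \<sigma>2 i x) * exp (\<delta> * \<Phi> i x)" for i x
    using diff[of i x] by (simp flip: exp_add) (metis add.commute diff_add_cancel)
  have e3: "cmod (exp (expo \<omega> \<sigma>2 i x)) \<le> 3" if "x \<in> X" "i \<in> I x" for i x
  proof -
    have "cmod (exp (expo \<omega> \<sigma>2 i x)) \<le> exp 1"
      using norm_exp[of "expo \<omega> \<sigma>2 i x"] expo_le_1[OF \<sigma>2 that] by (auto intro: order_trans)
    then show ?thesis using exp_le by linarith
  qed
  {
    have "cmod (exp (expo \<omega> \<sigma>1 i x) - exp (expo \<omega> \<sigma>2 i x) - \<delta> * \<Phi> i x)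
      = cmod (exp (expo \<omega> \<sigma>2 i x) * (exp (\<delta> * \<Phi> i x) - 1 - \<delta> * \<Phi> i x) + (exp (expo \<omega> \<sigma>2 i x) - 1) * (\<delta> * \<Phi> i x))"
      by (simp add: e algebra_simps)
    also have "\<dots> \<le> 3 * (3 * (M * S)\<^sup>2) + 6 * M * r * (M * S)"
    proof (rule norm_triangle_le, rule add_mono; unfold norm_mult[of "exp (expo \<omega> \<sigma>2 i x)"] norm_mult[of "exp (expo \<omega> \<sigma>2 i x) - 1"])
      have "cmod (exp (\<delta> * \<Phi> i x) - 1 - \<delta> * \<Phi> i x) \<le> 3 * (M * S)\<^sup>2"
        using norm_exp_diff_linear_le[OF d\<Phi>1[OF x i]] power_mono[OF d\<Phi>[OF x i] norm_ge_zero, of 2] by linarith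
      then show "cmod (exp (expo \<omega> \<sigma>2 i x)) * cmod (exp (\<delta> * \<Phi> i x) - 1 - \<delta> * \<Phi> i x) \<le> 3 * (3 * (M * S)\<^sup>2)"
        using e3[OF x i] by (intro mult_mono) auto
      show "cmod (exp (expo \<omega> \<sigma>2 i x) - 1) * cmod (\<delta> * \<Phi> i x) \<le> 6 * M * r * (M * S)"
        using exp_weight(1)[OF \<sigma>2 x i] d\<Phi>[OF x i] M1 r by (intro mult_mono) auto
    qed
    also have "(M * S)\<^sup>2 \<le> M\<^sup>2 * (2 * r * S)"
      using mult_left_mono[OF mult_right_mono[OF S2 S0], of "M\<^sup>2"]
      by (simp only: power_mult_distrib power2_eq_square[of S]) simp
    finally show "cmod (exp (expo \<omega> \<sigma>1 i x) - exp (expo \<omega> \<sigma>2 i x) - (\<sigma>1 - \<sigma>2) * \<Phi> i x) \<le> 24 * M\<^sup>2 * r * S"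
      by (simp add: \<delta>_def power2_eq_square algebra_simps)
  }
  assume y: "y \<in> X" and d: "D x y < 1"
  have iy: "i \<in> I y" using I_eq[OF x y d] i by simp
  have "cmod (\<delta> * \<Phi> i x - \<delta> * \<Phi> i y) = S * \<bar>\<Phi> i x - \<Phi> i y\<bar>"
    by (simp add: S_def \<delta>_def norm_mult flip: right_diff_distrib of_real_diff)
  also have "\<dots> \<le> S * (M * D x y)"
    using \<Phi>_lip[OF x y d i] S0 by (intro mult_left_mono)
  finally have a: "cmod (exp (\<delta> * \<Phi> i x) - exp (\<delta> * \<Phi> i y)) \<le> 3 * (S * (M * D x y))"
    using norm_exp_diff_le[OF d\<Phi>1[OF x i] d\<Phi>1[OF y iy]] by linarith
  have b: "cmod (exp (expo \<omega> \<sigma>2 i x) - exp (expo \<omega> \<sigma>2 i y)) \<le> 3 * D x y"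
    using exp_weight(2)[OF \<sigma>2 x y d i] mult_right_mono[OF r(2) D_nonneg[of x y]] by simp
  have c': "cmod (exp (\<delta> * \<Phi> i y) - 1) \<le> 3 * (M * S)"
    using norm_exp_diff_le[OF d\<Phi>1[OF y iy], of 0] d\<Phi>[OF y iy] by simp
  have "cmod ((exp (expo \<omega> \<sigma>1 i x) - exp (expo \<omega> \<sigma>2 i x)) - (exp (expo \<omega> \<sigma>1 i y) - exp (expo \<omega> \<sigma>2 i y)))
    = cmod (exp (expo \<omega> \<sigma>2 i x) * (exp (\<delta> * \<Phi> i x) - exp (\<delta> * \<Phi> i y))
        + (exp (expo \<omega> \<sigma>2 i x) - exp (expo \<omega> \<sigma>2 i y)) * (exp (\<delta> * \<Phi> i y) - 1))"
    by (simp add: e algebra_simps)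
  also have "\<dots> \<le> 3 * (3 * (S * (M * D x y))) + 3 * D x y * (3 * (M * S))"
    by (rule norm_triangle_le, rule add_mono; unfold norm_mult[of "exp (expo \<omega> \<sigma>2 i x)"] norm_mult[of "exp (expo \<omega> \<sigma>2 i x) - exp (expo \<omega> \<sigma>2 i y)"];
        rule mult_mono[OF e3[OF x i] a] mult_mono[OF b c']) (use D_nonneg[of x y] in auto)
  finally show "cmod ((exp (expo \<omega> \<sigma>1 i x) - exp (expo \<omega> \<sigma>2 i x)) - (exp (expo \<omega> \<sigma>1 i y) - exp (expo \<omega> \<sigma>2 i y)))
        \<le> 18 * M * S * D x y"
    by (simp add: algebra_simps)
qed


end

end


section \<open>Prescribing the eigenvalue of a perturbed averaging operator\<close>

context perturbed_averaging_system begin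

lemma norm_minus_1_le:
  assumes "lip L g" "mean k g = 1" "x \<in> X" shows "cmod (g x - 1) \<le> L"
  using lip_mean_bound[OF assms(1,3), of k] assms(2) by simp

context
  fixes r :: real and \<omega> :: complex
  assumes r: "0 < r" "2 * M * r \<le> 1" and \<omega>: "cmod \<omega> \<le> r"
begin

text \<open>The difference \<open>h\<close> of the functions has mean 0, so \<open>B\<close> bounds
  it uniformly as well. Splitting the image into \<open>avg h\<close>, the perturbation of the
  operator on \<open>h\<close>, and the change of weights on \<open>g2\<close>, the first part
  contracts, the second is of order \<open>r\<close>, and the third is controlled by
  \<open>S\<close>. In the mean, \<open>avg h\<close> contributes only
  \<open>\<rho> ^ k * B\<close>, and the third part is linear in the parameter up to a small
  multiple of \<open>S\<close>.\<close>

lemma pop_contraction: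
  assumes \<sigma>: "cmod \<sigma>1 \<le> r" "cmod \<sigma>2 \<le> r" "cmod (\<sigma>1 - \<sigma>2) \<le> S"
    and mean: "mean k g1 = 1" "mean k g2 = 1"
    and lip: "lip B (\<lambda>x. g1 x - g2 x)" "lip \<kappa> g2" and \<kappa>: "\<kappa> \<le> 1"
  shows "lip ((\<rho> + 6 * M * r * (P + 3)) * B + 18 * M * (2 * P + 5) * S) (\<lambda>x. pop \<omega> \<sigma>1 g1 x - pop \<omega> \<sigma>2 g2 x)"
    and "cmod (mean k (\<lambda>x. pop \<omega> \<sigma>1 g1 x - pop \<omega> \<sigma>2 g2 x)
          - (\<sigma>1 - \<sigma>2) * mean k (wop (\<lambda>i x. of_real (\<Phi> i x)) (\<lambda>_. 1)))
        \<le> (\<rho> ^ k + 6 * M * r) * B + (24 * M\<^sup>2 * r + 3 * M * \<kappa>) * S"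
proof -
  define h where "h = (\<lambda>x. g1 x - g2 x)"
  define m where "m = (\<lambda>i x. exp (expo \<omega> \<sigma>1 i x) - exp (expo \<omega> \<sigma>2 i x))"
  have S0: "0 \<le> S" using \<sigma>(3) norm_ge_zero order_trans by blast
  have hB: "lip B h" using lip by (simp add: h_def)
  have mh: "mean k h = 0" using mean by (simp add: h_def mean_linear)
  have hb: "cmod (h x) \<le> B" if "x \<in> X" for x
    using lip_mean_bound[OF hB that, of k] mh by simp
  have g2b: "cmod (g2 x - 1) \<le> \<kappa>" if "x \<in> X" for x
    using norm_minus_1_le[OF lip(2) mean(2) that] .
  have g2b2: "cmod (g2 x) \<le> 2" if "x \<in> X" for x
    using g2b[OF that] \<kappa> norm_triangle_ineq[of "g2 x - 1" 1] by simp
  have dec: "(\<lambda>x. pop \<omega> \<sigma>1 g1 x - pop \<omega> \<sigma>2 g2 x) = (\<lambda>x. avg h x + (pop \<omega> \<sigma>1 h x - avg h x) + wop m g2 x)"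
    by (simp add: fun_eq_iff h_def m_def wop_diff wop_diff_weight)
  have m1: "cmod (m i x) \<le> 3 * M * S" if "x \<in> X" "i \<in> I x" for i x
    unfolding m_def by (rule order_trans[OF exp_weight2(1)[OF r \<omega> \<sigma>(1,2) that] mult_left_mono[OF \<sigma>(3)]]) (use M1 in simp)
  have m2: "cmod (m i x - m i y) \<le> 18 * M * S * D x y" if "x \<in> X" "y \<in> X" "D x y < 1" "i \<in> I x" for i x y
  proof -
    have "18 * M * cmod (\<sigma>1 - \<sigma>2) * D x y \<le> 18 * M * S * D x y"
      using \<sigma>(3) M1 D_nonneg[of x y] by (intro mult_right_mono mult_left_mono) auto
    then show ?thesis using exp_weight2(2)[OF r \<omega> \<sigma>(1,2) that] unfolding m_def by simp
  qed
  have m3: "cmod (m i x - (\<sigma>1 - \<sigma>2) * \<Phi> i x) \<le> 24 * M\<^sup>2 * r * S" if "x \<in> X" "i \<in> I x" for i x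
    unfolding m_def by (rule order_trans[OF exp_weight2(3)[OF r \<omega> \<sigma>(1,2) that] mult_left_mono[OF \<sigma>(3)]]) (use r(1) in simp)
  have "lip (18 * M * S * ((P + 2) * 2 + \<kappa>)) (wop m g2)"
  proof (rule wop_lip[OF _ _ m2 g2b2 lip(2)])
    show "0 \<le> 18 * M * S" using M1 S0 by simp
    fix i x assume "x \<in> X" "i \<in> I x"
    have "3 * (M * S) \<le> 18 * (M * S)" using M1 S0 by (intro mult_right_mono) auto
    then show "cmod (m i x) \<le> 18 * M * S" using m1[OF \<open>x \<in> X\<close> \<open>i \<in> I x\<close>] by simp
  qed
  moreover have "18 * M * S * ((P + 2) * 2 + \<kappa>) \<le> 18 * M * (2 * P + 5) * S"
    using mult_left_mono[of "(P + 2) * 2 + \<kappa>" "2 * P + 5" "18 * M * S"] \<kappa> M1 S0 by (simp add: algebra_simps)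
  ultimately have l3: "lip (18 * M * (2 * P + 5) * S) (wop m g2)" by (rule lip_mono)
  have "lip (\<rho> * B + 6 * M * r * ((P + 2) * B + B) + 18 * M * (2 * P + 5) * S)
      (\<lambda>x. avg h x + (pop \<omega> \<sigma>1 h x - avg h x) + wop m g2 x)"
    by (intro lip_add avg_lip[OF hB] pop_diff_lip(1)[OF r \<omega> \<sigma>(1) hb hB] l3)
  then show "lip ((\<rho> + 6 * M * r * (P + 3)) * B + 18 * M * (2 * P + 5) * S) (\<lambda>x. pop \<omega> \<sigma>1 g1 x - pop \<omega> \<sigma>2 g2 x)"
    unfolding dec by (simp add: algebra_simps)
  \<comment> \<open>The linear response is split off with \<open>g2\<close> replaced by 1. The error
    of that replacement is at most \<open>\<kappa>\<close> and accounts for the term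
    \<open>3 * M * \<kappa>\<close>.\<close>
  have dec2: "wop m g2 x = wop (\<lambda>i x. m i x - (\<sigma>1 - \<sigma>2) * \<Phi> i x) (\<lambda>_. 1) x
      + (\<sigma>1 - \<sigma>2) * wop (\<lambda>i x. of_real (\<Phi> i x)) (\<lambda>_. 1) x + wop m (\<lambda>x. g2 x - 1) x" for x
    by (simp add: wop_def sum_distrib_left algebra_simps sum.distrib sum_subtractf)
  have "mean k (\<lambda>x. pop \<omega> \<sigma>1 g1 x - pop \<omega> \<sigma>2 g2 x) - (\<sigma>1 - \<sigma>2) * mean k (wop (\<lambda>i x. of_real (\<Phi> i x)) (\<lambda>_. 1))
    = (mean k (avg h) - mean k h) + mean k (\<lambda>x. pop \<omega> \<sigma>1 h x - avg h x)
      + mean k (wop (\<lambda>i x. m i x - (\<sigma>1 - \<sigma>2) * \<Phi> i x) (\<lambda>_. 1)) + mean k (wop m (\<lambda>x. g2 x - 1))"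
    unfolding dec by (simp add: mean_linear mh dec2)
  also have "cmod \<dots> \<le> \<rho> ^ k * B + 6 * M * r * B + 24 * M\<^sup>2 * r * S * 1 + 3 * M * S * \<kappa>"
    by (intro norm_triangle_le add_mono mean_avg[OF hB] mean_bound pop_diff_lip(2)[OF r \<omega> \<sigma>(1) hb hB]
        wop_bound m1 m3 g2b) (use M1 S0 r(1) in auto)
  finally show "cmod (mean k (\<lambda>x. pop \<omega> \<sigma>1 g1 x - pop \<omega> \<sigma>2 g2 x)
          - (\<sigma>1 - \<sigma>2) * mean k (wop (\<lambda>i x. of_real (\<Phi> i x)) (\<lambda>_. 1)))
        \<le> (\<rho> ^ k + 6 * M * r) * B + (24 * M\<^sup>2 * r + 3 * M * \<kappa>) * S"
    by (simp add: algebra_simps)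
qed

end

text \<open>The derivative at \<open>\<sigma> = 0\<close> of the mean of
  \<open>pop 0 \<sigma> (\<lambda>_. 1)\<close>. It stays frozen during the iteration, which is
  therefore a simplified Newton method.\<close>

definition slope :: "nat \<Rightarrow> complex" where
  "slope k = mean k (wop (\<lambda>i x. of_real (\<Phi> i x)) (\<lambda>_. 1))"

text \<open>All values \<open>\<Phi> i x + M\<close> lie between 0 and \<open>M - c\<close>, so
  \<open>slope k + M\<close> has modulus at most \<open>M - c\<close>; the triangle inequality
  leaves at least \<open>c\<close> for \<open>slope k\<close>.\<close>

lemma slope_bound: "c \<le> cmod (slope k)"
proof -
  have "I x0 \<noteq> {}" using p_sum[OF x0] by auto
  then obtain i where i: "i \<in> I x0" by auto
  have Mc: "0 \<le> M - c" using \<Phi>_bound[OF x0 i] \<Phi>_neg[OF x0 i] by linarith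
  have "slope k + M = mean k (\<lambda>x. wop (\<lambda>i x. of_real (\<Phi> i x)) (\<lambda>_. 1) x + M)"
    by (simp add: slope_def mean_linear)
  also have "\<dots> = mean k (wop (\<lambda>i x. of_real (\<Phi> i x + M)) (\<lambda>_. 1))"
    by (rule mean_cong)
      (simp add: wop_def distrib_left sum.distrib p_sum_complex flip: sum_distrib_right)
  also have "cmod \<dots> \<le> (M - c) * 1"
  proof (intro mean_bound wop_bound Mc)
    fix i x assume "x \<in> X" "i \<in> I x"
    then show "cmod (of_real (\<Phi> i x + M)) \<le> M - c"
      using \<Phi>_bound[of x i] \<Phi>_neg[of x i] unfolding norm_of_real by linarith
  qed auto
  finally have "cmod (slope k + M) \<le> M - c" by simp
  moreover have "M \<le> cmod (slope k + M) + cmod (slope k)"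
    using norm_triangle_ineq4[of "slope k + M" "slope k"] M1 by simp
  ultimately show ?thesis by linarith
qed

text \<open>
  A fixed point \<open>(g, \<sigma>)\<close> of the following map satisfies \<open>pop \<omega> \<sigma> g = g\<close>: the eigenvalue is prescribed,
  and the parameter \<open>\<sigma>\<close> is corrected by a Newton step.
\<close>

definition step :: "nat \<Rightarrow> complex \<Rightarrow> ('a \<Rightarrow> complex) \<times> complex \<Rightarrow> ('a \<Rightarrow> complex) \<times> complex" where
  "step k \<omega> = (\<lambda>(g, \<sigma>). let a = pop \<omega> \<sigma> g in
     (\<lambda>x. a x - mean k a + 1, \<sigma> - (mean k a - 1) / slope k))"

definition eig_seq :: "nat \<Rightarrow> complex \<Rightarrow> nat \<Rightarrow> 'a \<Rightarrow> complex" where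
  "eig_seq k \<omega> n = fst ((step k \<omega> ^^ n) (\<lambda>_. 1, 0))"

definition par_seq :: "nat \<Rightarrow> complex \<Rightarrow> nat \<Rightarrow> complex" where
  "par_seq k \<omega> n = snd ((step k \<omega> ^^ n) (\<lambda>_. 1, 0))"

lemma seq_0: "eig_seq k \<omega> 0 = (\<lambda>_. 1)" "par_seq k \<omega> 0 = 0"
  by (simp_all add: eig_seq_def par_seq_def)

lemma seq_Suc:
  "eig_seq k \<omega> (Suc n) = (\<lambda>x. pop \<omega> (par_seq k \<omega> n) (eig_seq k \<omega> n) x
      - mean k (pop \<omega> (par_seq k \<omega> n) (eig_seq k \<omega> n)) + 1)"
  "par_seq k \<omega> (Suc n) = par_seq k \<omega> n - (mean k (pop \<omega> (par_seq k \<omega> n) (eig_seq k \<omega> n)) - 1) / slope k"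
  by (simp_all add: eig_seq_def par_seq_def step_def Let_def case_prod_beta)

lemma mean_eig_seq: "mean k (eig_seq k \<omega> n) = 1"
  by (cases n) (simp_all add: seq_0 seq_Suc mean_linear)

section \<open>Holomorphy, reality and limits of the iterates\<close>

lemma holomorphic_wop:
  assumes "x \<in> X" "\<And>i x. (\<lambda>\<omega>. m \<omega> i x) holomorphic_on S" "\<And>x. x \<in> X \<Longrightarrow> (\<lambda>\<omega>. g \<omega> x) holomorphic_on S"
  shows "(\<lambda>\<omega>. wop (m \<omega>) (g \<omega>) x) holomorphic_on S"
  unfolding wop_def using assms T_in by (intro holomorphic_intros) auto

lemma holomorphic_avg_pow:
  assumes "\<And>x. x \<in> X \<Longrightarrow> (\<lambda>\<omega>. g \<omega> x) holomorphic_on S"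
  shows "x \<in> X \<Longrightarrow> (\<lambda>\<omega>. (avg ^^ k) (g \<omega>) x) holomorphic_on S"
proof (induction k arbitrary: x)
  case (Suc k)
  show ?case
    using holomorphic_wop[OF Suc(2), of "\<lambda>_ _ _. 1" S "\<lambda>\<omega>. (avg ^^ k) (g \<omega>)"] Suc(1) by (simp add: avg_def)
qed (use assms in auto)

text \<open>The sums over branches are finite and so is the number of averagings in
  \<open>mean k\<close>, hence every iterate is holomorphic in \<open>\<omega>\<close> on any set;
  smallness of \<open>\<omega>\<close> enters only through convergence.\<close>

lemma holomorphic_seq:
  "(\<lambda>\<omega>. par_seq k \<omega> n) holomorphic_on S \<and> (\<forall>x\<in>X. (\<lambda>\<omega>. eig_seq k \<omega> n x) holomorphic_on S)"
proof (induction n)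
  case (Suc n)
  have nz: "slope k \<noteq> 0" using slope_bound[of k] c by auto
  have p: "(\<lambda>\<omega>. pop \<omega> (par_seq k \<omega> n) (eig_seq k \<omega> n) x) holomorphic_on S" if "x \<in> X" for x
    by (rule holomorphic_wop[OF that]) (use Suc in \<open>auto simp: expo_def intro!: holomorphic_intros\<close>)
  have "(\<lambda>\<omega>. mean k (pop \<omega> (par_seq k \<omega> n) (eig_seq k \<omega> n))) holomorphic_on S"
    unfolding mean_def using holomorphic_avg_pow[OF p x0] by simp
  then show ?case
    using Suc p nz by (auto simp: seq_Suc intro!: holomorphic_intros)
qed (simp add: seq_0)

lemma Reals_wop:
  assumes "x \<in> X" "\<And>i x. m i x \<in> \<real>" "\<And>x. x \<in> X \<Longrightarrow> g x \<in> \<real>" shows "wop m g x \<in> \<real>"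
  unfolding wop_def using assms T_in by (intro sum_in_Reals) (auto intro!: Reals_mult)

lemma Reals_mean:
  assumes "\<And>x. x \<in> X \<Longrightarrow> g x \<in> \<real>" shows "mean k g \<in> \<real>"
proof -
  have "x \<in> X \<Longrightarrow> (avg ^^ k) g x \<in> \<real>" for x
    by (induction k arbitrary: x) (auto simp: avg_def intro: assms Reals_wop)
  then show ?thesis using x0 by (simp add: mean_def)
qed

lemma Reals_seq:
  "\<omega> \<in> \<real> \<Longrightarrow> par_seq k \<omega> n \<in> \<real> \<and> (\<forall>x\<in>X. eig_seq k \<omega> n x \<in> \<real>)"
proof (induction n)
  case (Suc n)
  have s: "slope k \<in> \<real>" unfolding slope_def by (intro Reals_mean Reals_wop) auto
  have p: "pop \<omega> (par_seq k \<omega> n) (eig_seq k \<omega> n) x \<in> \<real>" if "x \<in> X" for x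
  proof (rule Reals_wop[OF that])
    fix i x
    have "expo \<omega> (par_seq k \<omega> n) i x \<in> \<real>"
      using Suc unfolding expo_def by (intro Reals_add Reals_mult) auto
    then show "exp (expo \<omega> (par_seq k \<omega> n) i x) \<in> \<real>"
      by (auto elim!: Reals_cases simp: exp_of_real)
  qed (use Suc in auto)
  have "mean k (pop \<omega> (par_seq k \<omega> n) (eig_seq k \<omega> n)) \<in> \<real>"
    by (rule Reals_mean) (rule p)
  then show ?case
    using Suc p s by (auto simp: seq_Suc)
qed (simp add: seq_0)

lemma tendsto_wop:
  assumes "x \<in> X" "\<And>i x. (\<lambda>n. m n i x) \<longlonglongrightarrow> m' i x" "\<And>x. x \<in> X \<Longrightarrow> (\<lambda>n. g n x) \<longlonglongrightarrow> g' x"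
  shows "(\<lambda>n. wop (m n) (g n) x) \<longlonglongrightarrow> wop m' g' x"
  unfolding wop_def using assms T_in by (intro tendsto_intros) auto

lemma tendsto_mean:
  assumes "\<And>x. x \<in> X \<Longrightarrow> (\<lambda>n. g n x) \<longlonglongrightarrow> g' x"
  shows "(\<lambda>n. mean k (g n)) \<longlonglongrightarrow> mean k g'"
proof -
  have "x \<in> X \<Longrightarrow> (\<lambda>n. (avg ^^ k) (g n) x) \<longlonglongrightarrow> (avg ^^ k) g' x" for x
    by (induction k arbitrary: x) (auto simp: avg_def intro: assms tendsto_wop)
  then show ?thesis using x0 by (simp add: mean_def)
qed

text \<open>The Newton correction removes the linear response of the mean to the parameter, so the
  new parameter error consists of the remainder in \<open>pop_contraction\<close>. Restoring the
  mean 1 adds a constant to the function, which Lipschitz bounds do not see.\<close>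

lemma seq_step_contraction:
  assumes r: "0 < r" "2 * M * r \<le> 1" and \<omega>: "cmod \<omega> \<le> r"
    and \<sigma>: "cmod (par_seq k \<omega> m) \<le> r" "cmod (par_seq k \<omega> n) \<le> r"
      "cmod (par_seq k \<omega> m - par_seq k \<omega> n) \<le> S"
    and lip: "lip B (\<lambda>x. eig_seq k \<omega> m x - eig_seq k \<omega> n x)" "lip \<kappa> (eig_seq k \<omega> n)" and \<kappa>: "\<kappa> \<le> 1"
  shows "lip ((\<rho> + 6 * M * r * (P + 3)) * B + 18 * M * (2 * P + 5) * S)
      (\<lambda>x. eig_seq k \<omega> (Suc m) x - eig_seq k \<omega> (Suc n) x)"
    and "cmod (par_seq k \<omega> (Suc m) - par_seq k \<omega> (Suc n))
      \<le> ((\<rho> ^ k + 6 * M * r) * B + (24 * M\<^sup>2 * r + 3 * M * \<kappa>) * S) / c"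
proof -
  define a where "a n = pop \<omega> (par_seq k \<omega> n) (eig_seq k \<omega> n)" for n
  note pc = pop_contraction[OF r \<omega> \<sigma> mean_eig_seq mean_eig_seq lip \<kappa>, folded a_def slope_def]
  have "(\<lambda>x. eig_seq k \<omega> (Suc m) x - eig_seq k \<omega> (Suc n) x)
      = (\<lambda>x. (a m x - a n x) + (mean k (a n) - mean k (a m)))"
    by (simp add: seq_Suc a_def fun_eq_iff)
  then show "lip ((\<rho> + 6 * M * r * (P + 3)) * B + 18 * M * (2 * P + 5) * S)
      (\<lambda>x. eig_seq k \<omega> (Suc m) x - eig_seq k \<omega> (Suc n) x)"
    using pc(1) by (simp only: lip_add_const)
  have sl: "slope k \<noteq> 0" "c \<le> cmod (slope k)" using slope_bound[of k] c by auto
  have "par_seq k \<omega> (Suc m) - par_seq k \<omega> (Suc n)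
      = - (mean k (\<lambda>x. a m x - a n x) - (par_seq k \<omega> m - par_seq k \<omega> n) * slope k) / slope k"
    using sl(1) by (simp add: seq_Suc mean_linear a_def field_simps)
  also have "cmod \<dots> \<le> ((\<rho> ^ k + 6 * M * r) * B + (24 * M\<^sup>2 * r + 3 * M * \<kappa>) * S) / c"
    unfolding norm_divide norm_minus_cancel
    by (rule frac_le[OF _ pc(2) c sl(2)]) (rule order_trans[OF norm_ge_zero pc(2)])
  finally show "cmod (par_seq k \<omega> (Suc m) - par_seq k \<omega> (Suc n))
      \<le> ((\<rho> ^ k + 6 * M * r) * B + (24 * M\<^sup>2 * r + 3 * M * \<kappa>) * S) / c" .
qed

text \<open>For \<open>\<omega> = 0\<close> and \<open>\<sigma> = 0\<close> the constant 1 is a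
  fixed point, so the first step is of the size of the perturbation.\<close>

lemma seq_first_step:
  assumes r: "0 < r" "2 * M * r \<le> 1" and \<omega>: "cmod \<omega> \<le> r"
  shows "lip (6 * M * r * (P + 2)) (\<lambda>x. eig_seq k \<omega> 1 x - eig_seq k \<omega> 0 x)"
    and "cmod (par_seq k \<omega> 1 - par_seq k \<omega> 0) \<le> 6 * M * r / c"
proof -
  define a where "a = pop \<omega> 0 (\<lambda>_. 1)"
  have z: "cmod 0 \<le> r" using r by simp
  have l1: "lip 0 (\<lambda>_. 1)" by (simp add: lip_def)
  have l: "lip (6 * M * r * (P + 2)) (\<lambda>x. a x - avg (\<lambda>_. 1) x)"
    using pop_diff_lip(1)[OF r \<omega> z, of "\<lambda>_. 1" 1 0] l1 by (simp add: a_def)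
  have b: "cmod (a x - avg (\<lambda>_. 1) x) \<le> 6 * M * r" if "x \<in> X" for x
    using pop_diff_lip(2)[OF r \<omega> z _ l1 that, of 1] by (simp add: a_def)
  have "lip (6 * M * r * (P + 2)) a"
    using l avg_const[of _ 1] by (simp add: lip_def)
  moreover have e: "(\<lambda>x. eig_seq k \<omega> 1 x - eig_seq k \<omega> 0 x) = (\<lambda>x. a x + (- mean k a))"
    unfolding One_nat_def by (simp add: seq_Suc seq_0 a_def)
  ultimately show "lip (6 * M * r * (P + 2)) (\<lambda>x. eig_seq k \<omega> 1 x - eig_seq k \<omega> 0 x)"
    unfolding e lip_add_const by simp
  have "mean k a - 1 = mean k (\<lambda>x. a x - 1)" by (simp add: mean_linear)
  also have "cmod \<dots> \<le> 6 * M * r"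
    by (rule mean_bound) (use b avg_const[of _ 1] in auto)
  finally have m: "cmod (mean k a - 1) \<le> 6 * M * r" .
  have "cmod (par_seq k \<omega> 1 - par_seq k \<omega> 0) = cmod (mean k a - 1) / cmod (slope k)"
    unfolding One_nat_def by (simp add: seq_Suc seq_0 a_def norm_divide)
  also have "\<dots> \<le> 6 * M * r / c"
    by (rule frac_le[OF _ m c slope_bound]) (use M1 r in auto)
  finally show "cmod (par_seq k \<omega> 1 - par_seq k \<omega> 0) \<le> 6 * M * r / c" .
qed

lemma eventually_mult_le_at_right:
  fixes a b :: real assumes "0 < b" shows "eventually (\<lambda>r. a * r \<le> b) (at_right 0)"
proof -
  have "((\<lambda>r. a * r) \<longlongrightarrow> a * 0) (at_right 0)" by (intro tendsto_intros)
  then have "eventually (\<lambda>r. a * r < b) (at_right 0)" using assms by (auto dest: order_tendstoD)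
  then show ?thesis by (rule eventually_mono) simp
qed

text \<open>The iteration contracts in the weighted norm \<open>B + V * S\<close>, not in
  \<open>B + S\<close>: a parameter error feeds into the function with the large factor
  \<open>18 * M * (2 * P + 5)\<close>, whereas the function error feeds back into the parameter with
  a factor that \<open>k\<close> and \<open>r\<close> make small. The radius \<open>r\<close> limits
  the parameters for which the estimates hold; \<open>R\<close> limits \<open>\<omega>\<close> so
  that the whole orbit stays within them.\<close>

lemma seq_estimates:
  obtains R k \<theta> \<eta> where "0 < R" "0 \<le> \<theta>" "\<theta> < 1" "0 \<le> \<eta>"
    "\<And>\<omega> n. cmod \<omega> \<le> R \<Longrightarrow> cmod (par_seq k \<omega> (Suc n) - par_seq k \<omega> n) \<le> \<eta> * \<theta> ^ n"
    "\<And>\<omega> n x. cmod \<omega> \<le> R \<Longrightarrow> x \<in> X \<Longrightarrow> cmod (eig_seq k \<omega> (Suc n) x - eig_seq k \<omega> n x) \<le> \<eta> * \<theta> ^ n"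
    "\<And>\<omega> n x. cmod \<omega> \<le> R \<Longrightarrow> x \<in> X \<Longrightarrow> cmod (eig_seq k \<omega> n x - 1) \<le> 1 / 2"
proof -
  \<comment> \<open>\<open>V\<close> is four times the feedback factor, which leaves that feedback
    the share \<open>V / 4\<close>. The choices are made in order: \<open>V\<close> from
    \<open>M\<close> and \<open>P\<close>, then \<open>k\<close> and \<open>r\<close> from
    \<open>V\<close>, finally \<open>R\<close> from \<open>r\<close>.\<close>
  define V where "V = 72 * M * (2 * P + 5)"
  define \<kappa> where "\<kappa> = min (1/2) (c / (24 * M))"
  define \<theta> where "\<theta> = (1 + \<rho>) / 2"
  have \<theta>: "0 \<le> \<theta>" "\<theta> < 1" "1 / 2 \<le> \<theta>" using \<rho> by (auto simp: \<theta>_def)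
  have "1 * 1 \<le> M * (2 * P + 5)" using M1 P_nonneg by (intro mult_mono) auto
  then have V1: "1 \<le> V" by (simp add: V_def)
  have \<kappa>: "0 < \<kappa>" "\<kappa> \<le> 1/2" "3 * M * \<kappa> \<le> c / 8" "\<kappa> \<le> 1"
  proof -
    have "3 * M * \<kappa> \<le> 3 * M * (c / (24 * M))"
      unfolding \<kappa>_def by (rule mult_left_mono) (use M1 in auto)
    then show "3 * M * \<kappa> \<le> c / 8" using M1 by simp
  qed (use M1 c in \<open>auto simp: \<kappa>_def\<close>)
  have gap: "0 < (1 - \<rho>) / 6 * c / V" using \<rho> c V1 by simp
  obtain k where "\<rho> ^ k < (1 - \<rho>) / 6 * c / V"
    using real_arch_pow_inv[OF gap \<rho>(2)] by auto
  then have k: "V * \<rho> ^ k / c \<le> (1 - \<rho>) / 6" using c V1 by (simp add: field_simps)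
  have "eventually (\<lambda>r. 2 * M * r \<le> 1 \<and> 24 * M\<^sup>2 * r \<le> c / 8 \<and> 6 * M * (P + 3) * r \<le> (1 - \<rho>) / 6 \<and>
      V * 6 * M / c * r \<le> (1 - \<rho>) / 6) (at_right 0)"
    by (intro eventually_conj eventually_mult_le_at_right) (use c \<rho> in auto)
  then have "eventually (\<lambda>r. 2 * M * r \<le> 1 \<and> 24 * M\<^sup>2 * r \<le> c / 8 \<and> 6 * M * (P + 3) * r \<le> (1 - \<rho>) / 6 \<and>
      V * 6 * M / c * r \<le> (1 - \<rho>) / 6 \<and> 0 < r) (at_right 0)"
    using eventually_at_right_less[of 0] by eventually_elim auto
  then obtain r where r: "0 < r" "2 * M * r \<le> 1" "24 * M\<^sup>2 * r \<le> c / 8" "6 * M * (P + 3) * r \<le> (1 - \<rho>) / 6"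
      "V * 6 * M / c * r \<le> (1 - \<rho>) / 6"
    using eventually_happens'[OF trivial_limit_at_right_real] by blast
  define C where "C = 6 * M * (P + 2) + V * (6 * M / c)"
  have "eventually (\<lambda>R. 1 * R \<le> r \<and> C * R \<le> (1 - \<theta>) * \<kappa> \<and> C * R \<le> (1 - \<theta>) * r) (at_right 0)"
    by (intro eventually_conj eventually_mult_le_at_right) (use r \<kappa> \<theta> in auto)
  then have "eventually (\<lambda>R. 1 * R \<le> r \<and> C * R \<le> (1 - \<theta>) * \<kappa> \<and> C * R \<le> (1 - \<theta>) * r \<and> 0 < R) (at_right 0)"
    using eventually_at_right_less[of 0] by eventually_elim auto
  then obtain R where "1 * R \<le> r \<and> C * R \<le> (1 - \<theta>) * \<kappa> \<and> C * R \<le> (1 - \<theta>) * r \<and> 0 < R"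
    using eventually_happens'[OF trivial_limit_at_right_real] by blast
  then have R: "0 < R" "R \<le> r" "C * R \<le> (1 - \<theta>) * \<kappa>" "C * R \<le> (1 - \<theta>) * r" by auto
  have C0: "0 \<le> C" using M1 P_nonneg V1 c by (simp add: C_def)
  define \<eta> where "\<eta> = C * R"
  have \<eta>0: "0 \<le> \<eta>" using C0 R by (simp add: \<eta>_def)
  have R2: "2 * M * R \<le> 1" using R(2) r(2) M1 mult_left_mono[of R r "2 * M"] by linarith
  \<comment> \<open>\<open>Q t h s\<close> says that the pair \<open>(h, s)\<close> has weighted
    norm at most \<open>t\<close>. Witnesses \<open>B\<close> and \<open>S\<close> stand in for the
    least Lipschitz bound.\<close>
  define Q where "Q t h s \<longleftrightarrow> (\<exists>B S. lip B h \<and> cmod s \<le> S \<and> B + V * S \<le> t)" for t h s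
  have Q_bounds: "lip t h" "cmod s \<le> t" if "Q t h s" for t h s
  proof -
    obtain B S where BS: "lip B h" "cmod s \<le> S" "B + V * S \<le> t" using \<open>Q t h s\<close> by (auto simp: Q_def)
    have S0: "0 \<le> S" using BS(2) norm_ge_zero order_trans by blast
    have B0: "0 \<le> B" using BS(1) by (simp add: lip_def)
    have "S \<le> V * S" using V1 S0 mult_right_mono[of 1 V S] by simp
    then have "B \<le> t" "S \<le> t" using BS(3) B0 S0 by linarith+
    then show "lip t h" "cmod s \<le> t" using lip_mono[OF BS(1)] BS(2) by auto
  qed
  have Q_add: "Q (t + t') (\<lambda>x. h x + h' x) (s + s')" if "Q t h s" "Q t' h' s'" for t t' h h' s s'
  proof -
    obtain B S B' S' where BS: "lip B h" "cmod s \<le> S" "B + V * S \<le> t" "lip B' h'" "cmod s' \<le> S'" "B' + V * S' \<le> t'"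
      using \<open>Q t h s\<close> \<open>Q t' h' s'\<close> by (auto simp: Q_def)
    have "lip (B + B') (\<lambda>x. h x + h' x)" using BS(1,4) by (rule lip_add)
    moreover have "cmod (s + s') \<le> S + S'" using BS(2,5) by (rule norm_triangle_mono)
    moreover have "B + B' + V * (S + S') \<le> t + t'" using BS(3,6) by (simp add: algebra_simps)
    ultimately show ?thesis unfolding Q_def by blast
  qed
    \<comment> \<open>A geometric sum bounds the total displacement after \<open>n\<close> steps, so
      the iterates remain where the one-step estimates apply.\<close>
    have small: "(1 - \<theta> ^ n) / (1 - \<theta>) * \<eta> \<le> \<kappa>" "(1 - \<theta> ^ n) / (1 - \<theta>) * \<eta> \<le> r" for n :: nat
    proof -
      have "(1 - \<theta> ^ n) * \<eta> \<le> 1 * \<eta>" using \<theta> \<eta>0 by (intro mult_right_mono) auto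
      then have "(1 - \<theta> ^ n) * \<eta> \<le> (1 - \<theta>) * \<kappa>" "(1 - \<theta> ^ n) * \<eta> \<le> (1 - \<theta>) * r"
        using R(3,4) by (auto simp: \<eta>_def)
      then show "(1 - \<theta> ^ n) / (1 - \<theta>) * \<eta> \<le> \<kappa>" "(1 - \<theta> ^ n) / (1 - \<theta>) * \<eta> \<le> r"
        using \<theta>(2) by (auto simp: pos_divide_le_eq mult.commute)
    qed
  have main: "Q ((1 - \<theta> ^ n) / (1 - \<theta>) * \<eta>) (\<lambda>x. eig_seq k \<omega> n x + (- 1)) (par_seq k \<omega> n) \<and>
      Q (\<eta> * \<theta> ^ n) (\<lambda>x. eig_seq k \<omega> (Suc n) x - eig_seq k \<omega> n x) (par_seq k \<omega> (Suc n) - par_seq k \<omega> n)"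
    if \<omega>: "cmod \<omega> \<le> R" for \<omega> n
  proof (induction n)
    case 0
    have "Q 0 (\<lambda>x. eig_seq k \<omega> 0 x + (- 1)) (par_seq k \<omega> 0)"
      unfolding Q_def by (rule exI[of _ 0], rule exI[of _ 0]) (simp add: seq_0 lip_def)
    moreover have \<eta>_eq: "6 * M * R * (P + 2) + V * (6 * M * R / c) = \<eta>"
      by (simp add: \<eta>_def C_def algebra_simps)
    moreover have "Q (\<eta> * \<theta> ^ 0) (\<lambda>x. eig_seq k \<omega> (Suc 0) x - eig_seq k \<omega> 0 x) (par_seq k \<omega> (Suc 0) - par_seq k \<omega> 0)"
      unfolding Q_def using seq_first_step[OF R(1) R2 \<omega>, of k] \<eta>_eq
      by (intro exI[of _ "6 * M * R * (P + 2)"] exI[of _ "6 * M * R / c"]) simp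
    ultimately show ?case by simp
  next
    case (Suc n)
    have "Q ((1 - \<theta> ^ n) / (1 - \<theta>) * \<eta> + \<eta> * \<theta> ^ n)
      (\<lambda>x. (eig_seq k \<omega> n x + (- 1)) + (eig_seq k \<omega> (Suc n) x - eig_seq k \<omega> n x))
      (par_seq k \<omega> n + (par_seq k \<omega> (Suc n) - par_seq k \<omega> n))"
      by (rule Q_add) (use Suc in auto)
    moreover have "(1 - \<theta> ^ n) / (1 - \<theta>) * \<eta> + \<eta> * \<theta> ^ n = (1 - \<theta> ^ Suc n) / (1 - \<theta>) * \<eta>"
      using \<theta>(2) by (simp add: field_simps)
    ultimately have 1: "Q ((1 - \<theta> ^ Suc n) / (1 - \<theta>) * \<eta>) (\<lambda>x. eig_seq k \<omega> (Suc n) x + (- 1)) (par_seq k \<omega> (Suc n))"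
      by (simp add: algebra_simps)
    have s1: "cmod (par_seq k \<omega> (Suc n)) \<le> r" using Q_bounds(2)[OF 1] small(2) by (rule order_trans)
    have s0: "cmod (par_seq k \<omega> n) \<le> r" using Q_bounds(2)[OF conjunct1[OF Suc]] small(2) by (rule order_trans)
    have l0: "lip \<kappa> (eig_seq k \<omega> n)"
      using lip_mono[OF Q_bounds(1)[OF conjunct1[OF Suc]] small(1)] by (simp only: lip_add_const)
    obtain B S where BS: "lip B (\<lambda>x. eig_seq k \<omega> (Suc n) x - eig_seq k \<omega> n x)"
      "cmod (par_seq k \<omega> (Suc n) - par_seq k \<omega> n) \<le> S" "B + V * S \<le> \<eta> * \<theta> ^ n"
      using Suc by (auto simp: Q_def)
    have S0: "0 \<le> S" using BS(2) norm_ge_zero order_trans by blast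
    have B0: "0 \<le> B" using BS(1) by (simp add: lip_def)
    have \<omega>r: "cmod \<omega> \<le> r" using \<omega> R by simp
    note sc = seq_step_contraction[OF r(1,2) \<omega>r s1 s0 BS(2,1) l0 \<kappa>(4)]
    have "(\<rho> + 6 * M * r * (P + 3)) * B + 18 * M * (2 * P + 5) * S
        + V * (((\<rho> ^ k + 6 * M * r) * B + (24 * M\<^sup>2 * r + 3 * M * \<kappa>) * S) / c)
      = (\<rho> + 6 * M * (P + 3) * r + V * \<rho> ^ k / c + V * 6 * M / c * r) * B
        + (V / 4 + V * (24 * M\<^sup>2 * r + 3 * M * \<kappa>) / c) * S"
      using c by (simp add: V_def field_simps)
    \<comment> \<open>For \<open>B\<close>: \<open>\<rho>\<close> and three terms of at most
      \<open>(1 - \<rho>) / 6\<close> add up to \<open>\<theta>\<close>. For \<open>S\<close>: the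
      share \<open>V / 4\<close> and a Newton remainder of at most \<open>V / 4\<close> give
      \<open>V / 2\<close>, which is at most \<open>\<theta> * V\<close>.\<close>
    also have "\<dots> \<le> \<theta> * B + (V / 2) * S"
    proof (intro add_mono mult_right_mono B0 S0)
      have "\<rho> + x + y + z \<le> (1 + \<rho>) / 2" if "x \<le> (1 - \<rho>) / 6" "y \<le> (1 - \<rho>) / 6" "z \<le> (1 - \<rho>) / 6" for x y z
        using that by argo
      from this[OF r(4) k r(5)]
      show "\<rho> + 6 * M * (P + 3) * r + V * \<rho> ^ k / c + V * 6 * M / c * r \<le> \<theta>"
        unfolding \<theta>_def .
      have "V * (24 * M\<^sup>2 * r + 3 * M * \<kappa>) \<le> V * (c / 4)"
        using r(3) \<kappa>(3) V1 by (intro mult_left_mono) auto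
      then show "V / 4 + V * (24 * M\<^sup>2 * r + 3 * M * \<kappa>) / c \<le> V / 2"
        using c by (simp add: field_simps)
    qed
    also have "\<dots> \<le> \<theta> * (B + V * S)"
      using mult_right_mono[OF \<theta>(3), of "V * S"] V1 S0 by (simp add: algebra_simps)
    also have "\<dots> \<le> \<theta> * (\<eta> * \<theta> ^ n)" using BS(3) \<theta>(1) by (rule mult_left_mono)
    also have "\<dots> = \<eta> * \<theta> ^ Suc n" by simp
    finally show ?case using 1 sc unfolding Q_def by blast
  qed
  show thesis
  proof (rule that[of R \<theta> \<eta> k])
    fix \<omega> n x assume \<omega>: "cmod \<omega> \<le> R"
    show "cmod (par_seq k \<omega> (Suc n) - par_seq k \<omega> n) \<le> \<eta> * \<theta> ^ n"
      using Q_bounds(2) main[OF \<omega>] by blast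
    assume x: "x \<in> X"
    have "lip (\<eta> * \<theta> ^ n) (\<lambda>x. eig_seq k \<omega> (Suc n) x - eig_seq k \<omega> n x)"
      using Q_bounds(1) main[OF \<omega>] by blast
    from lip_mean_bound[OF this x, of k]
    show "cmod (eig_seq k \<omega> (Suc n) x - eig_seq k \<omega> n x) \<le> \<eta> * \<theta> ^ n"
      by (simp add: mean_linear mean_eig_seq)
    have "lip ((1 - \<theta> ^ n) / (1 - \<theta>) * \<eta>) (eig_seq k \<omega> n)"
      using Q_bounds(1)[OF conjunct1[OF main[OF \<omega>]]] by (simp only: lip_add_const)
    from norm_minus_1_le[OF this mean_eig_seq x]
    show "cmod (eig_seq k \<omega> n x - 1) \<le> 1 / 2"
      using small(1)[of n] \<kappa>(2) by linarith
  qed (use R \<theta> \<eta>0 in auto)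
qed

text \<open>The increments are dominated by a geometric series uniformly for
  \<open>cmod \<omega> \<le> R\<close>, so the limit of the parameters is holomorphic by the
  Weierstrass test. The eigenfunction is taken as a pointwise limit at real arguments, where all
  iterates are real and within \<open>1 / 2\<close> of 1.\<close>

theorem implicit_parameter:
  "\<exists>R>0. \<exists>\<sigma>. \<sigma> holomorphic_on ball 0 R \<and> (\<forall>w::real. \<bar>w\<bar> < R \<longrightarrow> \<sigma> (of_real w) \<in> \<real> \<and>
     (\<exists>g :: 'a \<Rightarrow> real. (\<forall>x\<in>X. 1 / 2 \<le> g x \<and> g x \<le> 2) \<and>
       (\<forall>x\<in>X. (\<Sum>i\<in>I x. p i x * exp (w * \<Psi> i x + Re (\<sigma> (of_real w)) * \<Phi> i x) * g (T i x)) = g x)))"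
proof -
  obtain R k \<theta> \<eta> where R: "0 < R" "0 \<le> \<theta>" "\<theta> < 1" "0 \<le> \<eta>"
    and par: "\<And>\<omega> n. cmod \<omega> \<le> R \<Longrightarrow> cmod (par_seq k \<omega> (Suc n) - par_seq k \<omega> n) \<le> \<eta> * \<theta> ^ n"
    and eig: "\<And>\<omega> n x. cmod \<omega> \<le> R \<Longrightarrow> x \<in> X \<Longrightarrow> cmod (eig_seq k \<omega> (Suc n) x - eig_seq k \<omega> n x) \<le> \<eta> * \<theta> ^ n"
    and half: "\<And>\<omega> n x. cmod \<omega> \<le> R \<Longrightarrow> x \<in> X \<Longrightarrow> cmod (eig_seq k \<omega> n x - 1) \<le> 1 / 2"
    by (rule seq_estimates) blast
  define \<sigma> where "\<sigma> \<omega> = (\<Sum>n. par_seq k \<omega> (Suc n) - par_seq k \<omega> n)" for \<omega>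
  have smb: "summable (\<lambda>n. \<eta> * \<theta> ^ n)" using R by (intro summable_mult summable_geometric) auto
  have "uniform_limit (cball 0 R) (\<lambda>n \<omega>. \<Sum>i<n. par_seq k \<omega> (Suc i) - par_seq k \<omega> i) \<sigma> sequentially"
    unfolding \<sigma>_def by (rule Weierstrass_m_test[OF _ smb]) (simp add: par)
  then have ul: "uniform_limit (cball 0 R) (\<lambda>n \<omega>. par_seq k \<omega> n) \<sigma> sequentially"
    by (simp add: sum_lessThan_telescope[of "par_seq k _"] seq_0)
  have hol: "\<sigma> holomorphic_on ball 0 R"
  proof (rule holomorphic_uniform_limit[OF _ ul])
    show "\<forall>\<^sub>F n in sequentially. continuous_on (cball 0 R) (\<lambda>\<omega>. par_seq k \<omega> n) \<and> (\<lambda>\<omega>. par_seq k \<omega> n) holomorphic_on ball 0 R"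
      using holomorphic_seq by (auto intro!: always_eventually holomorphic_on_imp_continuous_on)
  qed auto
  have sol: "\<sigma> (of_real w) \<in> \<real> \<and> (\<exists>g :: 'a \<Rightarrow> real. (\<forall>x\<in>X. 1 / 2 \<le> g x \<and> g x \<le> 2) \<and>
       (\<forall>x\<in>X. (\<Sum>i\<in>I x. p i x * exp (w * \<Psi> i x + Re (\<sigma> (of_real w)) * \<Phi> i x) * g (T i x)) = g x))"
    if w: "\<bar>w\<bar> < R" for w :: real
  proof -
    define \<omega> where "\<omega> = complex_of_real w"
    have \<omega>: "cmod \<omega> \<le> R" using w by (simp add: \<omega>_def)
    have \<sigma>: "(\<lambda>n. par_seq k \<omega> n) \<longlonglongrightarrow> \<sigma> \<omega>"
      by (rule tendsto_uniform_limitI[OF ul]) (use \<omega> in simp)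
    define g where "g x = 1 + (\<Sum>n. eig_seq k \<omega> (Suc n) x - eig_seq k \<omega> n x)" for x
    have g: "(\<lambda>n. eig_seq k \<omega> n x) \<longlonglongrightarrow> g x" if x: "x \<in> X" for x
    proof -
      have "summable (\<lambda>n. eig_seq k \<omega> (Suc n) x - eig_seq k \<omega> n x)"
        by (rule summable_comparison_test[OF _ smb]) (use eig[OF \<omega> x] in auto)
      from summable_LIMSEQ[OF this]
      have "(\<lambda>n. 1 + (eig_seq k \<omega> n x - eig_seq k \<omega> 0 x)) \<longlonglongrightarrow> g x"
        unfolding g_def sum_lessThan_telescope[of "\<lambda>n. eig_seq k \<omega> n x"] by (intro tendsto_add tendsto_const)
      then show ?thesis by (simp add: seq_0)
    qed
    have \<sigma>R: "\<sigma> \<omega> \<in> \<real>"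
      by (rule Lim_in_closed_set[OF closed_complex_Reals _ _ \<sigma>]) (use Reals_seq[of \<omega> k] in \<open>auto simp: \<omega>_def\<close>)
    have gR: "g x \<in> \<real>" if x: "x \<in> X" for x
      by (rule Lim_in_closed_set[OF closed_complex_Reals _ _ g[OF x]]) (use Reals_seq[of \<omega> k] x in \<open>auto simp: \<omega>_def\<close>)
    have gh: "cmod (g x - 1) \<le> 1 / 2" if x: "x \<in> X" for x
      by (rule Lim_norm_ubound[of sequentially "\<lambda>n. eig_seq k \<omega> n x - 1"])
         (use half[OF \<omega> x] g[OF x] in \<open>auto intro!: tendsto_intros\<close>)
    define a where "a = pop \<omega> (\<sigma> \<omega>) g"
    have pl: "(\<lambda>n. pop \<omega> (par_seq k \<omega> n) (eig_seq k \<omega> n) x) \<longlonglongrightarrow> a x" if "x \<in> X" for x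
      unfolding a_def expo_def by (rule tendsto_wop[OF that]) (auto intro!: tendsto_intros \<sigma> g)
    have ml: "(\<lambda>n. mean k (pop \<omega> (par_seq k \<omega> n) (eig_seq k \<omega> n))) \<longlonglongrightarrow> mean k a"
      by (rule tendsto_mean) (rule pl)
    have sl: "slope k \<noteq> 0" using slope_bound[of k] c by auto
    \<comment> \<open>In the limit the Newton correction must vanish, which forces the mean to be 1.
      The normalisation in the other component is then trivial, and the limit is a genuine fixed
      point.\<close>
    have "(\<lambda>n. par_seq k \<omega> (Suc n)) \<longlonglongrightarrow> \<sigma> \<omega> - (mean k a - 1) / slope k"
      unfolding seq_Suc by (intro tendsto_intros \<sigma> ml sl)
    from LIMSEQ_unique[OF this LIMSEQ_Suc[OF \<sigma>]] sl have m1: "mean k a = 1" by simp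
    have fix_g: "g x = a x" if x: "x \<in> X" for x
    proof -
      have "(\<lambda>n. eig_seq k \<omega> (Suc n) x) \<longlonglongrightarrow> a x - mean k a + 1"
        unfolding seq_Suc by (intro tendsto_intros pl[OF x] ml)
      from LIMSEQ_unique[OF this LIMSEQ_Suc[OF g[OF x]]] show ?thesis by (simp add: m1)
    qed
    have "(\<Sum>i\<in>I x. p i x * exp (w * \<Psi> i x + Re (\<sigma> \<omega>) * \<Phi> i x) * Re (g (T i x))) = Re (g x)" if x: "x \<in> X" for x
    proof -
      have s: "\<sigma> \<omega> = of_real (Re (\<sigma> \<omega>))" using \<sigma>R by (simp add: of_real_Re)
      have "g x = (\<Sum>i\<in>I x. complex_of_real (p i x * exp (w * \<Psi> i x + Re (\<sigma> \<omega>) * \<Phi> i x) * Re (g (T i x))))"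
        unfolding fix_g[OF x] a_def wop_def
      proof (rule sum.cong[OF refl])
        fix i assume "i \<in> I x"
        then have gT: "g (T i x) = of_real (Re (g (T i x)))" using gR T_in x by (simp add: of_real_Re)
        have "expo \<omega> (\<sigma> \<omega>) i x = of_real (w * \<Psi> i x + Re (\<sigma> \<omega>) * \<Phi> i x)"
          unfolding expo_def using s \<omega>_def by simp
        then have ex: "exp (expo \<omega> (\<sigma> \<omega>) i x) = of_real (exp (w * \<Psi> i x + Re (\<sigma> \<omega>) * \<Phi> i x))"
          by (simp only: exp_of_real)
        show "complex_of_real (p i x) * (exp (expo \<omega> (\<sigma> \<omega>) i x) * g (T i x))
          = complex_of_real (p i x * exp (w * \<Psi> i x + Re (\<sigma> \<omega>) * \<Phi> i x) * Re (g (T i x)))"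
          unfolding ex of_real_mult by (simp add: mult.assoc flip: gT)
      qed
      from arg_cong[OF this, of Re] show ?thesis
        unfolding of_real_sum[symmetric] Re_complex_of_real by (rule sym)
    qed
    moreover have "1 / 2 \<le> Re (g x) \<and> Re (g x) \<le> 2" if "x \<in> X" for x
      using gh[OF that] abs_Re_le_cmod[of "g x - 1"] by (auto simp: abs_le_iff)
    ultimately show ?thesis
      using \<sigma>R unfolding \<omega>_def[symmetric] by (intro conjI exI[of _ "\<lambda>x. Re (g x)"] ballI) auto
  qed
  show ?thesis
    by (rule exI[of _ R], rule conjI[OF R(1)], rule exI[of _ \<sigma>], rule conjI[OF hol]) (intro allI impI sol)
qed

end


section \<open>The shift space and its transfer operators\<close>

definition prepend :: "'e list \<Rightarrow> (nat \<Rightarrow> 'e) \<Rightarrow> nat \<Rightarrow> 'e" where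
  "prepend w u = (\<lambda>k. if k < length w then w ! k else u (k - length w))"

lemma prepend_Nil [simp]: "prepend [] u = u"
  by (simp add: prepend_def)

lemma prepend_append: "prepend (w @ v) u = prepend w (prepend v u)"
  by (auto simp: prepend_def fun_eq_iff nth_append)

lemma funpow_shift: "(shift ^^ n) u = (\<lambda>k. u (n + k))"
  by (induction n arbitrary: u) (simp_all add: funpow_Suc_right shift_def del: funpow.simps)

lemma funpow_shift_prepend: "k \<le> length w \<Longrightarrow> (shift ^^ k) (prepend w u) = prepend (drop k w) u"
  by (auto simp: funpow_shift prepend_def fun_eq_iff add.commute)

lemma prepend_0: "w \<noteq> [] \<Longrightarrow> prepend w u 0 = hd w"
  by (simp add: prepend_def hd_conv_nth)

lemma birkhoff_0 [simp]: "birkhoff f 0 u = 0"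
  by (simp add: birkhoff_def)

lemma birkhoff_add: "birkhoff f (n + m) u = birkhoff f n u + birkhoff f m ((shift ^^ n) u)"
  by (induction m) (simp_all add: birkhoff_def funpow_shift ac_simps)

lemma birkhoff_prepend_append:
  "birkhoff f (length w + length v) (prepend (w @ v) u)
    = birkhoff f (length w) (prepend w (prepend v u)) + birkhoff f (length v) (prepend v u)"
  by (simp add: birkhoff_add prepend_append funpow_shift_prepend)

lemma birkhoff_linear:
  "birkhoff (\<lambda>u. a * f u + b * g u) n u = a * birkhoff f n u + b * birkhoff g n u"
  by (simp add: birkhoff_def sum.distrib sum_distrib_left)

section \<open>The metrics of the shift space and Lipschitz functions\<close>

lemma shift_dist_nonneg: "0 < \<beta> \<Longrightarrow> 0 \<le> shift_dist \<beta> u v"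
  by (simp add: shift_dist_def)

lemma shift_dist_le_1: "0 < \<beta> \<Longrightarrow> \<beta> < 1 \<Longrightarrow> shift_dist \<beta> u v \<le> 1"
  by (simp add: shift_dist_def power_le_one)

lemma shift_dist_agree:
  assumes "0 < \<beta>" "\<beta> < 1" "\<And>k. k < n \<Longrightarrow> u k = v k"
  shows "shift_dist \<beta> u v \<le> \<beta> ^ n"
proof (cases "u = v")
  case False
  then obtain m where m: "u m \<noteq> v m" by auto
  have "n \<le> (LEAST m. u m \<noteq> v m)"
    by (rule LeastI2[of _ m]) (use m assms(3) not_less in blast)+
  then show ?thesis using False assms by (simp add: shift_dist_def power_decreasing)
qed (use assms in \<open>simp add: shift_dist_def\<close>)

lemma shift_dist_neq_0: "u 0 \<noteq> v 0 \<Longrightarrow> shift_dist \<beta> u v = 1"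
  by (auto simp: shift_dist_def)

lemma shift_dist_prepend:
  assumes \<beta>: "0 < \<beta>" "\<beta> < 1"
  shows "shift_dist \<beta> (prepend w u) (prepend w v) \<le> \<beta> ^ length w * shift_dist \<beta> u v"
proof (cases "u = v")
  case False
  define n where "n = (LEAST n. u n \<noteq> v n)"
  have "u k = v k" if "k < n" for k
    using not_less_Least[OF that[unfolded n_def]] by auto
  then have "shift_dist \<beta> (prepend w u) (prepend w v) \<le> \<beta> ^ (length w + n)"
    by (intro shift_dist_agree \<beta>) (auto simp: prepend_def)
  then show ?thesis using False by (simp add: shift_dist_def n_def power_add)
qed (simp add: shift_dist_def)

lemma shift_dist_mono: "0 < \<beta> \<Longrightarrow> \<beta> \<le> \<beta>' \<Longrightarrow> shift_dist \<beta> u v \<le> shift_dist \<beta>' u v"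
  by (simp add: shift_dist_def power_mono)

lemma shift_dist_powr: "0 < \<gamma> \<Longrightarrow> 0 < \<theta> \<Longrightarrow> shift_dist \<gamma> u v powr \<theta> = shift_dist (\<gamma> powr \<theta>) u v"
  by (simp add: shift_dist_def powr_powr mult.commute flip: powr_realpow)

definition lip_shift :: "('v, 'e) pre_digraph \<Rightarrow> real \<Rightarrow> real \<Rightarrow> ((nat \<Rightarrow> 'e) \<Rightarrow> real) \<Rightarrow> bool" where
  "lip_shift G \<beta> C f \<longleftrightarrow> 0 \<le> C \<and>
     (\<forall>u\<in>shift_space G. \<forall>v\<in>shift_space G. \<bar>f u - f v\<bar> \<le> C * shift_dist \<beta> u v)"

text \<open>A power of one of the metrics is the metric with ratio
  \<open>\<gamma> powr \<theta>\<close>, so Hoelder functions are Lipschitz for another member of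
  the same family. Different exponents are later brought to a common ratio by
  \<open>lip_shift_mono\<close>.\<close>

lemma hoelder_imp_lip:
  assumes "hoelder G \<gamma> f" "0 < \<gamma>" "\<gamma> < 1"
  obtains \<beta> C where "0 < \<beta>" "\<beta> < 1" "lip_shift G \<beta> C f"
proof -
  obtain C \<theta> where \<theta>: "0 < \<theta>" and C: "\<And>u v. u \<in> shift_space G \<Longrightarrow> v \<in> shift_space G \<Longrightarrow>
      \<bar>f u - f v\<bar> \<le> C * shift_dist \<gamma> u v powr \<theta>"
    using assms(1) unfolding hoelder_def by blast
  have "\<gamma> powr \<theta> < 1" using assms \<theta> by (simp add: powr01_less_one)
  moreover have "lip_shift G (\<gamma> powr \<theta>) \<bar>C\<bar> f"
    unfolding lip_shift_def
  proof (intro conjI ballI)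
    fix u v assume uv: "u \<in> shift_space G" "v \<in> shift_space G"
    have "C * shift_dist (\<gamma> powr \<theta>) u v \<le> \<bar>C\<bar> * shift_dist (\<gamma> powr \<theta>) u v"
      using assms by (intro mult_right_mono shift_dist_nonneg) auto
    then show "\<bar>f u - f v\<bar> \<le> \<bar>C\<bar> * shift_dist (\<gamma> powr \<theta>) u v"
      using C[OF uv] shift_dist_powr[OF assms(2) \<theta>, of u v] by simp
  qed auto
  ultimately show thesis using that[of "\<gamma> powr \<theta>" "\<bar>C\<bar>"] assms by simp
qed

lemma lip_shift_mono:
  assumes "lip_shift G \<beta> C f" "0 < \<beta>" "\<beta> \<le> \<beta>'" shows "lip_shift G \<beta>' C f"
  unfolding lip_shift_def
proof (intro conjI ballI)
  show C: "0 \<le> C" using assms(1) by (simp add: lip_shift_def)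
  fix u v assume "u \<in> shift_space G" "v \<in> shift_space G"
  then have "\<bar>f u - f v\<bar> \<le> C * shift_dist \<beta> u v" using assms(1) by (simp add: lip_shift_def)
  also have "\<dots> \<le> C * shift_dist \<beta>' u v" using shift_dist_mono[OF assms(2,3)] C by (rule mult_left_mono)
  finally show "\<bar>f u - f v\<bar> \<le> C * shift_dist \<beta>' u v" .
qed

lemma lip_shift_linear:
  assumes "lip_shift G \<beta> C f" "lip_shift G \<beta> C' g" "0 < \<beta>"
  shows "lip_shift G \<beta> (\<bar>a\<bar> * C + \<bar>b\<bar> * C') (\<lambda>u. a * f u + b * g u)"
  unfolding lip_shift_def
proof (intro conjI ballI)
  show "0 \<le> \<bar>a\<bar> * C + \<bar>b\<bar> * C'" using assms by (simp add: lip_shift_def)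
  fix u v assume uv: "u \<in> shift_space G" "v \<in> shift_space G"
  have "a * f u + b * g u - (a * f v + b * g v) = a * (f u - f v) + b * (g u - g v)"
    by (simp add: algebra_simps)
  also have "\<bar>\<dots>\<bar> \<le> \<bar>a\<bar> * \<bar>f u - f v\<bar> + \<bar>b\<bar> * \<bar>g u - g v\<bar>"
    by (rule order_trans[OF abs_triangle_ineq]) (simp add: abs_mult)
  also have "\<dots> \<le> \<bar>a\<bar> * (C * shift_dist \<beta> u v) + \<bar>b\<bar> * (C' * shift_dist \<beta> u v)"
    using assms uv by (intro add_mono mult_left_mono) (auto simp: lip_shift_def)
  finally show "\<bar>a * f u + b * g u - (a * f v + b * g v)\<bar> \<le> (\<bar>a\<bar> * C + \<bar>b\<bar> * C') * shift_dist \<beta> u v"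
    by (simp add: algebra_simps)
qed

locale shift_graph = fin_digraph G for G :: "('v, 'e) pre_digraph" +
  assumes sc: "strongly_connected G" and arcs_ne: "arcs G \<noteq> {}"
begin

abbreviation X :: "(nat \<Rightarrow> 'e) set" where "X \<equiv> shift_space G"

section \<open>Words, cylinders and inverse branches of a strongly connected graph\<close>

lemma funpow_shift_in: "u \<in> X \<Longrightarrow> (shift ^^ n) u \<in> X"
  by (simp add: shift_space_def funpow_shift)

text \<open>Admissibility of a nonempty prefix depends on \<open>y\<close> only through
  \<open>y 0\<close>. This is why points with the same first letter have the same inverse
  branches.\<close>

lemma prepend_in_iff:
  assumes "y \<in> X" "w \<noteq> []"
  shows "prepend w y \<in> X \<longleftrightarrow> w \<in> words G (length w) \<and> head G (last w) = tail G (y 0)"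
proof
  assume a: "prepend w y \<in> X"
  have "head G (prepend w y (length w - 1)) = tail G (prepend w y (Suc (length w - 1)))"
    using a unfolding shift_space_def by blast
  then have "head G (last w) = tail G (y 0)"
    using assms(2) by (simp add: prepend_def last_conv_nth)
  moreover have "set w \<subseteq> arcs G"
  proof
    fix e assume "e \<in> set w"
    then obtain k where "k < length w" "e = w ! k" by (auto simp: in_set_conv_nth)
    moreover have "prepend w y k \<in> arcs G" using a by (simp add: shift_space_def)
    ultimately show "e \<in> arcs G" by (simp add: prepend_def)
  qed
  moreover have "head G (w ! k) = tail G (w ! Suc k)" if "Suc k < length w" for k
  proof -
    have "head G (prepend w y k) = tail G (prepend w y (Suc k))" using a by (simp add: shift_space_def)
    then show ?thesis using that by (simp add: prepend_def)
  qed
  ultimately show "w \<in> words G (length w) \<and> head G (last w) = tail G (y 0)"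
    by (simp add: words_def)
next
  assume a: "w \<in> words G (length w) \<and> head G (last w) = tail G (y 0)"
  have "prepend w y k \<in> arcs G" for k
    using a assms by (auto simp: prepend_def words_def shift_space_def)
  moreover have "head G (prepend w y k) = tail G (prepend w y (Suc k))" for k
  proof -
    consider "Suc k < length w" | "Suc k = length w" | "length w \<le> k" by linarith
    then show ?thesis
    proof cases
      case 2
      then have "w ! k = last w" using assms(2) by (metis diff_Suc_1 last_conv_nth)
      then show ?thesis using a 2 by (simp add: prepend_def)
    next
      case 3
      then show ?thesis using assms(1) by (simp add: prepend_def shift_space_def Suc_diff_le)
    qed (use a in \<open>simp add: prepend_def words_def\<close>)
  qed
  ultimately show "prepend w y \<in> X" by (simp add: shift_space_def)
qed

lemma prepend_in_imp: "prepend w y \<in> X \<Longrightarrow> y \<in> X"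
  using funpow_shift_in[of "prepend w y" "length w"] by (simp add: funpow_shift_prepend)

lemma prefix_in_words: "u \<in> X \<Longrightarrow> map u [0..<n] \<in> words G n"
  by (auto simp: words_def shift_space_def)

lemma prepend_in_words: "prepend w y \<in> X \<Longrightarrow> w \<in> words G (length w)"
proof -
  assume "prepend w y \<in> X"
  moreover have "map (prepend w y) [0..<length w] = w"
    by (rule nth_equalityI) (auto simp: prepend_def)
  ultimately show ?thesis using prefix_in_words[of "prepend w y" "length w"] by simp
qed

lemma finite_words: "finite (words G n)"
  by (rule finite_subset[OF _ finite_lists_length_eq[OF finite_arcs, of n]]) (auto simp: words_def)

lemma ex_connecting:
  assumes "e \<in> arcs G" "y \<in> X"
  shows "\<exists>w. w \<noteq> [] \<and> hd w = e \<and> prepend w y \<in> X"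
proof -
  have "tail G (y 0) \<in> verts G" using assms(2) by (simp add: shift_space_def)
  then have "head G e \<rightarrow>\<^sup>*\<^bsub>G\<^esub> tail G (y 0)"
    using sc assms(1) by (auto simp: strongly_connected_def)
  \<comment> \<open>The claim is generalised to all arcs ending in a given vertex, so that it can be
    carried backwards along a directed path.\<close>
  then have "\<forall>e\<in>arcs G. head G e = v \<longrightarrow> (\<exists>w. w \<noteq> [] \<and> hd w = e \<and> prepend w y \<in> X)" if "v = head G e" for v
    using that[symmetric]
  proof (induction arbitrary: v rule: converse_reachable_induct)
    case base
    show ?case
    proof (intro ballI impI exI conjI)
      fix e assume "e \<in> arcs G" "head G e = v"
      then show "prepend [e] y \<in> X" using base assms by (subst prepend_in_iff) (auto simp: words_def)
    qed auto
  next
    case (step a b)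
    show ?case
    proof (intro ballI impI)
      fix e assume e: "e \<in> arcs G" "head G e = v"
      obtain e' where e': "e' \<in> arcs G" "tail G e' = a" "head G e' = b" using step(1) by blast
      then obtain w where w: "w \<noteq> []" "hd w = e'" "prepend w y \<in> X" using step(3)[of b] by auto
      have "prepend [e] (prepend w y) \<in> X"
        using e e' w step by (subst prepend_in_iff) (auto simp: words_def prepend_0)
      then show "\<exists>w. w \<noteq> [] \<and> hd w = e \<and> prepend w y \<in> X"
        by (intro exI[of _ "e # w"]) (simp flip: prepend_append)
    qed
  qed
  then show ?thesis using assms(1) by blast
qed

lemma ex_next: "v \<in> verts G \<Longrightarrow> \<exists>e\<in>arcs G. tail G e = v"
proof -
  assume v: "v \<in> verts G"
  obtain e where e: "e \<in> arcs G" using arcs_ne by auto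
  have "v \<rightarrow>\<^sup>*\<^bsub>G\<^esub> tail G e" using sc v e by (auto simp: strongly_connected_def)
  then show ?thesis
    by (cases rule: converse_reachable_cases) (use e in auto)
qed

lemma ex_start: assumes "v \<in> verts G" shows "\<exists>u\<in>X. tail G (u 0) = v"
proof -
  obtain nx where nx: "\<And>v. v \<in> verts G \<Longrightarrow> nx v \<in> arcs G \<and> tail G (nx v) = v"
    using ex_next by metis
  define u where "u = rec_nat (nx v) (\<lambda>_ e. nx (head G e))"
  have u: "u 0 = nx v" "u (Suc k) = nx (head G (u k))" for k by (simp_all add: u_def)
  have "u k \<in> arcs G" for k by (induction k) (use assms nx u in auto)
  then have "u \<in> X" using nx u by (simp add: shift_space_def)
  moreover have "tail G (u 0) = v" using u(1) nx[OF assms] by simp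
  ultimately show ?thesis by blast
qed

lemma X_ne: "X \<noteq> {}"
proof -
  obtain e where "e \<in> arcs G" using arcs_ne by auto
  then show ?thesis using ex_start[of "tail G e"] by auto
qed

lemma in_cylinder_iff: "u \<in> cylinder G w \<longleftrightarrow> u \<in> X \<and> u = prepend w ((shift ^^ length w) u)"
  by (auto simp: cylinder_def prepend_def funpow_shift fun_eq_iff split: if_splits)

lemma cylinder_ne: assumes "w \<in> words G n" shows "cylinder G w \<noteq> {}"
proof (cases "w = []")
  case True then show ?thesis using X_ne by (simp add: cylinder_def)
next
  case False
  have l: "length w = n" using assms by (simp add: words_def)
  have "last w \<in> arcs G" using assms last_in_set[OF False] by (auto simp: words_def)
  then have "head G (last w) \<in> verts G" by simp
  then obtain u where u: "u \<in> X" "tail G (u 0) = head G (last w)" using ex_start by blast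
  have "prepend w u \<in> X" using u False assms l by (simp add: prepend_in_iff)
  then have "prepend w u \<in> cylinder G w" by (simp add: cylinder_def prepend_def)
  then show ?thesis by auto
qed

definition pre :: "nat \<Rightarrow> (nat \<Rightarrow> 'e) \<Rightarrow> 'e list set" where
  "pre n x = {w. length w = n \<and> prepend w x \<in> X}"

lemma finite_pre: "finite (pre n x)"
  by (rule finite_subset[OF _ finite_words[of n]]) (auto simp: pre_def dest: prepend_in_words)

lemma pre_0: "x \<in> X \<Longrightarrow> pre 0 x = {[]}"
  by (auto simp: pre_def)

lemma pre_cong: "x \<in> X \<Longrightarrow> y \<in> X \<Longrightarrow> x 0 = y 0 \<Longrightarrow> pre n x = pre n y"
proof -
  assume "x \<in> X" "y \<in> X" "x 0 = y 0"
  then have "prepend w x \<in> X \<longleftrightarrow> prepend w y \<in> X" for w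
    by (cases "w = []") (simp_all add: prepend_in_iff)
  then show ?thesis by (simp add: pre_def)
qed

text \<open>A connecting word can be chosen according to \<open>e\<close> and \<open>y 0\<close>
  alone, and there are only finitely many such pairs.\<close>

lemma bounded_connecting:
  "\<exists>N. \<forall>e\<in>arcs G. \<forall>y\<in>X. \<exists>w. w \<noteq> [] \<and> hd w = e \<and> length w \<le> N \<and> prepend w y \<in> X"
proof -
  have "\<exists>w. \<forall>y\<in>X. y 0 = e' \<longrightarrow> w \<noteq> [] \<and> hd w = e \<and> prepend w y \<in> X"
    if e: "e \<in> arcs G" for e e'
  proof (cases "\<exists>y\<in>X. y 0 = e'")
    case True
    then obtain y where y: "y \<in> X" "y 0 = e'" by auto
    obtain w where w: "w \<noteq> []" "hd w = e" "prepend w y \<in> X" using ex_connecting[OF e y(1)] by auto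
    have "prepend w z \<in> X" if "z \<in> X" "z 0 = e'" for z
      using w y that prepend_in_iff[OF y(1) w(1)] prepend_in_iff[OF that(1) w(1)] by simp
    then show ?thesis using w by blast
  qed auto
  then obtain W where W: "\<And>e e' y. e \<in> arcs G \<Longrightarrow> y \<in> X \<Longrightarrow> y 0 = e' \<Longrightarrow>
      W e e' \<noteq> [] \<and> hd (W e e') = e \<and> prepend (W e e') y \<in> X"
    by metis
  define N where "N = Max ((\<lambda>(e, e'). length (W e e')) ` (arcs G \<times> arcs G))"
  have "length (W e (y 0)) \<le> N" if "e \<in> arcs G" "y \<in> X" for e y
    unfolding N_def using that by (intro Max_ge) (auto simp: shift_space_def)
  then show ?thesis using W by (intro exI[of _ N]) blast
qed

text \<open>The n-th power of the Ruelle transfer operator with potential \<open>f\<close>, written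
  at once as a sum over the n-th preimages of \<open>x\<close>. The semigroup law is
  \<open>trans_add\<close>.\<close>

definition trans :: "((nat \<Rightarrow> 'e) \<Rightarrow> real) \<Rightarrow> nat \<Rightarrow> ((nat \<Rightarrow> 'e) \<Rightarrow> real) \<Rightarrow> (nat \<Rightarrow> 'e) \<Rightarrow> real" where
  "trans f n g x = (\<Sum>w\<in>pre n x. exp (birkhoff f n (prepend w x)) * g (prepend w x))"

lemma trans_0: "x \<in> X \<Longrightarrow> trans f 0 g x = g x"
  by (simp add: trans_def pre_0)

lemma trans_add:
  assumes "x \<in> X" shows "trans f (n + m) g x = trans f m (trans f n g) x"
proof -
  \<comment> \<open>\<open>v\<close> is the block adjacent to \<open>x\<close> and \<open>w\<close>
    the block in front of it, so the operator of order \<open>n\<close> acts inside the one of order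
    \<open>m\<close>.\<close>
  define S where "S = (SIGMA v:pre m x. pre n (prepend v x))"
  have inj: "inj_on (\<lambda>(v, w). w @ v) S"
    by (auto simp: inj_on_def S_def pre_def)
  have img: "(\<lambda>(v, w). w @ v) ` S = pre (n + m) x"
  proof (intro equalityI subsetI)
    fix u assume u: "u \<in> pre (n + m) x"
    have "prepend (take n u @ drop n u) x \<in> X" using u by (simp add: pre_def)
    then have "prepend (take n u) (prepend (drop n u) x) \<in> X" by (simp only: prepend_append)
    moreover from this have "prepend (drop n u) x \<in> X" by (rule prepend_in_imp)
    ultimately have "(drop n u, take n u) \<in> S"
      using u by (simp add: S_def pre_def)
    then show "u \<in> (\<lambda>(v, w). w @ v) ` S" by (rule rev_image_eqI) simp
  qed (auto simp: S_def pre_def prepend_append)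
  have "trans f (n + m) g x = (\<Sum>(v, w)\<in>S. exp (birkhoff f (n + m) (prepend (w @ v) x)) * g (prepend (w @ v) x))"
    unfolding trans_def img[symmetric] sum.reindex[OF inj] by (simp add: case_prod_beta comp_def)
  also have "\<dots> = (\<Sum>(v, w)\<in>S. exp (birkhoff f m (prepend v x)) *
      (exp (birkhoff f n (prepend w (prepend v x))) * g (prepend w (prepend v x))))"
  proof (rule sum.cong[OF refl], safe)
    fix v w assume "(v, w) \<in> S"
    then have "birkhoff f (n + m) (prepend (w @ v) x)
        = birkhoff f n (prepend w (prepend v x)) + birkhoff f m (prepend v x)"
      using birkhoff_prepend_append[of f w v x] by (auto simp: S_def pre_def)
    then show "exp (birkhoff f (n + m) (prepend (w @ v) x)) * g (prepend (w @ v) x)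
      = exp (birkhoff f m (prepend v x)) * (exp (birkhoff f n (prepend w (prepend v x))) * g (prepend w (prepend v x)))"
      by (simp add: exp_add prepend_append)
  qed
  also have "\<dots> = trans f m (trans f n g) x"
    unfolding S_def by (subst sum.Sigma[symmetric]) (auto simp: finite_pre trans_def sum_distrib_left)
  finally show ?thesis .
qed

lemma trans_mono: "(\<And>y. y \<in> X \<Longrightarrow> g y \<le> h y) \<Longrightarrow> trans f n g x \<le> trans f n h x"
  unfolding trans_def by (intro sum_mono mult_left_mono) (auto simp: pre_def)

lemma trans_cmult: "trans f n (\<lambda>y. c * g y) x = c * trans f n g x"
  by (simp add: trans_def sum_distrib_left algebra_simps)

lemma trans_nonneg: "(\<And>y. y \<in> X \<Longrightarrow> 0 \<le> g y) \<Longrightarrow> 0 \<le> trans f n g x"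
  unfolding trans_def by (intro sum_nonneg mult_nonneg_nonneg) (auto simp: pre_def)

lemma tendsto_trans:
  assumes "\<And>y. y \<in> X \<Longrightarrow> ((\<lambda>i. g i y) \<longlongrightarrow> g' y) F"
  shows "((\<lambda>i. trans f n (g i) x) \<longlongrightarrow> trans f n g' x) F"
  unfolding trans_def by (intro tendsto_intros assms) (auto simp: pre_def)

lemma lip_shift_bounded:
  assumes "lip_shift G \<beta> C f" "0 < \<beta>" "\<beta> < 1"
  obtains F where "0 \<le> F" "\<And>u. u \<in> X \<Longrightarrow> \<bar>f u\<bar> \<le> F"
proof -
  obtain u0 where u0: "u0 \<in> X" using X_ne by auto
  have C: "0 \<le> C" using assms by (simp add: lip_shift_def)
  have "\<bar>f u\<bar> \<le> \<bar>f u0\<bar> + C" if "u \<in> X" for u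
  proof -
    have "\<bar>f u - f u0\<bar> \<le> C * shift_dist \<beta> u u0" using assms that u0 by (simp add: lip_shift_def)
    also have "\<dots> \<le> C" using shift_dist_le_1[OF assms(2,3)] C by (intro mult_left_le) auto
    finally show ?thesis by linarith
  qed
  then show thesis using that[of "\<bar>f u0\<bar> + C"] C by fastforce
qed

lemma birkhoff_le:
  assumes "\<And>u. u \<in> X \<Longrightarrow> f u \<le> F" "u \<in> X" shows "birkhoff f n u \<le> real n * F"
  unfolding birkhoff_def
  using sum_bounded_above[of "{..<n}" "\<lambda>k. f ((shift ^^ k) u)" F] assms(1)[OF funpow_shift_in[OF assms(2)]]
  by simp

lemma abs_birkhoff_le:
  assumes "\<And>u. u \<in> X \<Longrightarrow> \<bar>f u\<bar> \<le> F" "u \<in> X" shows "\<bar>birkhoff f n u\<bar> \<le> real n * F"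
proof -
  have "\<bar>birkhoff f n u\<bar> \<le> birkhoff (\<lambda>u. \<bar>f u\<bar>) n u" unfolding birkhoff_def by (rule sum_abs)
  also have "\<dots> \<le> real n * F" using assms by (rule birkhoff_le)
  finally show ?thesis .
qed

text \<open>After \<open>k\<close> shifts the two points still share the remaining letters of
  \<open>w\<close>, so the differences of \<open>f\<close> along the orbits form a geometric series
  whose sum does not depend on the length of \<open>w\<close>.\<close>

lemma birkhoff_distortion:
  assumes f: "lip_shift G \<beta> C f" and \<beta>: "0 < \<beta>" "\<beta> < 1"
    and xy: "prepend w x \<in> X" "prepend w y \<in> X"
  shows "\<bar>birkhoff f (length w) (prepend w x) - birkhoff f (length w) (prepend w y)\<bar> \<le> C / (1 - \<beta>) * shift_dist \<beta> x y"
proof -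
  define n where "n = length w"
  have C: "0 \<le> C" using f by (simp add: lip_shift_def)
  have d0: "0 \<le> shift_dist \<beta> x y" using shift_dist_nonneg[OF \<beta>(1)] .
  have "\<bar>birkhoff f n (prepend w x) - birkhoff f n (prepend w y)\<bar>
    \<le> (\<Sum>k<n. \<bar>f ((shift ^^ k) (prepend w x)) - f ((shift ^^ k) (prepend w y))\<bar>)"
    unfolding birkhoff_def sum_subtractf[symmetric] by (rule sum_abs)
  \<comment> \<open>The common prefix has length \<open>n - k\<close>; giving away one factor
    \<open>\<beta>\<close> lets the sum be reversed into the powers below \<open>n\<close>.\<close>
  also have "\<dots> \<le> (\<Sum>k<n. \<beta> ^ (n - Suc k) * (C * shift_dist \<beta> x y))"
  proof (rule sum_mono)
    fix k assume k: "k \<in> {..<n}"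
    have "\<bar>f ((shift ^^ k) (prepend w x)) - f ((shift ^^ k) (prepend w y))\<bar>
      \<le> C * shift_dist \<beta> ((shift ^^ k) (prepend w x)) ((shift ^^ k) (prepend w y))"
      using f funpow_shift_in xy by (simp add: lip_shift_def)
    also have "\<dots> = C * shift_dist \<beta> (prepend (drop k w) x) (prepend (drop k w) y)"
      using k by (simp add: funpow_shift_prepend n_def)
    also have "\<dots> \<le> C * (\<beta> ^ length (drop k w) * shift_dist \<beta> x y)"
      by (intro mult_left_mono shift_dist_prepend \<beta> C)
    also have "\<beta> ^ length (drop k w) \<le> \<beta> ^ (n - Suc k)"
      using \<beta> by (intro power_decreasing) (auto simp: n_def)
    finally show "\<bar>f ((shift ^^ k) (prepend w x)) - f ((shift ^^ k) (prepend w y))\<bar>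
      \<le> \<beta> ^ (n - Suc k) * (C * shift_dist \<beta> x y)"
      using C d0 by (simp add: mult_left_mono mult_right_mono algebra_simps)
  qed
  also have "\<dots> = (\<Sum>k<n. \<beta> ^ k) * (C * shift_dist \<beta> x y)"
    unfolding sum_distrib_right[symmetric] by (simp add: sum.nat_diff_reindex)
  also have "\<dots> \<le> 1 / (1 - \<beta>) * (C * shift_dist \<beta> x y)"
  proof (rule mult_right_mono)
    have "(\<Sum>k<n. \<beta> ^ k) = (1 - \<beta> ^ n) / (1 - \<beta>)" using \<beta> by (simp add: sum_gp_strict)
    also have "\<dots> \<le> 1 / (1 - \<beta>)" using \<beta> by (intro divide_right_mono) auto
    finally show "(\<Sum>k<n. \<beta> ^ k) \<le> 1 / (1 - \<beta>)" .
  qed (use C d0 in simp)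
  finally show ?thesis by (simp add: n_def)
qed

lemma birkhoff_cylinder_distortion:
  assumes f: "lip_shift G \<beta> C f" and \<beta>: "0 < \<beta>" "\<beta> < 1" and "u \<in> cylinder G w" "v \<in> cylinder G w"
  shows "\<bar>birkhoff f (length w) u - birkhoff f (length w) v\<bar> \<le> C / (1 - \<beta>)"
proof -
  define x where "x = (shift ^^ length w) u"
  define y where "y = (shift ^^ length w) v"
  have uv: "u = prepend w x" "v = prepend w y" "u \<in> X" "v \<in> X"
    using assms by (simp_all add: in_cylinder_iff x_def y_def)
  have "\<bar>birkhoff f (length w) u - birkhoff f (length w) v\<bar> \<le> C / (1 - \<beta>) * shift_dist \<beta> x y"
    using birkhoff_distortion[OF f \<beta>, of w x y] uv by simp
  also have "\<dots> \<le> C / (1 - \<beta>)"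
    using shift_dist_le_1[OF \<beta>] f \<beta> by (intro mult_left_le) (auto simp: lip_shift_def)
  finally show ?thesis .
qed

end


section \<open>Eigenfunctions at the critical parameter\<close>

text \<open>The partial sum up to \<open>N\<close> is at most the partial sum up to \<open>n\<close>
  plus \<open>\<theta>\<close> times itself, which bounds all partial sums.\<close>

lemma summable_if_shift_contracts:
  fixes b :: "nat \<Rightarrow> real"
  assumes b: "\<And>m. 0 \<le> b m" and step: "\<And>m. b (m + n) \<le> \<theta> * b m" and \<theta>: "0 \<le> \<theta>" "\<theta> < 1"
  shows "summable b"
proof (rule summableI_nonneg_bounded[OF b])
  fix N
  have "sum b {..<N} \<le> sum b {..<N + n}" using b by (intro sum_mono2) auto
  also have "\<dots> = sum b {..<n} + (\<Sum>m<N. b (m + n))"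
    using sum.nat_group[of b] by (induction N) (auto simp: ac_simps)
  also have "\<dots> \<le> sum b {..<n} + \<theta> * sum b {..<N}"
    unfolding sum_distrib_left by (intro add_left_mono sum_mono step)
  finally have "(1 - \<theta>) * sum b {..<N} \<le> sum b {..<n}" by (simp add: algebra_simps)
  then show "sum b {..<N} \<le> sum b {..<n} / (1 - \<theta>)"
    using \<theta> by (simp add: pos_le_divide_eq mult.commute)
qed

context shift_graph
begin

abbreviation tr1 :: "((nat \<Rightarrow> 'e) \<Rightarrow> real) \<Rightarrow> nat \<Rightarrow> (nat \<Rightarrow> 'e) \<Rightarrow> real" where
  "tr1 f n \<equiv> trans f n (\<lambda>_. 1)"

text \<open>The cone of functions with Lipschitz logarithm on each cylinder of length 1, in a
  multiplicative form that admits the value 0 and is preserved by pointwise limits.\<close>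

definition log_lip :: "real \<Rightarrow> real \<Rightarrow> ((nat \<Rightarrow> 'e) \<Rightarrow> real) \<Rightarrow> bool" where
  "log_lip \<beta> K g \<longleftrightarrow> (\<forall>x\<in>X. 0 \<le> g x) \<and>
     (\<forall>x\<in>X. \<forall>y\<in>X. x 0 = y 0 \<longrightarrow> g x \<le> exp (K * shift_dist \<beta> x y) * g y)"

text \<open>The weights contribute their distortion \<open>C / (1 - \<beta>)\<close>, whatever
  \<open>n\<close> is, and \<open>K\<close> does not grow because inverse branches do not expand
  distances.\<close>

lemma log_lip_trans:
  assumes f: "lip_shift G \<beta> C f" and \<beta>: "0 < \<beta>" "\<beta> < 1" and g: "log_lip \<beta> K g" and K: "0 \<le> K"
  shows "log_lip \<beta> (C / (1 - \<beta>) + K) (trans f n g)"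
  unfolding log_lip_def
proof (intro conjI ballI impI)
  fix x show "0 \<le> trans f n g x" using g by (intro trans_nonneg) (simp add: log_lip_def)
next
  fix x y assume xy: "x \<in> X" "y \<in> X" "x 0 = y 0"
  define d where "d = shift_dist \<beta> x y"
  have d: "0 \<le> d" using shift_dist_nonneg[OF \<beta>(1)] by (simp add: d_def)
  have "trans f n g x \<le> (\<Sum>w\<in>pre n y. exp ((C / (1 - \<beta>) + K) * d) * (exp (birkhoff f n (prepend w y)) * g (prepend w y)))"
    unfolding trans_def pre_cong[OF xy]
  proof (rule sum_mono)
    fix w assume w: "w \<in> pre n y"
    then have l: "length w = n" and wy: "prepend w y \<in> X" and wx: "prepend w x \<in> X"
      using pre_cong[OF xy, of n] by (auto simp: pre_def)
    have "birkhoff f n (prepend w x) \<le> C / (1 - \<beta>) * d + birkhoff f n (prepend w y)"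
      using birkhoff_distortion[OF f \<beta> wx wy] by (simp add: l d_def abs_le_iff)
    then have 1: "exp (birkhoff f n (prepend w x)) \<le> exp (C / (1 - \<beta>) * d) * exp (birkhoff f n (prepend w y))"
      by (simp flip: exp_add)
    have "prepend w x 0 = prepend w y 0" using xy by (simp add: prepend_def)
    then have "g (prepend w x) \<le> exp (K * shift_dist \<beta> (prepend w x) (prepend w y)) * g (prepend w y)"
      using g wx wy by (simp add: log_lip_def)
    also have "\<dots> \<le> exp (K * d) * g (prepend w y)"
    proof (rule mult_right_mono)
      have "shift_dist \<beta> (prepend w x) (prepend w y) \<le> \<beta> ^ length w * d"
        using shift_dist_prepend[OF \<beta>] by (simp add: d_def)
      also have "\<dots> \<le> d" using d \<beta> by (simp add: mult_left_le_one_le power_le_one)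
      finally show "exp (K * shift_dist \<beta> (prepend w x) (prepend w y)) \<le> exp (K * d)"
        using K by (simp add: mult_left_mono)
    qed (use g wy in \<open>simp add: log_lip_def\<close>)
    finally have "exp (birkhoff f n (prepend w x)) * g (prepend w x)
        \<le> (exp (C / (1 - \<beta>) * d) * exp (birkhoff f n (prepend w y))) * (exp (K * d) * g (prepend w y))"
      using 1 g wx by (intro mult_mono) (auto simp: log_lip_def)
    moreover have "exp ((C / (1 - \<beta>) + K) * d) = exp (C / (1 - \<beta>) * d) * exp (K * d)"
      by (simp only: distrib_right exp_add)
    ultimately show "exp (birkhoff f n (prepend w x)) * g (prepend w x)
        \<le> exp ((C / (1 - \<beta>) + K) * d) * (exp (birkhoff f n (prepend w y)) * g (prepend w y))"
      by (simp only: mult_ac)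
  qed
  then show "trans f n g x \<le> exp ((C / (1 - \<beta>) + K) * shift_dist \<beta> x y) * trans f n g y"
    by (simp add: trans_def sum_distrib_left d_def)
qed

lemma log_lip_one: "log_lip \<beta> 0 (\<lambda>_. 1)"
  by (simp add: log_lip_def)

text \<open>A Harnack inequality, uniform in \<open>n\<close>. A short word \<open>w\<close>
  starting with \<open>x 0\<close> leads to \<open>y\<close>; bounded distortion compares
  \<open>x\<close> with \<open>prepend w y\<close>, and the value there is one summand of
  \<open>trans f j (tr1 f n) y\<close> up to a bounded weight.\<close>

lemma tr1_ratio:
  assumes f: "lip_shift G \<beta> C f" and \<beta>: "0 < \<beta>" "\<beta> < 1"
  obtains A where "1 \<le> A" "\<And>n x y. x \<in> X \<Longrightarrow> y \<in> X \<Longrightarrow> tr1 f n x \<le> A * tr1 f n y"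
proof -
  obtain F where F: "0 \<le> F" "\<And>u. u \<in> X \<Longrightarrow> \<bar>f u\<bar> \<le> F" by (rule lip_shift_bounded[OF f \<beta>]) blast
  obtain N where N: "\<And>e y. e \<in> arcs G \<Longrightarrow> y \<in> X \<Longrightarrow> \<exists>w. w \<noteq> [] \<and> hd w = e \<and> length w \<le> N \<and> prepend w y \<in> X"
    using bounded_connecting by auto
  define E where "E = C / (1 - \<beta>)"
  define K where "K = (\<Sum>j\<le>N. real (card (words G j)) * exp (real j * F))"
  have trj: "tr1 f j z \<le> K" if "j \<le> N" for j z
  proof -
    have "tr1 f j z \<le> (\<Sum>w\<in>pre j z. exp (real j * F))"
      unfolding trans_def
    proof (rule sum_mono)
      fix w assume "w \<in> pre j z"
      then have "\<bar>birkhoff f j (prepend w z)\<bar> \<le> real j * F"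
        by (intro abs_birkhoff_le F) (auto simp: pre_def)
      then show "exp (birkhoff f j (prepend w z)) * 1 \<le> exp (real j * F)" by simp
    qed
    also have "\<dots> \<le> real (card (words G j)) * exp (real j * F)"
      using card_mono[OF finite_words[of j], of "pre j z"] by (auto simp: pre_def dest: prepend_in_words)
    also have "\<dots> \<le> K"
      unfolding K_def using that by (intro member_le_sum) auto
    finally show ?thesis .
  qed
  define A where "A = exp E * exp (real N * F) * K"
  have main: "tr1 f n x \<le> A * tr1 f n y" if x: "x \<in> X" and y: "y \<in> X" for n x y
  proof -
    have "x 0 \<in> arcs G" using x by (simp add: shift_space_def)
    then obtain w where w: "w \<noteq> []" "hd w = x 0" "length w \<le> N" "prepend w y \<in> X" using N y by blast
    define j where "j = length w"
    have "tr1 f n x \<le> exp ((E + 0) * shift_dist \<beta> x (prepend w y)) * tr1 f n (prepend w y)"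
      using log_lip_trans[OF f \<beta> log_lip_one, of n] x w by (simp add: log_lip_def E_def prepend_0)
    also have "\<dots> \<le> exp E * tr1 f n (prepend w y)"
    proof (rule mult_right_mono)
      have "E * shift_dist \<beta> x (prepend w y) \<le> E"
        using shift_dist_le_1[OF \<beta>] f \<beta> by (intro mult_left_le) (auto simp: lip_shift_def E_def)
      then show "exp ((E + 0) * shift_dist \<beta> x (prepend w y)) \<le> exp E" by simp
    qed (simp add: trans_nonneg)
    also have "tr1 f n (prepend w y) \<le> exp (real N * F) * trans f j (tr1 f n) y"
    proof -
      have "\<bar>birkhoff f j (prepend w y)\<bar> \<le> real j * F" by (intro abs_birkhoff_le F w)
      also have "\<dots> \<le> real N * F" using w F by (simp add: j_def mult_right_mono)
      finally have "1 \<le> exp (real N * F) * exp (birkhoff f j (prepend w y))" by (simp flip: exp_add)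
      then have "tr1 f n (prepend w y) \<le> exp (real N * F) * (exp (birkhoff f j (prepend w y)) * tr1 f n (prepend w y))"
        using mult_right_mono[of 1 "exp (real N * F) * exp (birkhoff f j (prepend w y))" "tr1 f n (prepend w y)"]
        by (simp add: trans_nonneg mult.assoc)
      also have "exp (birkhoff f j (prepend w y)) * tr1 f n (prepend w y) \<le> trans f j (tr1 f n) y"
        unfolding trans_def[of f j]
        by (rule member_le_sum[of w "pre j y" "\<lambda>w. exp (birkhoff f j (prepend w y)) * tr1 f n (prepend w y)"])
           (use w in \<open>auto simp: pre_def j_def trans_nonneg finite_pre[unfolded pre_def]\<close>)
      finally show ?thesis by simp
    qed
    \<comment> \<open>Exchanging the two powers puts the short one inside, where it is bounded by
      \<open>K\<close> because \<open>j \<le> N\<close>.\<close>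
    also have "trans f j (tr1 f n) y = trans f n (tr1 f j) y"
      using trans_add[OF y, of f n j] trans_add[OF y, of f j n] by (simp add: add.commute)
    also have "\<dots> \<le> trans f n (\<lambda>_. K * 1) y" by (rule trans_mono) (use trj w in \<open>simp add: j_def\<close>)
    also have "\<dots> = K * tr1 f n y" by (rule trans_cmult)
    finally show ?thesis by (simp add: A_def mult.assoc)
  qed
  obtain x where x: "x \<in> X" using X_ne by auto
  have "1 \<le> A" using main[OF x x, of 0] by (simp add: trans_0 x)
  then show thesis using main by (rule that)
qed

lemma tr1_change:
  assumes \<phi>: "\<And>u. u \<in> X \<Longrightarrow> \<bar>\<phi> u\<bar> \<le> F" and x: "x \<in> X"
  shows "tr1 (\<lambda>u. g u + s' * \<phi> u) n x \<le> exp (real n * \<bar>s' - s\<bar> * F) * tr1 (\<lambda>u. g u + s * \<phi> u) n x"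
  unfolding trans_def sum_distrib_left
proof (rule sum_mono)
  fix w assume w: "w \<in> pre n x"
  have "birkhoff (\<lambda>u. g u + s' * \<phi> u) n (prepend w x) - birkhoff (\<lambda>u. g u + s * \<phi> u) n (prepend w x)
    = (s' - s) * birkhoff \<phi> n (prepend w x)"
    using birkhoff_linear[of 1 g s' \<phi> n "prepend w x"] birkhoff_linear[of 1 g s \<phi> n "prepend w x"]
    by (simp add: algebra_simps)
  also have "\<dots> \<le> \<bar>s' - s\<bar> * (real n * F)"
  proof -
    have "\<bar>(s' - s) * birkhoff \<phi> n (prepend w x)\<bar> \<le> \<bar>s' - s\<bar> * (real n * F)"
      unfolding abs_mult using w by (intro mult_left_mono abs_birkhoff_le \<phi>) (auto simp: pre_def)
    then show ?thesis by linarith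
  qed
  finally show "exp (birkhoff (\<lambda>u. g u + s' * \<phi> u) n (prepend w x)) * 1
      \<le> exp (real n * \<bar>s' - s\<bar> * F) * (exp (birkhoff (\<lambda>u. g u + s * \<phi> u) n (prepend w x)) * 1)"
    by (simp add: algebra_simps flip: exp_add)
qed

text \<open>If some \<open>tr1\<close> at the critical parameter exceeded \<open>A\<close>, the
  Harnack inequality would make it exceed 1 everywhere, and still at a slightly larger parameter.
  Iterating then gives values at least 1 along the multiples of \<open>n\<close>, against
  convergence. A value below \<open>1 / A\<close> likewise gives a strict contraction at a slightly
  smaller parameter, against divergence.\<close>

lemma tr1_critical:
  assumes lip: "lip_shift G \<beta> C (\<lambda>u. g u + t * \<phi> u)" and \<beta>: "0 < \<beta>" "\<beta> < 1"
    and \<phi>: "\<And>u. u \<in> X \<Longrightarrow> \<bar>\<phi> u\<bar> \<le> F"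
    and conv: "\<And>s x. t < s \<Longrightarrow> x \<in> X \<Longrightarrow> summable (\<lambda>n. tr1 (\<lambda>u. g u + s * \<phi> u) n x)"
    and div: "\<And>s x. s < t \<Longrightarrow> x \<in> X \<Longrightarrow> \<not> summable (\<lambda>n. tr1 (\<lambda>u. g u + s * \<phi> u) n x)"
  obtains A where "1 \<le> A" "\<And>n x. x \<in> X \<Longrightarrow> 1 / A \<le> tr1 (\<lambda>u. g u + t * \<phi> u) n x"
    "\<And>n x. x \<in> X \<Longrightarrow> tr1 (\<lambda>u. g u + t * \<phi> u) n x \<le> A"
proof -
  define f where "f s = (\<lambda>u. g u + s * \<phi> u)" for s
  obtain A where A: "1 \<le> A" "\<And>n x y. x \<in> X \<Longrightarrow> y \<in> X \<Longrightarrow> tr1 (f t) n x \<le> A * tr1 (f t) n y"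
    using tr1_ratio[OF lip \<beta>] unfolding f_def by blast
  have upper: "tr1 (f t) n y \<le> A" if y: "y \<in> X" for n y
  proof (rule ccontr)
    assume "\<not> tr1 (f t) n y \<le> A"
    then have gt: "1 < tr1 (f t) n y / A" using A(1) by (simp add: field_simps)
    have "((\<lambda>\<delta>. exp (- (real n * \<delta> * F)) * (tr1 (f t) n y / A)) \<longlongrightarrow> exp (- (real n * 0 * F)) * (tr1 (f t) n y / A)) (at_right 0)"
      by (intro tendsto_intros)
    then have "eventually (\<lambda>\<delta>. 1 < exp (- (real n * \<delta> * F)) * (tr1 (f t) n y / A)) (at_right 0)"
      by (rule order_tendstoD) (use gt in simp)
    then have "eventually (\<lambda>\<delta>. 1 < exp (- (real n * \<delta> * F)) * (tr1 (f t) n y / A) \<and> 0 < \<delta>) (at_right 0)"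
      using eventually_at_right_less[of 0] by (rule eventually_conj)
    then obtain \<delta> where \<delta>: "1 < exp (- (real n * \<delta> * F)) * (tr1 (f t) n y / A)" "0 < \<delta>"
      using eventually_happens'[OF trivial_limit_at_right_real] by blast
    have one: "1 \<le> tr1 (f (t + \<delta>)) n x" if x: "x \<in> X" for x
    proof -
      have "tr1 (f t) n y / A \<le> tr1 (f t) n x" using A(1) A(2)[OF y x, of n] by (simp add: field_simps)
      also have "\<dots> \<le> exp (real n * \<delta> * F) * tr1 (f (t + \<delta>)) n x"
        using tr1_change[of \<phi> F x g t n "t + \<delta>", OF \<phi> x] \<delta>(2) by (simp add: f_def)
      finally have "exp (- (real n * \<delta> * F)) * (tr1 (f t) n y / A) \<le> exp (- (real n * \<delta> * F)) * (exp (real n * \<delta> * F) * tr1 (f (t + \<delta>)) n x)"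
        by (rule mult_left_mono) simp
      also have "\<dots> = tr1 (f (t + \<delta>)) n x"
        unfolding mult.assoc[symmetric] exp_add[symmetric] by simp
      finally show ?thesis using \<delta>(1) by linarith
    qed
    have ge: "1 \<le> tr1 (f (t + \<delta>)) (k * n) x" if x: "x \<in> X" for k x
      using x
    proof (induction k arbitrary: x)
      case (Suc k)
      have "tr1 (f (t + \<delta>)) (k * n + n) x = trans (f (t + \<delta>)) n (tr1 (f (t + \<delta>)) (k * n)) x"
        by (rule trans_add[OF Suc(2)])
      also have "\<dots> \<ge> tr1 (f (t + \<delta>)) n x" using Suc(1) by (rule trans_mono)
      finally show ?case using one[OF Suc(2)] by (simp add: add.commute)
    qed (simp add: trans_0)
    have n0: "n \<noteq> 0"
    proof
      assume "n = 0"
      then have "tr1 (f t) n y = 1" by (simp add: trans_0 y)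
      then show False using gt A(1) by simp
    qed
    have "(\<lambda>m. tr1 (f (t + \<delta>)) m y) \<longlonglongrightarrow> 0"
      using conv[of "t + \<delta>" y] \<delta> y unfolding f_def by (intro summable_LIMSEQ_zero) simp
    then have "eventually (\<lambda>m. tr1 (f (t + \<delta>)) m y < 1) sequentially" by (rule order_tendstoD) simp
    then obtain m0 where "\<And>m. m0 \<le> m \<Longrightarrow> tr1 (f (t + \<delta>)) m y < 1" by (auto simp: eventually_sequentially)
    from this[of "m0 * n"] ge[OF y, of m0] n0 show False by simp
  qed
  have lower: "1 / A \<le> tr1 (f t) n y" if y: "y \<in> X" for n y
  proof (rule ccontr)
    assume "\<not> 1 / A \<le> tr1 (f t) n y"
    then have lt: "A * tr1 (f t) n y < 1" using A(1) by (simp add: field_simps)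
    have "((\<lambda>\<delta>. exp (real n * \<delta> * F) * (A * tr1 (f t) n y)) \<longlongrightarrow> exp (real n * 0 * F) * (A * tr1 (f t) n y)) (at_right 0)"
      by (intro tendsto_intros)
    then have "eventually (\<lambda>\<delta>. exp (real n * \<delta> * F) * (A * tr1 (f t) n y) < 1) (at_right 0)"
      by (rule order_tendstoD) (use lt in simp)
    then have "eventually (\<lambda>\<delta>. exp (real n * \<delta> * F) * (A * tr1 (f t) n y) < 1 \<and> 0 < \<delta>) (at_right 0)"
      using eventually_at_right_less[of 0] by (rule eventually_conj)
    then obtain \<delta> where \<delta>: "exp (real n * \<delta> * F) * (A * tr1 (f t) n y) < 1" "0 < \<delta>"
      using eventually_happens'[OF trivial_limit_at_right_real] by blast
    define \<theta> where "\<theta> = exp (real n * \<delta> * F) * (A * tr1 (f t) n y)"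
    have \<theta>: "0 \<le> \<theta>" "\<theta> < 1" using \<delta> A(1) by (auto simp: \<theta>_def trans_nonneg)
    have small: "tr1 (f (t - \<delta>)) n x \<le> \<theta>" if x: "x \<in> X" for x
    proof -
      have "tr1 (f (t - \<delta>)) n x \<le> exp (real n * \<delta> * F) * tr1 (f t) n x"
        using tr1_change[of \<phi> F x g "t - \<delta>" n t, OF \<phi> x] \<delta>(2) by (simp add: f_def)
      also have "\<dots> \<le> \<theta>" unfolding \<theta>_def using A(2)[OF x y] by (intro mult_left_mono) auto
      finally show ?thesis .
    qed
    have "summable (\<lambda>m. tr1 (f (t - \<delta>)) m y)"
    proof (rule summable_if_shift_contracts[OF _ _ \<theta>])
      fix m
      show "0 \<le> tr1 (f (t - \<delta>)) m y" by (simp add: trans_nonneg)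
      have "tr1 (f (t - \<delta>)) (m + n) y = trans (f (t - \<delta>)) m (tr1 (f (t - \<delta>)) n) y"
        using trans_add[OF y, of "f (t - \<delta>)" n m] by (simp add: add.commute)
      also have "\<dots> \<le> trans (f (t - \<delta>)) m (\<lambda>_. \<theta> * 1) y" by (rule trans_mono) (simp add: small)
      also have "\<dots> = \<theta> * tr1 (f (t - \<delta>)) m y" by (rule trans_cmult)
      finally show "tr1 (f (t - \<delta>)) (m + n) y \<le> \<theta> * tr1 (f (t - \<delta>)) m y" .
    qed
    then show False using div[of "t - \<delta>" y] \<delta>(2) y by (simp add: f_def)
  qed
  show thesis using that[OF A(1)] upper lower unfolding f_def by blast
qed

text \<open>
  The lower limit of \<open>tr1 f n\<close> is superharmonic, so its iterates decrease to an eigenfunction; the two-sided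
  bound on \<open>tr1 f n\<close> keeps the limit away from \<open>0\<close>.
\<close>

lemma ex_eigenfunction:
  assumes lip: "lip_shift G \<beta> C f" and \<beta>: "0 < \<beta>" "\<beta> < 1" and A: "1 \<le> A"
    and lower: "\<And>n x. x \<in> X \<Longrightarrow> 1 / A \<le> tr1 f n x" and upper: "\<And>n x. x \<in> X \<Longrightarrow> tr1 f n x \<le> A"
  shows "\<exists>h b B K. 0 < b \<and> 0 \<le> K \<and> (\<forall>x\<in>X. b \<le> h x \<and> h x \<le> B) \<and> log_lip \<beta> K h \<and>
    (\<forall>n. \<forall>x\<in>X. trans f n h x = h x)"
proof -
  define E where "E = C / (1 - \<beta>)"
  have E0: "0 \<le> E" using lip \<beta> by (simp add: E_def lip_shift_def)
  \<comment> \<open>Infima over tails increase to the lower limit. The sequence itself may fail to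
    converge when the graph is periodic.\<close>
  define g where "g N x = (INF n\<in>{N..}. tr1 f n x)" for N x
  have bdd: "bdd_below ((\<lambda>n. tr1 f n x) ` S)" if "x \<in> X" for x S
    using lower[OF that] by (auto intro!: bdd_belowI)
  have g_le: "g N x \<le> tr1 f n x" if "x \<in> X" "N \<le> n" for N n x
    unfolding g_def using that by (intro cINF_lower bdd) auto
  have g_ge: "1 / A \<le> g N x" if "x \<in> X" for N x
    unfolding g_def using lower[OF that] by (intro cINF_greatest) auto
  have g_inc: "incseq (\<lambda>N. g N x)" if "x \<in> X" for x
    unfolding incseq_def g_def by (intro allI impI cINF_superset_mono bdd that) auto
  have "\<exists>L. (\<lambda>N. g N x) \<longlonglongrightarrow> L" if x: "x \<in> X" for x
  proof -
    have "g N x \<le> A" for N using g_le[OF x order_refl, of N] upper[OF x, of N] by linarith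
    then show ?thesis using incseq_convergent[OF g_inc[OF x], of A] by blast
  qed
  then obtain g' where g': "\<And>x. x \<in> X \<Longrightarrow> (\<lambda>N. g N x) \<longlonglongrightarrow> g' x" by metis
  have g'_ge: "1 / A \<le> g' x" if "x \<in> X" for x
    by (rule LIMSEQ_le_const[OF g'[OF that]]) (use g_ge[OF that] in auto)
  have g'_le: "g' x \<le> A" if "x \<in> X" for x
    by (rule LIMSEQ_le_const2[OF g'[OF that]]) (use order_trans[OF g_le[OF that order_refl] upper[OF that]] in auto)
  have g'_log: "log_lip \<beta> E g'"
    unfolding log_lip_def
  proof (intro conjI ballI impI)
    fix x assume "x \<in> X"
    then have "1 / A \<le> g' x" by (rule g'_ge)
    moreover have "0 \<le> 1 / A" using A by simp
    ultimately show "0 \<le> g' x" by linarith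
  next
    fix x y assume xy: "x \<in> X" "y \<in> X" "x 0 = y 0"
    have "g N x \<le> exp (E * shift_dist \<beta> x y) * g N y" for N
    proof -
      have "exp (- (E * shift_dist \<beta> x y)) * g N x \<le> g N y"
        unfolding g_def[of N y]
      proof (rule cINF_greatest)
        fix n assume n: "n \<in> {N..}"
        have "tr1 f n x \<le> exp ((E + 0) * shift_dist \<beta> x y) * tr1 f n y"
          using log_lip_trans[OF lip \<beta> log_lip_one, of n] xy by (simp add: log_lip_def E_def)
        with g_le[OF xy(1), of N n] n have "g N x \<le> exp (E * shift_dist \<beta> x y) * tr1 f n y" by simp
        then show "exp (- (E * shift_dist \<beta> x y)) * g N x \<le> tr1 f n y"
          by (simp add: exp_minus field_simps)
      qed auto
      then show ?thesis by (simp add: exp_minus field_simps)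
    qed
    then show "g' x \<le> exp (E * shift_dist \<beta> x y) * g' y"
      by (intro LIMSEQ_le[OF g'[OF xy(1)] tendsto_mult_left[OF g'[OF xy(2)]]]) auto
  qed
  have super: "trans f 1 g' x \<le> g' x" if x: "x \<in> X" for x
  proof (rule LIMSEQ_le[OF tendsto_trans[OF g'] LIMSEQ_Suc[OF g'[OF x]]])
    show "\<exists>N. \<forall>n\<ge>N. trans f 1 (g n) x \<le> g (Suc n) x"
    proof (intro exI allI impI)
      fix N :: nat
      show "trans f 1 (g N) x \<le> g (Suc N) x"
        unfolding g_def[of "Suc N"]
      proof (rule cINF_greatest)
        fix n assume n: "n \<in> {Suc N..}"
        have "trans f 1 (g N) x \<le> trans f 1 (tr1 f (n - 1)) x"
          by (rule trans_mono) (use n in \<open>auto intro: g_le\<close>)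
        also have "\<dots> = tr1 f n x" using trans_add[OF x, of f "n - 1" 1] n by simp
        finally show "trans f 1 (g N) x \<le> tr1 f n x" .
      qed auto
    qed
  qed auto
  define k where "k n x = trans f n g' x" for n x
  have k_dec: "decseq (\<lambda>n. k n x)" if x: "x \<in> X" for x
  proof (rule decseq_SucI)
    fix n
    have "k (Suc n) x = trans f n (trans f 1 g') x" using trans_add[OF x, of f 1 n] by (simp add: k_def)
    also have "\<dots> \<le> k n x" unfolding k_def by (rule trans_mono) (rule super)
    finally show "k (Suc n) x \<le> k n x" .
  qed
  \<comment> \<open>One factor \<open>1 / A\<close> comes from the lower bound on \<open>g'\<close>,
    the other from that on \<open>tr1 f n\<close>.\<close>
  have k_ge: "1 / A * (1 / A) \<le> k n x" if x: "x \<in> X" for n x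
  proof -
    have "1 / A * (1 / A) \<le> 1 / A * tr1 f n x" using lower[OF x] A by (intro mult_left_mono) auto
    also have "\<dots> = trans f n (\<lambda>_. 1 / A * 1) x" by (rule trans_cmult[symmetric])
    also have "\<dots> \<le> k n x" unfolding k_def by (rule trans_mono) (simp add: g'_ge)
    finally show ?thesis .
  qed
  have "\<exists>L. (\<lambda>n. k n x) \<longlonglongrightarrow> L" if x: "x \<in> X" for x
    using decseq_convergent[OF k_dec[OF x], of "1 / A * (1 / A)"] k_ge[OF x] by blast
  then obtain h where h: "\<And>x. x \<in> X \<Longrightarrow> (\<lambda>n. k n x) \<longlonglongrightarrow> h x" by metis
  have k_log: "log_lip \<beta> (E + E) (k n)" for n
    unfolding k_def E_def by (rule log_lip_trans[OF lip \<beta>]) (use g'_log E0 in \<open>simp_all add: E_def\<close>)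
  have h_ge: "1 / A * (1 / A) \<le> h x" if "x \<in> X" for x
    by (rule LIMSEQ_le_const[OF h[OF that]]) (use k_ge[OF that] in auto)
  have h_le: "h x \<le> A" if x: "x \<in> X" for x
  proof (rule LIMSEQ_le_const2[OF h[OF x]], intro exI allI impI)
    fix n :: nat
    have "k n x \<le> k 0 x" using k_dec[OF x] by (simp add: decseq_def)
    also have "\<dots> \<le> A" using g'_le[OF x] by (simp add: k_def trans_0 x)
    finally show "k n x \<le> A" .
  qed
  have h_log: "log_lip \<beta> (E + E) h"
    unfolding log_lip_def
  proof (intro conjI ballI impI)
    fix x assume "x \<in> X"
    then have "1 / A * (1 / A) \<le> h x" by (rule h_ge)
    moreover have "0 \<le> 1 / A * (1 / A)" using A by simp
    ultimately show "0 \<le> h x" by linarith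
  next
    fix x y assume xy: "x \<in> X" "y \<in> X" "x 0 = y 0"
    show "h x \<le> exp ((E + E) * shift_dist \<beta> x y) * h y"
      using k_log xy by (intro LIMSEQ_le[OF h[OF xy(1)] tendsto_mult_left[OF h[OF xy(2)]]]) (auto simp: log_lip_def)
  qed
  have fix_h: "trans f n h x = h x" if x: "x \<in> X" for n x
  proof -
    have "(\<lambda>m. trans f n (k m) x) \<longlonglongrightarrow> trans f n h x" by (rule tendsto_trans[OF h])
    moreover have "trans f n (k m) x = k (m + n) x" for m
      using trans_add[OF x, of f m n g'] by (simp add: k_def[abs_def])
    ultimately have "(\<lambda>m. k (m + n) x) \<longlonglongrightarrow> trans f n h x" by simp
    moreover have "(\<lambda>m. k (m + n) x) \<longlonglongrightarrow> h x" using h[OF x] by (rule LIMSEQ_ignore_initial_segment)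
    ultimately show ?thesis by (rule LIMSEQ_unique)
  qed
  have b0: "0 < 1 / A * (1 / A)" using A by simp
  show ?thesis
    by (rule exI[of _ h], rule exI[of _ "1 / A * (1 / A)"], rule exI[of _ A], rule exI[of _ "E + E"])
      (intro conjI allI ballI b0 h_ge h_le h_log fix_h add_nonneg_nonneg E0)
qed

text \<open>
  In the truncated metric \<open>min 1 (K * d)\<close> with \<open>K\<close> large, close points are contracted because the weights vary
  slowly, and far points because words of length at most \<open>m\<close> bring them close with a definite probability.
\<close>

lemma local_solution:
  assumes \<beta>: "0 < \<beta>" "\<beta> < 1"
    and f: "lip_shift G \<beta> Cf f" and \<psi>: "lip_shift G \<beta> C\<psi> \<psi>" and \<phi>: "lip_shift G \<beta> C\<phi> \<phi>"
    and c: "0 < c" "\<forall>u\<in>X. \<phi> u \<le> - c"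
    and A: "1 \<le> A" and crit: "\<forall>n. \<forall>x\<in>X. 1 / A \<le> tr1 f n x \<and> tr1 f n x \<le> A"
  shows "\<exists>m\<ge>1. \<exists>R>0. \<exists>\<sigma>. \<sigma> holomorphic_on ball 0 R \<and> (\<forall>w::real. \<bar>w\<bar> < R \<longrightarrow> \<sigma> (of_real w) \<in> \<real> \<and>
     (\<exists>g b B. 0 < b \<and> (\<forall>x\<in>X. b \<le> g x \<and> g x \<le> B) \<and>
       (\<forall>x\<in>X. (\<Sum>j=1..m. trans (\<lambda>u. f u + (w * \<psi> u + Re (\<sigma> (of_real w)) * \<phi> u)) j g x) = real m * g x)))"
proof -
  have neg: "0 < c" "\<And>u. u \<in> X \<Longrightarrow> \<phi> u \<le> - c"
    and lower: "\<And>n x. x \<in> X \<Longrightarrow> 1 / A \<le> tr1 f n x" and upper: "\<And>n x. x \<in> X \<Longrightarrow> tr1 f n x \<le> A"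
    using c crit by auto
  obtain h b B H where h: "0 < b" "0 \<le> H" "\<And>x. x \<in> X \<Longrightarrow> b \<le> h x" "\<And>x. x \<in> X \<Longrightarrow> h x \<le> B" "log_lip \<beta> H h"
      "\<And>n x. x \<in> X \<Longrightarrow> trans f n h x = h x"
    using ex_eigenfunction[OF f \<beta> A lower upper] by blast
  have h0: "0 < h x" if "x \<in> X" for x using h(1) h(3)[OF that] by linarith
  obtain z where z: "z \<in> X" using X_ne by auto
  have B0: "0 < B" using h0[OF z] h(4)[OF z] by linarith
  obtain F where F: "0 \<le> F" "\<And>u. u \<in> X \<Longrightarrow> \<bar>f u\<bar> \<le> F" by (rule lip_shift_bounded[OF f \<beta>]) blast
  obtain F\<psi> where F\<psi>: "0 \<le> F\<psi>" "\<And>u. u \<in> X \<Longrightarrow> \<bar>\<psi> u\<bar> \<le> F\<psi>" by (rule lip_shift_bounded[OF \<psi> \<beta>]) blast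
  obtain F\<phi> where F\<phi>: "0 \<le> F\<phi>" "\<And>u. u \<in> X \<Longrightarrow> \<bar>\<phi> u\<bar> \<le> F\<phi>" by (rule lip_shift_bounded[OF \<phi> \<beta>]) blast
  obtain N where N: "\<And>e y. e \<in> arcs G \<Longrightarrow> y \<in> X \<Longrightarrow> \<exists>w. w \<noteq> [] \<and> hd w = e \<and> length w \<le> N \<and> prepend w y \<in> X"
    using bounded_connecting by auto
  \<comment> \<open>The logarithmic variation of \<open>p\<close>: the distortion of the Birkhoff
    sum, and \<open>H\<close> twice, for \<open>h\<close> at the preimage and for \<open>h x\<close>
    in the denominator.\<close>
  define Q where "Q = Cf / (1 - \<beta>) + H + H"
  have Cf0: "0 \<le> Cf / (1 - \<beta>)" using f \<beta> by (simp add: lip_shift_def)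
  have Q0: "0 \<le> Q" using Cf0 h(2) by (simp add: Q_def)
  define P where "P = exp Q * Q"
  have P0: "0 \<le> P" using Q0 by (simp add: P_def)
  \<comment> \<open>For near points the variation of the weights then costs at most
    \<open>(1 - \<beta>) / 2\<close>, which leaves the contraction rate
    \<open>(1 + \<beta>) / 2\<close>.\<close>
  define K where "K = max 1 (2 * P / (1 - \<beta>))"
  have K: "1 \<le> K" "P / K \<le> (1 - \<beta>) / 2"
  proof -
    show K1: "1 \<le> K" by (simp add: K_def)
    have "2 * P / (1 - \<beta>) \<le> K" by (simp add: K_def)
    then show "P / K \<le> (1 - \<beta>) / 2" using K1 \<beta> by (simp add: field_simps)
  qed
  have "0 < 1 / (2 * K)" using K by simp
  then obtain L' where "\<beta> ^ L' < 1 / (2 * K)" using real_arch_pow_inv \<beta>(2) by blast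
  then have L': "K * \<beta> ^ L' \<le> 1 / 2" using K by (simp add: field_simps)
  \<comment> \<open>The extra letter is the first letter of a connecting word, which will be chosen
    as \<open>z L'\<close>; together with the \<open>L'\<close> letters copied from \<open>z\<close>
    it gives a common prefix of length \<open>L\<close>.\<close>
  define L where "L = Suc L'"
  have "\<beta> ^ L \<le> \<beta> ^ L'" using \<beta> by (simp add: L_def mult_left_le_one_le)
  then have L: "K * \<beta> ^ L \<le> 1 / 2" using L' K(1) mult_left_mono[of "\<beta> ^ L" "\<beta> ^ L'" K] by linarith
  define m where "m = L + N"
  have m1: "1 \<le> m" by (simp add: m_def L_def)
  define I where "I x = (\<Union>j\<in>{1..m}. pre j x)" for x
  have finI: "finite (I x)" for x by (auto simp: I_def finite_pre)
  have I_len: "1 \<le> length w" "length w \<le> m" "prepend w x \<in> X" if "w \<in> I x" for w x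
    using that by (auto simp: I_def pre_def)
  have sum_I: "(\<Sum>w\<in>I x. G' w) = (\<Sum>j=1..m. \<Sum>w\<in>pre j x. G' w)" for x and G' :: "'e list \<Rightarrow> real"
  proof -
    have "pre i x \<inter> pre j x = {}" if "i \<noteq> j" for i j using that by (auto simp: pre_def)
    then show ?thesis unfolding I_def by (intro sum.UNION_disjoint) (simp_all add: finite_pre)
  qed
  \<comment> \<open>The Doob transform by the eigenfunction \<open>h\<close>. Each of the
    \<open>m\<close> powers fixes \<open>h\<close>, so the weights of all words of length 1 to
    \<open>m\<close> add up to 1.\<close>
  define p where "p w x = exp (birkhoff f (length w) (prepend w x)) * h (prepend w x) / (real m * h x)" for w x
  have p_nonneg: "0 \<le> p w x" if "x \<in> X" "w \<in> I x" for w x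
    using h0[OF that(1)] h0[OF I_len(3)[OF that(2)]] by (simp add: p_def)
  have sum_tr: "(\<Sum>w\<in>I x. exp (birkhoff f' (length w) (prepend w x)) * g (prepend w x)) = (\<Sum>j=1..m. trans f' j g x)" for f' g x
    unfolding sum_I trans_def by (intro sum.cong) (auto simp: pre_def)
  have p_sum: "(\<Sum>w\<in>I x. p w x) = 1" if x: "x \<in> X" for x
  proof -
    have "(\<Sum>w\<in>I x. p w x) = (\<Sum>w\<in>I x. exp (birkhoff f (length w) (prepend w x)) * h (prepend w x)) / (real m * h x)"
      by (simp add: p_def sum_divide_distrib)
    also have "\<dots> = 1" unfolding sum_tr using h(6)[OF x] h0[OF x] m1 by simp
    finally show ?thesis .
  qed
  define d where "d x y = shift_dist \<beta> x y" for x y :: "nat \<Rightarrow> 'e"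
  have d0: "0 \<le> d x y" and d1: "d x y \<le> 1" for x y :: "nat \<Rightarrow> 'e"
    using shift_dist_nonneg[OF \<beta>(1)] shift_dist_le_1[OF \<beta>] by (auto simp: d_def)
  define D where "D x y = min 1 (K * d x y)" for x y :: "nat \<Rightarrow> 'e"
  have D0: "0 \<le> D x y" and D1: "D x y \<le> 1" for x y using d0 K(1) by (auto simp: D_def)
  have D_less: "x 0 = y 0" "D x y = K * d x y" "d x y \<le> D x y" if "D x y < 1" for x y
  proof -
    show e: "D x y = K * d x y" using that by (auto simp: D_def min_def split: if_splits)
    show "d x y \<le> D x y" unfolding e using K(1) d0[of x y] mult_right_mono[of 1 K "d x y"] by simp
    show "x 0 = y 0"
    proof (rule ccontr)
      assume "x 0 \<noteq> y 0"
      then have "d x y = 1" by (simp add: d_def shift_dist_neq_0)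
      then show False using that e K(1) by simp
    qed
  qed
  have I_eq: "I y = I x" if "x \<in> X" "y \<in> X" "D x y < 1" for x y
    unfolding I_def using pre_cong[OF that(1,2) D_less(1)[OF that(3)]] by simp
  have d_prep: "d (prepend w x) (prepend w y) \<le> \<beta> * d x y" if "1 \<le> length w" for w x y
  proof -
    have "d (prepend w x) (prepend w y) \<le> \<beta> ^ length w * d x y" unfolding d_def by (rule shift_dist_prepend[OF \<beta>])
    also have "\<beta> ^ length w \<le> \<beta> ^ 1" using that \<beta> by (intro power_decreasing) auto
    finally show ?thesis using d0[of x y] by (simp add: mult_right_mono)
  qed
  have D_prep: "D (prepend w x) (prepend w y) \<le> \<beta> * D x y" if "D x y < 1" "w \<in> I x" for w x y
  proof -
    have "D (prepend w x) (prepend w y) \<le> K * d (prepend w x) (prepend w y)" by (simp add: D_def)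
    also have "\<dots> \<le> K * (\<beta> * d x y)" using d_prep I_len(1)[OF that(2)] K(1) by (intro mult_left_mono) auto
    finally show ?thesis unfolding D_less(2)[OF that(1)] by (simp add: mult_ac)
  qed
  have d_prep1: "d (prepend w x) (prepend w y) \<le> d x y" if "1 \<le> length w" for w x y
    using d_prep[OF that, of x y] mult_left_le_one_le[OF d0, of \<beta> x y] \<beta> by linarith
  have p_ratio: "p w x \<le> exp (Q * d x y) * p w y" if "x \<in> X" "y \<in> X" "x 0 = y 0" "w \<in> I x" "w \<in> I y" for w x y
  proof -
    have 1: "birkhoff f (length w) (prepend w x) \<le> Cf / (1 - \<beta>) * d x y + birkhoff f (length w) (prepend w y)"
      using birkhoff_distortion[OF f \<beta> I_len(3)[OF that(4)] I_len(3)[OF that(5)]] by (simp add: d_def abs_le_iff)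
    have "h (prepend w x) \<le> exp (H * d (prepend w x) (prepend w y)) * h (prepend w y)"
      using h(5) I_len(1)[OF that(4)] I_len(3)[OF that(4)] I_len(3)[OF that(5)] that(3)
      by (auto simp: log_lip_def d_def prepend_def)
    also have "\<dots> \<le> exp (H * d x y) * h (prepend w y)"
      using d_prep1[OF I_len(1)[OF that(4)]] h(2) h0[OF I_len(3)[OF that(5)]]
      by (intro mult_right_mono) (auto intro: mult_left_mono)
    finally have 2: "h (prepend w x) \<le> exp (H * d x y) * h (prepend w y)" .
    have "h y \<le> exp (H * d y x) * h x" using h(5) that by (simp add: log_lip_def d_def)
    moreover have "d y x = d x y" by (simp add: d_def shift_dist_def eq_commute)
    moreover have pos: "0 < h x" "0 < h y" "0 < real m" "0 < h (prepend w x)" "0 < h (prepend w y)"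
      using h0 that m1 I_len(3) by auto
    ultimately have 3: "1 / (real m * h x) \<le> exp (H * d x y) * (1 / (real m * h y))"
      by (simp add: field_simps)
    have "p w x = exp (birkhoff f (length w) (prepend w x)) * h (prepend w x) * (1 / (real m * h x))"
      by (simp add: p_def)
    also have "\<dots> \<le> (exp (Cf / (1 - \<beta>) * d x y) * exp (birkhoff f (length w) (prepend w y))) * (exp (H * d x y) * h (prepend w y))
        * (exp (H * d x y) * (1 / (real m * h y)))"
      by (intro mult_mono 2 3) (use 1 pos in \<open>auto simp: less_imp_le simp flip: exp_add\<close>)
    also have "\<dots> = exp (Q * d x y) * p w y"
      unfolding Q_def p_def distrib_right exp_add by simp
    finally show ?thesis .
  qed
  have p_lip: "(\<Sum>w\<in>I x. \<bar>p w x - p w y\<bar>) \<le> P * d x y" if xy: "x \<in> X" "y \<in> X" "D x y < 1" for x y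
  proof -
    have dd: "d y x = d x y" by (simp add: d_def shift_dist_def eq_commute)
    have "(\<Sum>w\<in>I x. \<bar>p w x - p w y\<bar>) \<le> (\<Sum>w\<in>I x. P * d x y * p w x)"
    proof (rule sum_mono)
      fix w assume w: "w \<in> I x"
      then have w': "w \<in> I y" using I_eq[OF xy] by simp
      define t where "t = Q * d x y"
      have t: "0 \<le> t" "t \<le> Q" using Q0 d0[of x y] d1[of x y] by (auto simp: t_def mult_left_le)
      have r1: "p w x \<le> exp t * p w y" using p_ratio[OF xy(1,2) D_less(1)[OF xy(3)] w w'] by (simp add: t_def)
      have r2: "p w y \<le> exp t * p w x" using p_ratio[OF xy(2,1) D_less(1)[OF xy(3), symmetric] w' w] by (simp add: t_def dd)
      have px: "0 \<le> p w x" using p_nonneg xy w by simp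
      have e1: "1 - t \<le> exp (- t)" using exp_ge_add_one_self[of "- t"] by simp
      have "exp t * (1 - t) \<le> exp t * exp (- t)" using e1 by (intro mult_left_mono) auto
      then have "exp t - 1 \<le> exp t * t" by (simp add: exp_minus algebra_simps)
      also have "\<dots> \<le> exp Q * t" using t by (intro mult_right_mono) auto
      finally have et: "exp t - 1 \<le> P * d x y" by (simp add: P_def t_def)
      have "p w y - p w x \<le> (exp t - 1) * p w x" using r2 by (simp add: algebra_simps)
      moreover have "p w x - p w y \<le> (exp t - 1) * p w x"
      proof -
        have "exp (- t) * p w x \<le> exp (- t) * (exp t * p w y)" using r1 by (rule mult_left_mono) simp
        also have "\<dots> = p w y" unfolding mult.assoc[symmetric] exp_add[symmetric] by simp
        finally have "p w x - p w y \<le> (1 - exp (- t)) * p w x" by (simp add: algebra_simps)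
        also have "\<dots> \<le> (exp t - 1) * p w x"
        proof (rule mult_right_mono[OF _ px])
          have "1 + t \<le> exp t" by (rule exp_ge_add_one_self)
          then show "1 - exp (- t) \<le> exp t - 1" using e1 by linarith
        qed
        finally show ?thesis .
      qed
      ultimately have "\<bar>p w x - p w y\<bar> \<le> (exp t - 1) * p w x" by linarith
      also have "\<dots> \<le> P * d x y * p w x" using et px by (rule mult_right_mono)
      finally show "\<bar>p w x - p w y\<bar> \<le> P * d x y * p w x" .
    qed
    also have "\<dots> = P * d x y" using p_sum[OF xy(1)] by (simp flip: sum_distrib_left)
    finally show ?thesis .
  qed
  define \<eta> where "\<eta> = min 1 (exp (- (real m * F)) * b / (real m * B))"
  have \<eta>: "0 < \<eta>" "\<eta> \<le> 1" using h(1) B0 m1 by (auto simp: \<eta>_def)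
  have p_ge: "\<eta> \<le> p w x" if x: "x \<in> X" and w: "w \<in> I x" for w x
  proof -
    have "\<bar>birkhoff f (length w) (prepend w x)\<bar> \<le> real (length w) * F"
      by (intro abs_birkhoff_le F I_len(3)[OF w])
    also have "\<dots> \<le> real m * F" using I_len(2)[OF w] F(1) by (intro mult_right_mono) auto
    finally have "exp (- (real m * F)) \<le> exp (birkhoff f (length w) (prepend w x))" by simp
    then have "exp (- (real m * F)) * b / (real m * B) \<le> p w x"
      unfolding p_def using h(1) h(3)[OF I_len(3)[OF w]] h(4)[OF x] h0[OF x] h0[OF I_len(3)[OF w]] m1 B0
      by (intro frac_le mult_mono) (auto simp: less_imp_le)
    then show ?thesis by (simp add: \<eta>_def)
  qed
  \<comment> \<open>The words reaching the neighbourhood of the reference point \<open>z\<close> may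
    have different lengths for different \<open>x\<close>. This freedom makes the contraction
    insensitive to the period of the graph.\<close>
  have ex_near: "\<exists>w\<in>I x. \<forall>k<L. prepend w x k = z k" if x: "x \<in> X" for x
  proof -
    have "z L' \<in> arcs G" using z by (simp add: shift_space_def)
    then obtain w where w: "w \<noteq> []" "hd w = z L'" "length w \<le> N" "prepend w x \<in> X" using N x by blast
    define v where "v = map z [0..<L']"
    have "prepend v (prepend w x) \<in> X"
    proof (cases "v = []")
      case False
      have "last v = z (L' - 1)" "L' \<noteq> 0" using False by (auto simp: v_def last_map)
      moreover have "head G (z (L' - 1)) = tail G (z (Suc (L' - 1)))" using z unfolding shift_space_def by blast
      ultimately have "head G (last v) = tail G (hd w)" using w(2) by simp
      then show ?thesis
        using prepend_in_iff[OF w(4) False] prefix_in_words[OF z, of L'] w(1) by (simp add: v_def prepend_0)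
    qed (use w in simp)
    then have "v @ w \<in> I x" using w by (auto simp: I_def pre_def prepend_append m_def L_def v_def Suc_le_eq intro!: bexI[of _ "L' + length w"])
    moreover have "prepend (v @ w) x k = z k" if "k < L" for k
      using that w(1,2) by (auto simp: prepend_def v_def L_def nth_append hd_conv_nth less_Suc_eq)
    ultimately show ?thesis by blast
  qed
  define \<rho> where "\<rho> = max ((1 + \<beta>) / 2) (1 - \<eta> * \<eta> / 2)"
  have \<rho>: "0 \<le> \<rho>" "\<rho> < 1" using \<beta> \<eta> by (auto simp: \<rho>_def le_max_iff_disj)
  have contr: "cmod ((\<Sum>w\<in>I x. p w x * g (prepend w x)) - (\<Sum>w\<in>I y. p w y * g (prepend w y))) \<le> \<rho> * S * D x y"
    if S0: "0 \<le> S" and g: "\<forall>x\<in>X. \<forall>y\<in>X. cmod (g x - g y) \<le> S * D x y" and x: "x \<in> X" and y: "y \<in> X" for g :: "(nat \<Rightarrow> 'e) \<Rightarrow> complex" and S x y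
  proof -
    have psc: "(\<Sum>w\<in>I x. complex_of_real (p w x)) = 1" if "x \<in> X" for x
      using p_sum[OF that] by (metis of_real_1 of_real_sum)
    have gS: "cmod (g u - g v) \<le> S" if "u \<in> X" "v \<in> X" for u v
      using g that S0 D1[of u v] mult_left_le[of "D u v" S] by (meson order_trans)
    show ?thesis
    proof (cases "D x y < 1")
      case True
      have Iy: "I y = I x" using I_eq x y True by blast
      \<comment> \<open>Both families of weights sum to 1, so \<open>g\<close> may be replaced by
        \<open>g - g z\<close>, which is bounded by \<open>S\<close> although \<open>g\<close>
        itself is not controlled.\<close>
      have "(\<Sum>w\<in>I x. p w x * g (prepend w x)) - (\<Sum>w\<in>I y. p w y * g (prepend w y))
        = (\<Sum>w\<in>I x. p w x * (g (prepend w x) - g (prepend w y)) + (p w x - p w y) * (g (prepend w y) - g z))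
          + ((\<Sum>w\<in>I x. complex_of_real (p w x)) - (\<Sum>w\<in>I y. complex_of_real (p w y))) * g z"
        unfolding Iy sum_subtractf[symmetric] sum_distrib_right sum.distrib[symmetric]
        by (intro sum.cong) (auto simp: algebra_simps)
      also have "((\<Sum>w\<in>I x. complex_of_real (p w x)) - (\<Sum>w\<in>I y. complex_of_real (p w y))) * g z = 0"
        using psc x y by simp
      finally have "cmod ((\<Sum>w\<in>I x. p w x * g (prepend w x)) - (\<Sum>w\<in>I y. p w y * g (prepend w y)))
        = cmod (\<Sum>w\<in>I x. p w x * (g (prepend w x) - g (prepend w y)) + (p w x - p w y) * (g (prepend w y) - g z))"
        by simp
      also have "\<dots> \<le> (\<Sum>w\<in>I x. p w x * (S * (\<beta> * D x y)) + \<bar>p w x - p w y\<bar> * S)"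
      proof (rule sum_norm_le)
        fix w assume w: "w \<in> I x"
        have wx: "prepend w x \<in> X" and wy: "prepend w y \<in> X" using I_len(3) w Iy by auto
        have "cmod (g (prepend w x) - g (prepend w y)) \<le> S * D (prepend w x) (prepend w y)" using g wx wy by blast
        also have "\<dots> \<le> S * (\<beta> * D x y)" using D_prep[OF True w] S0 by (rule mult_left_mono)
        finally have 1: "cmod (p w x * (g (prepend w x) - g (prepend w y))) \<le> p w x * (S * (\<beta> * D x y))"
          using p_nonneg[OF x w] by (simp add: norm_mult mult_left_mono)
        have 2: "cmod ((p w x - p w y) * (g (prepend w y) - g z)) \<le> \<bar>p w x - p w y\<bar> * S"
          using gS[OF wy z] by (simp add: norm_mult mult_left_mono flip: of_real_diff)
        show "cmod (p w x * (g (prepend w x) - g (prepend w y)) + (p w x - p w y) * (g (prepend w y) - g z))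
            \<le> p w x * (S * (\<beta> * D x y)) + \<bar>p w x - p w y\<bar> * S"
          by (intro norm_triangle_le add_mono 1 2)
      qed
      also have "\<dots> = S * (\<beta> * D x y) + (\<Sum>w\<in>I x. \<bar>p w x - p w y\<bar>) * S"
        unfolding sum.distrib sum_distrib_right[symmetric] p_sum[OF x] by simp
      also have "\<dots> \<le> S * (\<beta> * D x y) + (P / K * D x y) * S"
        using p_lip[OF x y True] S0 K(1) by (intro add_left_mono mult_right_mono) (auto simp: D_less(2)[OF True])
      also have "\<dots> = (\<beta> + P / K) * (S * D x y)" by (simp add: algebra_simps)
      also have "\<dots> \<le> \<rho> * (S * D x y)"
      proof (rule mult_right_mono)
        have "\<beta> + P / K \<le> (1 + \<beta>) / 2" using K(2) by argo
        then show "\<beta> + P / K \<le> \<rho>" unfolding \<rho>_def by (rule max.coboundedI1)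
      qed (use S0 D0 in simp)
      finally show ?thesis by (simp add: mult.assoc)
    next
      case False
      then have Deq: "D x y = 1" using D1[of x y] by linarith
      obtain wx where wx: "wx \<in> I x" "\<And>k. k < L \<Longrightarrow> prepend wx x k = z k" using ex_near[OF x] by blast
      obtain wy where wy: "wy \<in> I y" "\<And>k. k < L \<Longrightarrow> prepend wy y k = z k" using ex_near[OF y] by blast
      \<comment> \<open>The product coupling of the two probability vectors; since both have mass 1,
        the difference of the averages becomes a double sum of differences of
        \<open>g\<close>.\<close>
      define a where "a w v = p w x * p v y" for w v
      define J where "J = I x \<times> I y"
      have near: "cmod (g (prepend wx x) - g (prepend wy y)) \<le> S / 2"
      proof -
        have "d (prepend wx x) (prepend wy y) \<le> \<beta> ^ L"
          unfolding d_def by (rule shift_dist_agree[OF \<beta>]) (simp add: wx wy)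
        then have "D (prepend wx x) (prepend wy y) \<le> K * \<beta> ^ L"
          using K(1) by (simp add: D_def min.coboundedI2 mult_left_mono)
        also note L
        finally have "S * D (prepend wx x) (prepend wy y) \<le> S * (1 / 2)" using S0 by (rule mult_left_mono)
        moreover have "cmod (g (prepend wx x) - g (prepend wy y)) \<le> S * D (prepend wx x) (prepend wy y)"
          using g I_len(3) wx(1) wy(1) by blast
        ultimately show ?thesis by simp
      qed
      have "(\<Sum>w\<in>I x. p w x * g (prepend w x)) - (\<Sum>v\<in>I y. p v y * g (prepend v y))
        = (\<Sum>w\<in>I x. p w x * g (prepend w x)) * (\<Sum>v\<in>I y. complex_of_real (p v y))
          - (\<Sum>w\<in>I x. complex_of_real (p w x)) * (\<Sum>v\<in>I y. p v y * g (prepend v y))"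
        using psc x y by simp
      also have "\<dots> = (\<Sum>(w, v)\<in>J. a w v * (g (prepend w x) - g (prepend v y)))"
        unfolding sum_product J_def sum.cartesian_product sum_subtractf[symmetric]
        by (intro sum.cong) (auto simp: a_def algebra_simps)
      \<comment> \<open>The pair \<open>(wx, wy)\<close> has mass at least
        \<open>\<eta> * \<eta>\<close> and lands at distance at most \<open>1 / 2\<close>, which
        saves half of its contribution. All other pairs get the trivial bound
        \<open>S\<close>.\<close>
      also have "cmod \<dots> \<le> (\<Sum>(w, v)\<in>J. a w v * S - (if (w, v) = (wx, wy) then \<eta> * \<eta> / 2 * S else 0))"
      proof (rule sum_norm_le, clarsimp simp only: case_prod_conv)
        fix w v assume "(w, v) \<in> J"
        then have w: "w \<in> I x" and v: "v \<in> I y" by (auto simp: J_def)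
        have a0: "0 \<le> a w v" unfolding a_def using p_nonneg x y w v by simp
        have n: "cmod (a w v * (g (prepend w x) - g (prepend v y))) = a w v * cmod (g (prepend w x) - g (prepend v y))"
          using a0 by (simp add: norm_mult)
        show "cmod (a w v * (g (prepend w x) - g (prepend v y))) \<le> a w v * S - (if (w, v) = (wx, wy) then \<eta> * \<eta> / 2 * S else 0)"
        proof (cases "(w, v) = (wx, wy)")
          case True
          have "\<eta> * \<eta> \<le> a w v" unfolding a_def using p_ge[OF x w] p_ge[OF y v] \<eta> by (intro mult_mono) auto
          then have "\<eta> * \<eta> * S \<le> a w v * S" using S0 by (rule mult_right_mono)
          moreover have "a w v * cmod (g (prepend w x) - g (prepend v y)) \<le> a w v * (S / 2)"
            using near True a0 by (intro mult_left_mono) auto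
          ultimately show ?thesis unfolding n if_P[OF True] by simp
        next
          case False
          have "a w v * cmod (g (prepend w x) - g (prepend v y)) \<le> a w v * S"
            by (intro mult_left_mono gS I_len(3)[OF w] I_len(3)[OF v] a0)
          then show ?thesis unfolding n if_not_P[OF False] by simp
        qed
      qed
      also have "\<dots> = (\<Sum>(w, v)\<in>J. a w v) * S - \<eta> * \<eta> / 2 * S"
      proof -
        have "(\<Sum>wv\<in>J. if wv = (wx, wy) then \<eta> * \<eta> / 2 * S else 0) = \<eta> * \<eta> / 2 * S"
          using wx wy finI by (simp add: J_def)
        then show ?thesis
          by (simp only: split_def prod.collapse sum_subtractf sum_distrib_right)
      qed
      also have "(\<Sum>(w, v)\<in>J. a w v) = 1"
        unfolding J_def a_def sum.cartesian_product[symmetric] sum_product[symmetric] p_sum[OF x] p_sum[OF y] by simp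
      also have "1 * S - \<eta> * \<eta> / 2 * S \<le> \<rho> * S"
        using mult_right_mono[OF max.cobounded2 S0, of "1 - \<eta> * \<eta> / 2" "(1 + \<beta>) / 2", folded \<rho>_def]
        by (simp only: left_diff_distrib)
      finally show ?thesis by (simp add: Deq)
    qed
  qed
  define \<Psi> where "\<Psi> w x = birkhoff \<psi> (length w) (prepend w x)" for w x
  define \<Phi> where "\<Phi> w x = birkhoff \<phi> (length w) (prepend w x)" for w x
  define M where "M = max 1 (max (real m * max F\<psi> F\<phi>) (max (C\<psi> / (1 - \<beta>)) (C\<phi> / (1 - \<beta>))))"
  have M: "1 \<le> M" "real m * F\<psi> \<le> M" "real m * F\<phi> \<le> M" "C\<psi> / (1 - \<beta>) \<le> M" "C\<phi> / (1 - \<beta>) \<le> M"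
  proof -
    have "real m * F\<psi> \<le> real m * max F\<psi> F\<phi>" "real m * F\<phi> \<le> real m * max F\<psi> F\<phi>"
      by (auto intro: mult_left_mono)
    then show "real m * F\<psi> \<le> M" "real m * F\<phi> \<le> M" unfolding M_def by linarith+
  qed (simp_all add: M_def)
  have bound: "\<bar>birkhoff \<xi> (length w) (prepend w x)\<bar> \<le> real m * F'"
    if "\<And>u. u \<in> X \<Longrightarrow> \<bar>\<xi> u\<bar> \<le> F'" "0 \<le> F'" "w \<in> I x" for \<xi> F' w x
  proof -
    have "\<bar>birkhoff \<xi> (length w) (prepend w x)\<bar> \<le> real (length w) * F'"
      by (intro abs_birkhoff_le that(1) I_len(3)[OF that(3)])
    also have "\<dots> \<le> real m * F'" using I_len(2)[OF that(3)] that(2) by (intro mult_right_mono) auto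
    finally show ?thesis .
  qed
  have lipb: "\<bar>birkhoff \<xi> (length w) (prepend w x) - birkhoff \<xi> (length w) (prepend w y)\<bar> \<le> M * D x y"
    if "lip_shift G \<beta> C' \<xi>" "C' / (1 - \<beta>) \<le> M" "x \<in> X" "y \<in> X" "D x y < 1" "w \<in> I x" for \<xi> C' w x y
  proof -
    have "w \<in> I y" using I_eq[OF that(3-5)] that(6) by simp
    then have "\<bar>birkhoff \<xi> (length w) (prepend w x) - birkhoff \<xi> (length w) (prepend w y)\<bar> \<le> C' / (1 - \<beta>) * d x y"
      unfolding d_def by (intro birkhoff_distortion[OF that(1) \<beta>] I_len(3) that(6))
    also have "\<dots> \<le> M * D x y" using that(2) D_less(3)[OF that(5)] d0 M(1) by (intro mult_mono) auto
    finally show ?thesis .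
  qed
  interpret pas: perturbed_averaging_system X D I prepend p P \<rho> z \<Psi> \<Phi> M c
  proof unfold_locales
    show "0 \<le> P" by (rule P0)
    fix x y w assume x: "x \<in> X" and y: "y \<in> X" and xy: "D x y < 1" 
    show "(\<Sum>i\<in>I x. \<bar>p i x - p i y\<bar>) \<le> P * D x y"
      using p_lip[OF x y xy] mult_left_mono[OF D_less(3)[OF xy] P0] by linarith
    assume w: "w \<in> I x"
    show "D (prepend w x) (prepend w y) \<le> D x y"
      using D_prep[OF xy w] mult_left_le_one_le[OF D0, of \<beta> x y] \<beta> by linarith
    show "\<bar>\<Psi> w x - \<Psi> w y\<bar> \<le> M * D x y" unfolding \<Psi>_def by (rule lipb[OF \<psi> M(4) x y xy w])
    show "\<bar>\<Phi> w x - \<Phi> w y\<bar> \<le> M * D x y" unfolding \<Phi>_def by (rule lipb[OF \<phi> M(5) x y xy w])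
  next
    fix x w assume x: "x \<in> X" and w: "w \<in> I x"
    show "\<bar>\<Psi> w x\<bar> \<le> M" unfolding \<Psi>_def by (rule order_trans[OF bound[of \<psi> F\<psi> w x] M(2)]) (simp_all add: F\<psi> w)
    show "\<bar>\<Phi> w x\<bar> \<le> M" unfolding \<Phi>_def by (rule order_trans[OF bound[of \<phi> F\<phi> w x] M(3)]) (simp_all add: F\<phi> w)
    have "\<Phi> w x \<le> real (length w) * (- c)" unfolding \<Phi>_def by (intro birkhoff_le neg(2) I_len(3)[OF w])
    also have "\<dots> \<le> - c" using I_len(1)[OF w] neg(1) mult_right_mono[of 1 "real (length w)" c] by simp
    finally show "\<Phi> w x \<le> - c" .
    show "prepend w x \<in> X" by (rule I_len(3)[OF w])
    show "0 \<le> p w x" by (rule p_nonneg[OF x w])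
  next
    fix g :: "(nat \<Rightarrow> 'e) \<Rightarrow> complex" and S x y
    assume "0 \<le> S" "\<forall>x\<in>X. \<forall>y\<in>X. cmod (g x - g y) \<le> S * D x y" "x \<in> X" "y \<in> X"
    then show "cmod ((\<Sum>w\<in>I x. p w x * g (prepend w x)) - (\<Sum>w\<in>I y. p w y * g (prepend w y))) \<le> \<rho> * S * D x y"
      by (rule contr)
  qed (use z finI p_sum D0 D1 I_eq \<rho> M neg in auto)
  obtain R \<sigma> where R: "0 < R" and hol: "\<sigma> holomorphic_on ball 0 R"
    and \<sigma>: "\<forall>w::real. \<bar>w\<bar> < R \<longrightarrow> \<sigma> (of_real w) \<in> \<real> \<and>
     (\<exists>g :: (nat \<Rightarrow> 'e) \<Rightarrow> real. (\<forall>x\<in>X. 1 / 2 \<le> g x \<and> g x \<le> 2) \<and>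
       (\<forall>x\<in>X. (\<Sum>i\<in>I x. p i x * exp (w * \<Psi> i x + Re (\<sigma> (of_real w)) * \<Phi> i x) * g (prepend i x)) = g x))"
    using pas.implicit_parameter by (elim exE conjE) (rule that; assumption)
  have sol: "\<exists>g b B. 0 < b \<and> (\<forall>x\<in>X. b \<le> g x \<and> g x \<le> B) \<and>
       (\<forall>x\<in>X. (\<Sum>j=1..m. trans (\<lambda>u. f u + (w * \<psi> u + Re (\<sigma> (of_real w)) * \<phi> u)) j g x) = real m * g x)"
    if w: "\<bar>w\<bar> < R" for w :: real
  proof -
    define s where "s = Re (\<sigma> (of_real w))"
    obtain g where "\<forall>x\<in>X. 1 / 2 \<le> g x \<and> g x \<le> 2"
      "\<forall>x\<in>X. (\<Sum>i\<in>I x. p i x * exp (w * \<Psi> i x + s * \<Phi> i x) * g (prepend i x)) = g x"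
      using \<sigma>[rule_format, OF w, THEN conjunct2, folded s_def] by (elim exE conjE) (rule that; assumption)
    then have g: "\<And>x. x \<in> X \<Longrightarrow> 1 / 2 \<le> g x \<and> g x \<le> 2"
      "\<And>x. x \<in> X \<Longrightarrow> (\<Sum>i\<in>I x. p i x * exp (w * \<Psi> i x + s * \<Phi> i x) * g (prepend i x)) = g x"
      by simp_all
    have g0: "0 \<le> g x" if "x \<in> X" for x using g(1)[OF that] by linarith
    \<comment> \<open>Multiplication by \<open>h\<close> undoes the normalisation and turns the
      fixed point of the Markov operator into one of the averaged transfer operator.\<close>
    have "(\<Sum>j=1..m. trans (\<lambda>u. f u + (w * \<psi> u + s * \<phi> u)) j (\<lambda>x. h x * g x) x) = real m * (h x * g x)"
      if x: "x \<in> X" for x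
    proof -
      have "birkhoff (\<lambda>u. f u + (w * \<psi> u + s * \<phi> u)) n u = birkhoff f n u + (w * birkhoff \<psi> n u + s * birkhoff \<phi> n u)" for n u
        by (simp add: birkhoff_def sum.distrib sum_distrib_left)
      then have "(\<Sum>j=1..m. trans (\<lambda>u. f u + (w * \<psi> u + s * \<phi> u)) j (\<lambda>x. h x * g x) x)
        = (\<Sum>i\<in>I x. (real m * h x) * (p i x * exp (w * \<Psi> i x + s * \<Phi> i x) * g (prepend i x)))"
        unfolding sum_tr[symmetric] p_def \<Psi>_def \<Phi>_def using h0[OF x] m1
        by (intro sum.cong) (simp_all add: exp_add)
      also have "\<dots> = (real m * h x) * g x" unfolding sum_distrib_left[symmetric] g(2)[OF x] ..
      finally show ?thesis by simp
    qed
    moreover have "b * (1 / 2) \<le> h x * g x \<and> h x * g x \<le> B * 2" if "x \<in> X" for x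
      using h(1,3,4) g(1) g0 h0 that B0 by (intro conjI mult_mono) (auto simp: less_imp_le)
    moreover have "0 < b * (1 / 2)" using h(1) by simp
    ultimately show ?thesis unfolding s_def
      by (intro exI[of _ "\<lambda>x. h x * g x"] exI[of _ "b * (1 / 2)"] exI[of _ "B * 2"] conjI ballI) auto
  qed
  show ?thesis
  proof (intro exI[of _ m] exI[of _ R] exI[of _ \<sigma>] conjI allI impI)
    show "1 \<le> m" "0 < R" "\<sigma> holomorphic_on ball 0 R" using m1 R hol by auto
    fix w :: real assume w: "\<bar>w\<bar> < R"
    show "\<sigma> (of_real w) \<in> \<real>" using \<sigma> w by simp
    show "\<exists>g b B. 0 < b \<and> (\<forall>x\<in>X. b \<le> g x \<and> g x \<le> B) \<and>
       (\<forall>x\<in>X. (\<Sum>j=1..m. trans (\<lambda>u. f u + (w * \<psi> u + Re (\<sigma> (of_real w)) * \<phi> u)) j g x) = real m * g x)"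
      by (rule sol[OF w])
  qed
qed

end


section \<open>Analyticity of the critical parameter\<close>

context shift_graph
begin

lemma trans_decrease:
  assumes \<phi>: "0 < c" "\<And>u. u \<in> X \<Longrightarrow> \<phi> u \<le> - c" and st: "s \<le> t" and u: "\<And>y. y \<in> X \<Longrightarrow> 0 \<le> u y"
  shows "trans (\<lambda>v. g v + t * \<phi> v) j u x \<le> exp (- ((t - s) * c * real j)) * trans (\<lambda>v. g v + s * \<phi> v) j u x"
  unfolding trans_def sum_distrib_left
proof (rule sum_mono)
  fix w assume w: "w \<in> pre j x"
  then have wx: "prepend w x \<in> X" by (simp add: pre_def)
  have "birkhoff (\<lambda>v. g v + t * \<phi> v) j (prepend w x) - birkhoff (\<lambda>v. g v + s * \<phi> v) j (prepend w x)
    = (t - s) * birkhoff \<phi> j (prepend w x)"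
    using birkhoff_linear[of 1 g t \<phi> j "prepend w x"] birkhoff_linear[of 1 g s \<phi> j "prepend w x"]
    by (simp add: algebra_simps)
  also have "\<dots> \<le> (t - s) * (real j * (- c))"
    by (intro mult_left_mono birkhoff_le \<phi>(2) wx) (use st in auto)
  finally have "exp (birkhoff (\<lambda>v. g v + t * \<phi> v) j (prepend w x))
    \<le> exp (- ((t - s) * c * real j)) * exp (birkhoff (\<lambda>v. g v + s * \<phi> v) j (prepend w x))"
    by (simp add: algebra_simps flip: exp_add)
  then show "exp (birkhoff (\<lambda>v. g v + t * \<phi> v) j (prepend w x)) * u (prepend w x)
      \<le> exp (- ((t - s) * c * real j)) * (exp (birkhoff (\<lambda>v. g v + s * \<phi> v) j (prepend w x)) * u (prepend w x))"
    using u[OF wx] by (simp add: mult_right_mono flip: mult.assoc)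
qed

text \<open>For \<open>t > s\<close> every power from the first on loses a factor of at most
  \<open>\<theta> < 1\<close> when \<open>s\<close> is replaced by \<open>t\<close>. With
  \<open>\<kappa>\<close> the supremum of \<open>u2 / u1\<close>, the two eigenvalue equations then
  give \<open>\<kappa> \<le> \<theta> * \<kappa>\<close>, which is absurd for
  \<open>\<kappa> > 0\<close>.\<close>

lemma eigen_parameter_le:
  assumes \<phi>: "0 < c" "\<And>u. u \<in> X \<Longrightarrow> \<phi> u \<le> - c" and m: "1 \<le> m"
    and u1: "0 < b1" "\<And>x. x \<in> X \<Longrightarrow> b1 \<le> u1 x"
      "\<And>x. x \<in> X \<Longrightarrow> (\<Sum>j=1..m. trans (\<lambda>v. g v + s * \<phi> v) j u1 x) = real m * u1 x"
    and u2: "0 < b2" "\<And>x. x \<in> X \<Longrightarrow> b2 \<le> u2 x" "\<And>x. x \<in> X \<Longrightarrow> u2 x \<le> B2"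
      "\<And>x. x \<in> X \<Longrightarrow> (\<Sum>j=1..m. trans (\<lambda>v. g v + t * \<phi> v) j u2 x) = real m * u2 x"
  shows "t \<le> s"
proof (rule ccontr)
  assume "\<not> t \<le> s"
  then have st: "s < t" by simp
  have p1: "0 < u1 x" and p2: "0 < u2 x" if "x \<in> X" for x
    using u1(1) u1(2)[OF that] u2(1) u2(2)[OF that] by linarith+
  obtain z where z: "z \<in> X" using X_ne by auto
  define \<kappa> where "\<kappa> = (SUP x\<in>X. u2 x / u1 x)"
  define \<theta> where "\<theta> = exp (- ((t - s) * c))"
  have \<theta>: "0 < \<theta>" "\<theta> < 1" using st \<phi>(1) by (auto simp: \<theta>_def)
  have bdd: "bdd_above ((\<lambda>x. u2 x / u1 x) ` X)"
  proof (intro bdd_aboveI2)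
    fix x assume x: "x \<in> X"
    show "u2 x / u1 x \<le> B2 / b1"
      using p2[OF x] u2(3)[OF x] u1(1) u1(2)[OF x] by (intro frac_le) auto
  qed
  have le: "u2 x \<le> \<kappa> * u1 x" if x: "x \<in> X" for x
  proof -
    have "u2 x / u1 x \<le> \<kappa>" unfolding \<kappa>_def by (rule cSUP_upper[OF x bdd])
    then show ?thesis using p1[OF x] by (simp add: pos_divide_le_eq)
  qed
  have "u2 x / u1 x \<le> \<theta> * \<kappa>" if x: "x \<in> X" for x
  proof -
    have "real m * u2 x = (\<Sum>j=1..m. trans (\<lambda>v. g v + t * \<phi> v) j u2 x)" using u2(4)[OF x] by simp
    also have "\<dots> \<le> (\<Sum>j=1..m. \<theta> * (\<kappa> * trans (\<lambda>v. g v + s * \<phi> v) j u1 x))"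
    proof (rule sum_mono)
      fix j assume j: "j \<in> {1..m}"
      have t0: "0 \<le> trans (\<lambda>v. g v + s * \<phi> v) j u2 x" using p2 by (intro trans_nonneg) (simp add: less_imp_le)
      have "trans (\<lambda>v. g v + t * \<phi> v) j u2 x \<le> exp (- ((t - s) * c * real j)) * trans (\<lambda>v. g v + s * \<phi> v) j u2 x"
        by (rule trans_decrease[OF \<phi>]) (use st p2 in \<open>auto simp: less_imp_le\<close>)
      also have "\<dots> \<le> \<theta> * trans (\<lambda>v. g v + s * \<phi> v) j u2 x"
        unfolding \<theta>_def using j st \<phi>(1) by (intro mult_right_mono t0) auto
      also have "trans (\<lambda>v. g v + s * \<phi> v) j u2 x \<le> trans (\<lambda>v. g v + s * \<phi> v) j (\<lambda>y. \<kappa> * u1 y) x"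
        by (rule trans_mono[OF le])
      finally show "trans (\<lambda>v. g v + t * \<phi> v) j u2 x \<le> \<theta> * (\<kappa> * trans (\<lambda>v. g v + s * \<phi> v) j u1 x)"
        using \<theta>(1) by (simp add: trans_cmult)
    qed
    also have "\<dots> = \<theta> * (\<kappa> * (real m * u1 x))"
      unfolding u1(3)[OF x, symmetric] sum_distrib_left ..
    finally have "u2 x \<le> \<theta> * \<kappa> * u1 x" using m by simp
    then show ?thesis using p1[OF x] by (simp add: pos_divide_le_eq)
  qed
  then have "\<kappa> \<le> \<theta> * \<kappa>" unfolding \<kappa>_def[symmetric] by (subst (1) \<kappa>_def) (intro cSUP_least X_ne)
  moreover have "0 < \<kappa>" using le[OF z] p1[OF z] p2[OF z] by (metis less_le_trans zero_less_mult_pos2)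
  ultimately show False using \<theta> by simp
qed

text \<open>At every \<open>q\<close> the critical parameter has an eigenfunction for all powers,
  hence for the averaged operator. Near \<open>q0\<close> the holomorphic solution supplies another
  eigenfunction of that averaged operator, and applying \<open>eigen_parameter_le\<close> in both
  directions identifies the two parameters.\<close>

lemma real_analytic_critical_parameter:
  fixes \<tau> :: "real \<Rightarrow> real"
  assumes \<beta>: "0 < \<beta>" "\<beta> < 1" and \<psi>: "lip_shift G \<beta> C\<psi> \<psi>" and \<phi>: "lip_shift G \<beta> C\<phi> \<phi>"
    and neg: "0 < c" "\<And>u. u \<in> X \<Longrightarrow> \<phi> u \<le> - c"
    and conv: "\<And>q s x. \<tau> q < s \<Longrightarrow> x \<in> X \<Longrightarrow> summable (\<lambda>n. tr1 (\<lambda>u. q * \<psi> u + s * \<phi> u) n x)"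
    and div: "\<And>q s x. s < \<tau> q \<Longrightarrow> x \<in> X \<Longrightarrow> \<not> summable (\<lambda>n. tr1 (\<lambda>u. q * \<psi> u + s * \<phi> u) n x)"
  shows "real_analytic \<tau>"
  unfolding real_analytic_def
proof
  fix q0
  obtain F where F: "0 \<le> F" "\<And>u. u \<in> X \<Longrightarrow> \<bar>\<phi> u\<bar> \<le> F" by (rule lip_shift_bounded[OF \<phi> \<beta>]) blast
  \<comment> \<open>Criticality is required at all \<open>q\<close> and not just at
    \<open>q0\<close>: it produces the eigenfunctions at \<open>q0 + w\<close> that are compared
    with the holomorphic solution.\<close>
  have crit: "\<exists>A\<ge>1. \<forall>n. \<forall>x\<in>X. 1 / A \<le> tr1 (\<lambda>u. q * \<psi> u + \<tau> q * \<phi> u) n x \<and> tr1 (\<lambda>u. q * \<psi> u + \<tau> q * \<phi> u) n x \<le> A" for q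
    by (rule tr1_critical[where g = "\<lambda>u. q * \<psi> u" and t = "\<tau> q" and \<phi> = \<phi>,
          OF lip_shift_linear[OF \<psi> \<phi> \<beta>(1)] \<beta> F(2) conv div]) auto
  obtain A where A: "1 \<le> A" "\<forall>n. \<forall>x\<in>X. 1 / A \<le> tr1 (\<lambda>u. q0 * \<psi> u + \<tau> q0 * \<phi> u) n x \<and>
      tr1 (\<lambda>u. q0 * \<psi> u + \<tau> q0 * \<phi> u) n x \<le> A"
    using crit[of q0] by blast
  have neg': "\<forall>u\<in>X. \<phi> u \<le> - c" using neg(2) by blast
  obtain m R \<sigma> where m: "1 \<le> m" and R: "0 < R" and hol: "\<sigma> holomorphic_on ball 0 R"
    and \<sigma>: "\<forall>w::real. \<bar>w\<bar> < R \<longrightarrow> \<sigma> (of_real w) \<in> \<real> \<and>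
     (\<exists>g b B. 0 < b \<and> (\<forall>x\<in>X. b \<le> g x \<and> g x \<le> B) \<and>
       (\<forall>x\<in>X. (\<Sum>j=1..m. trans (\<lambda>u. (q0 * \<psi> u + \<tau> q0 * \<phi> u) + (w * \<psi> u + Re (\<sigma> (of_real w)) * \<phi> u)) j g x) = real m * g x))"
    using local_solution[OF \<beta> lip_shift_linear[OF \<psi> \<phi> \<beta>(1)] \<psi> \<phi> neg(1) neg' A] by (elim exE conjE) (rule that; assumption)
  have \<tau>: "\<tau> (q0 + w) = \<tau> q0 + Re (\<sigma> (of_real w))" if w: "\<bar>w\<bar> < R" for w
  proof -
    define q where "q = q0 + w"
    define t where "t = \<tau> q0 + Re (\<sigma> (of_real w))"
    have "(\<lambda>u. (q0 * \<psi> u + \<tau> q0 * \<phi> u) + (w * \<psi> u + Re (\<sigma> (of_real w)) * \<phi> u)) = (\<lambda>u. q * \<psi> u + t * \<phi> u)"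
      by (simp add: fun_eq_iff q_def t_def algebra_simps)
    then obtain g b B where g: "0 < b" "\<forall>x\<in>X. b \<le> g x \<and> g x \<le> B"
        "\<forall>x\<in>X. (\<Sum>j=1..m. trans (\<lambda>u. q * \<psi> u + t * \<phi> u) j g x) = real m * g x"
      using \<sigma>[rule_format, OF w, THEN conjunct2] by (elim exE conjE) (simp only:)
    obtain A' where A': "1 \<le> A'" "\<And>n x. x \<in> X \<Longrightarrow> 1 / A' \<le> tr1 (\<lambda>u. q * \<psi> u + \<tau> q * \<phi> u) n x"
      "\<And>n x. x \<in> X \<Longrightarrow> tr1 (\<lambda>u. q * \<psi> u + \<tau> q * \<phi> u) n x \<le> A'"
      using crit[of q] by blast
    obtain h b' B' where h: "0 < b'" "\<forall>x\<in>X. b' \<le> h x \<and> h x \<le> B'"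
        "\<forall>n. \<forall>x\<in>X. trans (\<lambda>u. q * \<psi> u + \<tau> q * \<phi> u) n h x = h x"
      using ex_eigenfunction[OF lip_shift_linear[OF \<psi> \<phi> \<beta>(1)] \<beta> A'] by blast
    have h': "(\<Sum>j=1..m. trans (\<lambda>u. q * \<psi> u + \<tau> q * \<phi> u) j h x) = real m * h x" if "x \<in> X" for x
      using h(3) that by simp
    have "t \<le> \<tau> q"
      by (rule eigen_parameter_le[OF neg m h(1) _ h' g(1), of g B]) (use g h in auto)
    moreover have "\<tau> q \<le> t"
      by (rule eigen_parameter_le[where ?u1.0 = g and ?u2.0 = h and ?b1.0 = b and ?b2.0 = b' and ?B2.0 = B' and g = "\<lambda>u. q * \<psi> u", OF neg m g(1) _ _ h(1) _ _ h']) (use g h in auto)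
    ultimately show ?thesis by (simp add: q_def t_def)
  qed
  \<comment> \<open>\<open>\<sigma>\<close> measures the displacement from \<open>\<tau> q0\<close>,
    so that value is added to the constant coefficient; taking real parts is compatible with
    evaluation at real arguments.\<close>
  define a where "a n = Re ((deriv ^^ n) \<sigma> 0 / fact n) + (if n = 0 then \<tau> q0 else 0)" for n
  have "(\<lambda>n. a n * (x - q0) ^ n) sums \<tau> x" if x: "\<bar>x - q0\<bar> < R" for x
  proof -
    define w where "w = x - q0"
    have "(\<lambda>n. (deriv ^^ n) \<sigma> 0 / fact n * (of_real w - 0) ^ n) sums \<sigma> (of_real w)"
      by (rule holomorphic_power_series[OF hol]) (use x in \<open>simp add: w_def del: of_real_diff\<close>)
    then have "(\<lambda>n. Re ((deriv ^^ n) \<sigma> 0 / fact n * of_real (w ^ n))) sums Re (\<sigma> (of_real w))"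
      by (intro sums_Re) simp
    then have "(\<lambda>n. Re ((deriv ^^ n) \<sigma> 0 / fact n) * w ^ n) sums Re (\<sigma> (of_real w))"
      by (simp only: Re_complex_of_real Im_complex_of_real times_complex.sel mult_zero_right diff_zero)
    moreover have "(\<lambda>n. if n = 0 then \<tau> q0 else 0) sums \<tau> q0"
      using sums_single[of 0 "\<lambda>_. \<tau> q0"] by simp
    ultimately have "(\<lambda>n. Re ((deriv ^^ n) \<sigma> 0 / fact n) * w ^ n + (if n = 0 then \<tau> q0 else 0)) sums (Re (\<sigma> (of_real w)) + \<tau> q0)"
      by (rule sums_add)
    moreover have "Re ((deriv ^^ n) \<sigma> 0 / fact n) * w ^ n + (if n = 0 then \<tau> q0 else 0) = a n * w ^ n" for n
      by (simp add: a_def)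
    ultimately show ?thesis using \<tau>[of w] x by (simp add: w_def add.commute)
  qed
  then show "\<exists>r>0. \<exists>a. \<forall>x. \<bar>x - q0\<bar> < r \<longrightarrow> (\<lambda>n. a n * (x - q0) ^ n) sums \<tau> x"
    using R by blast
qed

end


section \<open>Sequential compactness of the probability measures\<close>

lemma diagonal_subsequence:
  fixes x :: "nat \<Rightarrow> nat \<Rightarrow> real"
  assumes "\<And>j i. x j i \<in> {0..1}"
  shows "\<exists>r l. strict_mono r \<and> (\<forall>i. (\<lambda>j. x (r j) i) \<longlonglongrightarrow> l i)"
proof -
  interpret subseqs "\<lambda>i s. convergent (\<lambda>j. x (s j) i)"
  proof
    fix i and s :: "nat \<Rightarrow> nat"
    have "bounded (range (\<lambda>j. x (s j) i))"
      by (rule bounded_subset[of "{0..1}"]) (use assms in auto)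
    from bounded_imp_convergent_subsequence[OF this]
    show "\<exists>r'. strict_mono r' \<and> convergent (\<lambda>j. x ((s \<circ> r') j) i)"
      unfolding convergent_def comp_def by blast
  qed
  have conv: "convergent (\<lambda>j. x (diagseq j) i)" for i
  proof -
    \<comment> \<open>The diagonal sequence is a subsequence of the i-th extraction only from index
      \<open>Suc i\<close> on.\<close>
    have "convergent (\<lambda>j. x ((diagseq \<circ> ((+) (Suc i))) j) i)"
    proof (rule diagseq_holds)
      fix r s :: "nat \<Rightarrow> nat" and n
      assume "strict_mono r" "convergent (\<lambda>j. x (s j) n)"
      then show "convergent (\<lambda>j. x ((s \<circ> r) j) n)"
        using convergent_subseq_convergent[of "\<lambda>j. x (s j) n" r] by (simp add: comp_def)
    qed
    then have "convergent (\<lambda>j. x (diagseq (j + Suc i)) i)" by (simp add: comp_def add.commute)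
    then show ?thesis by (subst (asm) convergent_ignore_initial_segment)
  qed
  show ?thesis
    by (intro exI[of _ diagseq] exI[of _ "\<lambda>i. lim (\<lambda>j. x (diagseq j) i)"] conjI allI subseq_diagseq
        convergent_LIMSEQ_iff[THEN iffD1] conv)
qed

lemma tendsto_finite_eventually:
  fixes x :: "nat \<Rightarrow> real"
  assumes "finite F" "\<And>j. x j \<in> F" "x \<longlonglongrightarrow> l"
  shows "eventually (\<lambda>j. x j = l) sequentially"
proof -
  have "open (- (F - {l}))" using assms(1) by (intro open_Compl finite_imp_closed) auto
  then have "eventually (\<lambda>j. x j \<in> - (F - {l})) sequentially"
    by (rule topological_tendstoD[OF assms(3)]) simp
  then show ?thesis
    by eventually_elim (use assms(2) in auto)
qed

context shift_graph
begin

text \<open>Letters are coded injectively by reals in the unit interval, to which the diagonal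
  extraction applies. Since the alphabet is finite, convergence of the codes means that each
  coordinate is eventually constant, so admissibility is inherited by the limit.\<close>

lemma X_seq_compact:
  fixes u :: "nat \<Rightarrow> nat \<Rightarrow> 'e"
  assumes "\<And>j. u j \<in> X"
  shows "\<exists>r v. strict_mono r \<and> v \<in> X \<and> (\<forall>n. eventually (\<lambda>j. \<forall>k<n. u (r j) k = v k) sequentially)"
proof -
  obtain f :: "'e \<Rightarrow> nat" where f: "inj_on f (arcs G)"
    using finite_imp_inj_to_nat_seg[OF finite_arcs] by auto
  define c where "c e = 1 / real (Suc (f e))" for e
  have inj: "inj_on c (arcs G)" using f by (auto simp: inj_on_def c_def)
  obtain r l where r: "strict_mono r" and l: "\<And>k. (\<lambda>j. c (u (r j) k)) \<longlonglongrightarrow> l k"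
    using diagonal_subsequence[of "\<lambda>j k. c (u j k)"] by (auto simp: c_def)
  have ar: "u j k \<in> arcs G" for j k using assms[of j] by (simp add: shift_space_def)
  have ev: "eventually (\<lambda>j. c (u (r j) k) = l k) sequentially" for k
    by (rule tendsto_finite_eventually[of "c ` arcs G", OF _ _ l]) (use ar in auto)
  define v where "v k = inv_into (arcs G) c (l k)" for k
  have ev': "eventually (\<lambda>j. u (r j) k = v k) sequentially" for k
    using ev[of k]
  proof eventually_elim
    case (elim j)
    show ?case unfolding v_def elim[symmetric] by (rule inv_into_f_f[OF inj ar, symmetric])
  qed
  have all: "eventually (\<lambda>j. \<forall>k<n. u (r j) k = v k) sequentially" for n
  proof -
    have "eventually (\<lambda>j. \<forall>k\<in>{..<n}. u (r j) k = v k) sequentially"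
      by (rule eventually_ball_finite) (use ev' in auto)
    then show ?thesis by (rule eventually_mono) auto
  qed
  have "v k \<in> arcs G \<and> head G (v k) = tail G (v (Suc k))" for k
  proof -
    obtain j where "\<forall>i<Suc (Suc k). u (r j) i = v i"
      using eventually_happens'[OF sequentially_bot all] by blast
    then have "u (r j) k = v k" "u (r j) (Suc k) = v (Suc k)" by auto
    moreover have "u (r j) k \<in> arcs G" "head G (u (r j) k) = tail G (u (r j) (Suc k))"
      using assms[of "r j"] by (simp_all add: shift_space_def)
    ultimately show ?thesis by simp
  qed
  then have "v \<in> X" by (simp add: shift_space_def)
  then show ?thesis using r all by blast
qed

section \<open>The countable algebra of clopen sets and the Borel sets\<close>

definition agree :: "nat \<Rightarrow> (nat \<Rightarrow> 'e) \<Rightarrow> (nat \<Rightarrow> 'e) \<Rightarrow> bool" where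
  "agree n u v \<longleftrightarrow> (\<forall>k<n. u k = v k)"

text \<open>These are the finite unions of cylinders, equivalently the clopen sets: a countable
  algebra, small enough for diagonal extraction and large enough to generate the Borel sets.\<close>

definition local_sets :: "(nat \<Rightarrow> 'e) set set" where
  "local_sets = {A. A \<subseteq> X \<and> (\<exists>n. \<forall>u\<in>X. \<forall>v\<in>X. agree n u v \<longrightarrow> (u \<in> A \<longleftrightarrow> v \<in> A))}"

lemma local_setsE:
  assumes "A \<in> local_sets"
  obtains n where "A \<subseteq> X" "\<And>u v. u \<in> X \<Longrightarrow> v \<in> X \<Longrightarrow> agree n u v \<Longrightarrow> u \<in> A \<longleftrightarrow> v \<in> A"
  using assms unfolding local_sets_def by blast

lemma agree_mono: "agree n u v \<Longrightarrow> m \<le> n \<Longrightarrow> agree m u v"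
  by (simp add: agree_def)

lemma cylinder_local: "cylinder G w \<in> local_sets"
  unfolding local_sets_def cylinder_def agree_def by (auto intro!: exI[of _ "length w"])

lemma openin_shift_top_iff:
  "openin (shift_top G) A \<longleftrightarrow> A \<subseteq> X \<and> (\<forall>u\<in>A. \<exists>n. \<forall>v\<in>X. (\<forall>k<n. v k = u k) \<longrightarrow> v \<in> A)"
proof safe
  assume "openin (shift_top G) A"
  then obtain T where T: "openin (product_topology (\<lambda>_. discrete_topology (arcs G)) UNIV) T" "A = T \<inter> X"
    by (auto simp: shift_top_def openin_subtopology)
  {
    fix u assume "u \<in> A" then show "u \<in> X" using T by simp
  }
  fix u assume "u \<in> A"
  then have u: "u \<in> T" "u \<in> X" using T by auto
  then obtain V where V: "finite {i. V i \<noteq> arcs G}" "u \<in> Pi\<^sub>E UNIV V" "Pi\<^sub>E UNIV V \<subseteq> T"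
    using T(1) unfolding openin_product_topology_alt by auto
  obtain n where n: "\<And>i. V i \<noteq> arcs G \<Longrightarrow> i < n"
    using V(1) finite_nat_set_iff_bounded by auto
  show "\<exists>n. \<forall>v\<in>X. (\<forall>k<n. v k = u k) \<longrightarrow> v \<in> A"
  proof (intro exI ballI impI)
    fix v assume v: "v \<in> X" "\<forall>k<n. v k = u k"
    have "v i \<in> V i" for i
    proof (cases "i < n")
      case True then show ?thesis using v(2) V(2) by (auto simp: PiE_def)
    next
      case False then have "V i = arcs G" using n by blast
      then show ?thesis using v(1) by (simp add: shift_space_def)
    qed
    then have "v \<in> Pi\<^sub>E UNIV V" by auto
    then show "v \<in> A" using V(3) T(2) v(1) by auto
  qed
next
  assume A: "A \<subseteq> X" "\<forall>u\<in>A. \<exists>n. \<forall>v\<in>X. (\<forall>k<n. v k = u k) \<longrightarrow> v \<in> A"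
  then obtain N where N: "\<And>u v. u \<in> A \<Longrightarrow> v \<in> X \<Longrightarrow> (\<And>k. k < N u \<Longrightarrow> v k = u k) \<Longrightarrow> v \<in> A" by metis
  define B where "B u = Pi\<^sub>E UNIV (\<lambda>k. if k < N u then {u k} else arcs G)" for u
  have ar: "u k \<in> arcs G" if "u \<in> X" for u k using that by (simp add: shift_space_def)
  have "openin (product_topology (\<lambda>_. discrete_topology (arcs G)) UNIV) (B u)" if "u \<in> A" for u
    unfolding B_def
  proof (rule product_topology_basis)
    show "openin (discrete_topology (arcs G)) (if k < N u then {u k} else arcs G)" for k
      using ar[of u k] that A by auto
    show "finite {k. (if k < N u then {u k} else arcs G) \<noteq> topspace (discrete_topology (arcs G))}"
      by (rule finite_subset[of _ "{..<N u}"]) auto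
  qed
  then have "openin (product_topology (\<lambda>_. discrete_topology (arcs G)) UNIV) (\<Union>u\<in>A. B u)" by blast
  moreover have "A = (\<Union>u\<in>A. B u) \<inter> X"
  proof (intro equalityI subsetI)
    fix u assume u: "u \<in> A"
    then have "u \<in> B u" using A ar[of u] by (auto simp: B_def)
    then show "u \<in> (\<Union>u\<in>A. B u) \<inter> X" using u A by blast
  next
    fix v assume "v \<in> (\<Union>u\<in>A. B u) \<inter> X"
    then obtain u where u: "u \<in> A" "v \<in> B u" "v \<in> X" by blast
    have "v k = u k" if "k < N u" for k
      using PiE_mem[OF u(2)[unfolded B_def], of k] that by simp
    then show "v \<in> A" using N u by blast
  qed
  ultimately show "openin (shift_top G) A"
    unfolding shift_top_def openin_subtopology by blast
qed

lemma topspace_shift_top: "topspace (shift_top G) = X"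
proof
  show "topspace (shift_top G) \<subseteq> X" using openin_topspace[of "shift_top G"] unfolding openin_shift_top_iff by simp
  show "X \<subseteq> topspace (shift_top G)" by (rule openin_subset) (auto simp: openin_shift_top_iff)
qed

lemma local_open:
  assumes "A \<in> local_sets" shows "openin (shift_top G) A"
proof -
  obtain n where n: "A \<subseteq> X" "\<And>u v. u \<in> X \<Longrightarrow> v \<in> X \<Longrightarrow> agree n u v \<Longrightarrow> u \<in> A \<longleftrightarrow> v \<in> A"
    using local_setsE[OF assms] by metis
  have "v \<in> A" if "u \<in> A" "v \<in> X" "\<forall>k<n. v k = u k" for u v
    using n(2)[of u v] that n(1) by (auto simp: agree_def)
  then show ?thesis unfolding openin_shift_top_iff using n(1) by blast
qed

lemma countable_local: "countable local_sets"
proof (rule countable_subset)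
  show "local_sets \<subseteq> (\<Union>n. (\<lambda>S. {u\<in>X. map u [0..<n] \<in> S}) ` Pow (words G n))"
  proof
    fix A assume "A \<in> local_sets"
    then obtain n where A: "A \<subseteq> X" and n: "\<And>u v. u \<in> X \<Longrightarrow> v \<in> X \<Longrightarrow> agree n u v \<Longrightarrow> u \<in> A \<longleftrightarrow> v \<in> A"
      using local_setsE by metis
    define S where "S = (\<lambda>u. map u [0..<n]) ` A"
    have "A = {u\<in>X. map u [0..<n] \<in> S}"
    proof (intro equalityI subsetI)
      fix u assume "u \<in> {u\<in>X. map u [0..<n] \<in> S}"
      then obtain v where v: "u \<in> X" "v \<in> A" "map u [0..<n] = map v [0..<n]" by (auto simp: S_def)
      have "agree n u v" using v(3) by (auto simp: agree_def)
      then show "u \<in> A" using n[of u v] v A by blast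
    qed (use A in \<open>auto simp: S_def\<close>)
    moreover have "S \<subseteq> words G n" using A prefix_in_words by (auto simp: S_def)
    ultimately show "A \<in> (\<Union>n. (\<lambda>S. {u\<in>X. map u [0..<n] \<in> S}) ` Pow (words G n))" by blast
  qed
  show "countable (\<Union>n. (\<lambda>S. {u\<in>X. map u [0..<n] \<in> S}) ` Pow (words G n))"
    by (intro countable_UN countable_image) (auto simp: finite_words intro: countable_finite)
qed

lemma algebra_local: "algebra X local_sets"
  unfolding algebra_iff_Un
proof (intro conjI ballI)
  show "local_sets \<subseteq> Pow X" by (auto simp: local_sets_def)
  show "{} \<in> local_sets" by (simp add: local_sets_def)
  fix A assume A: "A \<in> local_sets"
  then obtain n where n: "A \<subseteq> X" "\<And>u v. u \<in> X \<Longrightarrow> v \<in> X \<Longrightarrow> agree n u v \<Longrightarrow> u \<in> A \<longleftrightarrow> v \<in> A"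
    using local_setsE by metis
  show "X - A \<in> local_sets"
    unfolding local_sets_def
    by (rule CollectI, rule conjI[OF Diff_subset], rule exI[of _ n]) (use n(2) in blast)
  fix B assume "B \<in> local_sets"
  then obtain m where m: "B \<subseteq> X" "\<And>u v. u \<in> X \<Longrightarrow> v \<in> X \<Longrightarrow> agree m u v \<Longrightarrow> u \<in> B \<longleftrightarrow> v \<in> B"
    using local_setsE by metis
  show "A \<union> B \<in> local_sets" unfolding local_sets_def
  proof (intro CollectI conjI exI[of _ "max n m"] ballI impI)
    fix u v assume uv: "u \<in> X" "v \<in> X" "agree (max n m) u v"
    then have "u \<in> A \<longleftrightarrow> v \<in> A" "u \<in> B \<longleftrightarrow> v \<in> B"
      using n(2)[OF uv(1,2)] m(2)[OF uv(1,2)] agree_mono[OF uv(3)] by simp_all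
    then show "u \<in> A \<union> B \<longleftrightarrow> v \<in> A \<union> B" by blast
  qed (use n m in auto)
qed

text \<open>An open set is the union of the local sets contained in it, and this union is
  countable.\<close>

lemma sets_shift_borel: "sets (shift_borel G) = sigma_sets X local_sets"
proof -
  have sub: "{A. openin (shift_top G) A} \<subseteq> Pow X" by (auto simp: openin_shift_top_iff)
  have "sigma_sets X {A. openin (shift_top G) A} = sigma_sets X local_sets"
  proof (rule sigma_sets_eqI)
    fix A assume "A \<in> {A. openin (shift_top G) A}"
    then have A: "A \<subseteq> X" "\<And>u. u \<in> A \<Longrightarrow> \<exists>n. \<forall>v\<in>X. (\<forall>k<n. v k = u k) \<longrightarrow> v \<in> A"
      by (auto simp: openin_shift_top_iff)
    define \<C> where "\<C> = {C\<in>local_sets. C \<subseteq> A}"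
    have "A = \<Union>\<C>"
    proof (intro equalityI subsetI)
      fix u assume u: "u \<in> A"
      then obtain n where n: "\<forall>v\<in>X. (\<forall>k<n. v k = u k) \<longrightarrow> v \<in> A" using A(2) by blast
      have "cylinder G (map u [0..<n]) \<subseteq> A" using n by (auto simp: cylinder_def)
      moreover have "u \<in> cylinder G (map u [0..<n])" using u A by (auto simp: cylinder_def)
      ultimately show "u \<in> \<Union>\<C>" using cylinder_local unfolding \<C>_def by blast
    qed (auto simp: \<C>_def)
    moreover have "\<Union>\<C> \<in> sigma_sets X local_sets"
    proof (rule sigma_sets_UNION)
      show "countable \<C>" unfolding \<C>_def using countable_local by (rule countable_subset[rotated]) auto
      show "B \<in> sigma_sets X local_sets" if "B \<in> \<C>" for B
        using that by (intro sigma_sets.Basic) (simp add: \<C>_def)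
    qed
    ultimately show "A \<in> sigma_sets X local_sets" by simp
  qed (use local_open in auto)
  then show ?thesis using sub by (simp add: shift_borel_def)
qed

lemma space_shift_borel: "space (shift_borel G) = X"
proof -
  have "{A. openin (shift_top G) A} \<subseteq> Pow X" by (auto simp: openin_shift_top_iff)
  then show ?thesis by (simp add: shift_borel_def space_measure_of)
qed

lemma shift_probs_space: "M \<in> shift_probs G \<Longrightarrow> space M = X"
  using sets_eq_imp_space_eq[of M "shift_borel G"] by (simp add: shift_probs_def space_shift_borel)

lemma local_in_sets: "M \<in> shift_probs G \<Longrightarrow> A \<in> local_sets \<Longrightarrow> A \<in> sets M"
  by (simp add: shift_probs_def sets_shift_borel)

text \<open>Clopen sets are compact, so a decreasing sequence with empty intersection is eventually
  empty. Continuity at the empty set, as Caratheodory's theorem demands, is thereby automatic for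
  finitely additive functions on \<open>local_sets\<close>.\<close>

lemma decseq_local_empty:
  assumes A: "\<And>i. A i \<in> local_sets" "decseq A" "(\<Inter>i. A i) = {}"
  shows "\<exists>i. A i = {}"
proof (rule ccontr)
  assume "\<not> (\<exists>i. A i = {})"
  then have "\<forall>i. \<exists>v. v \<in> A i" by auto
  from choice[OF this] obtain u where u: "\<And>i. u i \<in> A i" by blast
  have "u i \<in> X" for i using u[of i] A(1)[of i] by (auto simp: local_sets_def)
  from X_seq_compact[of u, OF this] obtain r v where r: "strict_mono r" "v \<in> X"
    "\<forall>n. eventually (\<lambda>j. \<forall>k<n. u (r j) k = v k) sequentially" by blast
  have "v \<in> A i" for i
  proof -
    obtain n where n: "A i \<subseteq> X" "\<And>u v. u \<in> X \<Longrightarrow> v \<in> X \<Longrightarrow> agree n u v \<Longrightarrow> u \<in> A i \<longleftrightarrow> v \<in> A i"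
      using local_setsE[OF A(1)[of i]] by metis
    have "eventually (\<lambda>j. (\<forall>k<n. u (r j) k = v k) \<and> i \<le> j) sequentially"
      using r(3)[rule_format] eventually_ge_at_top by (rule eventually_conj)
    then obtain j where j: "\<forall>k<n. u (r j) k = v k" "i \<le> j"
      using eventually_happens'[OF sequentially_bot] by blast
    have "i \<le> r j" using j(2) strict_mono_imp_increasing[OF r(1), of j] by linarith
    then have "u (r j) \<in> A i" using u[of "r j"] A(2) by (auto simp: decseq_def)
    then show ?thesis using n(2)[of "u (r j)" v] n(1) j(1) r(2) by (auto simp: agree_def)
  qed
  then show False using A(3) by blast
qed

lemma ex_measure_local:
  assumes nonneg: "\<And>A. A \<in> local_sets \<Longrightarrow> 0 \<le> f A" and f1: "f X = 1"
    and add: "\<And>A B. A \<in> local_sets \<Longrightarrow> B \<in> local_sets \<Longrightarrow> A \<inter> B = {} \<Longrightarrow> f (A \<union> B) = f A + f B"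
  obtains \<nu> where "\<nu> \<in> shift_probs G" "\<And>A. A \<in> local_sets \<Longrightarrow> measure \<nu> A = (f A :: real)"
proof -
  interpret algebra X local_sets by (rule algebra_local)
  have f0: "f {} = 0" using add[of "{}" "{}"] by simp
  have "\<exists>M :: (nat \<Rightarrow> 'e) set \<Rightarrow> ennreal. (\<forall>s\<in>local_sets. M s = ennreal (f s)) \<and> measure_space X (sigma_sets X local_sets) M"
  proof (rule caratheodory_empty_continuous)
    show "positive local_sets (\<lambda>A. ennreal (f A))" by (simp add: positive_def f0)
    show "additive local_sets (\<lambda>A. ennreal (f A))"
      unfolding additive_def using add nonneg by (auto simp: ennreal_plus)
    fix A :: "nat \<Rightarrow> (nat \<Rightarrow> 'e) set"
    assume A: "range A \<subseteq> local_sets" "decseq A" "(\<Inter>i. A i) = {}"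
    obtain i where i: "A i = {}" using decseq_local_empty[of A] A by blast
    have "A j = {}" if "i \<le> j" for j using A(2) i that by (auto simp: decseq_def)
    then have "eventually (\<lambda>j. ennreal (f (A j)) = 0) sequentially"
      by (auto simp: eventually_sequentially f0 intro!: exI[of _ i])
    then show "(\<lambda>j. ennreal (f (A j))) \<longlonglongrightarrow> 0" by (rule tendsto_eventually)
  qed simp
  then obtain M where M: "\<And>s. s \<in> local_sets \<Longrightarrow> M s = ennreal (f s)" "measure_space X (sigma_sets X local_sets) M"
    by blast
  define \<nu> where "\<nu> = measure_of X local_sets M"
  have sub: "local_sets \<subseteq> Pow X" by (rule space_closed)
  have sets: "sets \<nu> = sigma_sets X local_sets" and space: "space \<nu> = X"
    using sub by (simp_all add: \<nu>_def)
  have em: "emeasure \<nu> A = ennreal (f A)" if "A \<in> local_sets" for A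
    using emeasure_measure_of[OF \<nu>_def sub, of A] M that
    by (simp add: measure_space_def sets)
  have "prob_space \<nu>"
    using em[OF top] by (intro prob_spaceI) (simp add: space f1)
  then have "\<nu> \<in> shift_probs G" by (simp add: shift_probs_def sets sets_shift_borel)
  moreover have "measure \<nu> A = f A" if "A \<in> local_sets" for A
    using em[OF that] nonneg[OF that] by (simp add: measure_def)
  ultimately show thesis by (rule that)
qed

text \<open>A diagonal extraction over the countable algebra makes all measures of local sets
  converge. The limits are finitely additive with total mass 1, and \<open>ex_measure_local\<close>
  extends them to a probability measure.\<close>

lemma probs_seq_compact:
  fixes M :: "nat \<Rightarrow> (nat \<Rightarrow> 'e) measure"
  assumes M: "\<And>j. M j \<in> shift_probs G"
  obtains r \<nu> where "strict_mono r" "\<nu> \<in> shift_probs G"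
    "\<And>A. A \<in> local_sets \<Longrightarrow> (\<lambda>j. measure (M (r j)) A) \<longlonglongrightarrow> measure \<nu> A"
proof -
  interpret algebra X local_sets by (rule algebra_local)
  have ps: "prob_space (M j)" for j using M by (simp add: shift_probs_def)
  obtain r l where r: "strict_mono r" and l: "\<And>i. (\<lambda>j. measure (M (r j)) (from_nat_into local_sets i)) \<longlonglongrightarrow> l i"
    using diagonal_subsequence[of "\<lambda>j i. measure (M j) (from_nat_into local_sets i)"] prob_space.prob_le_1[OF ps]
    by auto
  define f where "f A = lim (\<lambda>j. measure (M (r j)) A)" for A
  have f: "(\<lambda>j. measure (M (r j)) A) \<longlonglongrightarrow> f A" if A: "A \<in> local_sets" for A
  proof -
    obtain i where "from_nat_into local_sets i = A" using from_nat_into_surj[OF countable_local A] by auto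
    then have "convergent (\<lambda>j. measure (M (r j)) A)" using l[of i] by (auto simp: convergent_def)
    then show ?thesis by (simp add: f_def convergent_LIMSEQ_iff)
  qed
  obtain \<nu> where \<nu>: "\<nu> \<in> shift_probs G" "\<And>A. A \<in> local_sets \<Longrightarrow> measure \<nu> A = f A"
  proof (rule ex_measure_local[of f])
    fix A assume A: "A \<in> local_sets"
    show "0 \<le> f A" by (rule LIMSEQ_le_const[OF f[OF A]]) auto
    fix B assume B: "B \<in> local_sets" and AB: "A \<inter> B = {}"
    have "measure (M j) (A \<union> B) = measure (M j) A + measure (M j) B" for j
      using ps[of j] local_in_sets[OF M] A B AB
      by (intro finite_measure.finite_measure_Union) (auto simp: prob_space_def)
    then have "(\<lambda>j. measure (M (r j)) (A \<union> B)) \<longlonglongrightarrow> f A + f B"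
      using tendsto_add[OF f[OF A] f[OF B]] by simp
    then show "f (A \<union> B) = f A + f B" using f[of "A \<union> B"] A B LIMSEQ_unique by blast
  next
    have "measure (M j) X = 1" for j
      using prob_space.prob_space[OF ps[of j]] shift_probs_space[OF M[of j]] by simp
    then show "f X = 1" using f[OF top] LIMSEQ_unique[of "\<lambda>_. 1" 1 "f X"] by simp
  qed auto
  show thesis
    by (rule that[OF r \<nu>(1)]) (use f \<nu>(2) in simp)
qed

end


section \<open>Weakly continuous functions of empirical measures\<close>

context shift_graph
begin

section \<open>Uniform approximation by step functions and convergence of integrals\<close>

lemma continuous_uniform:
  assumes f: "continuous_map (shift_top G) euclideanreal f" and e: "0 < e"
  shows "\<exists>n. \<forall>u\<in>X. \<forall>v\<in>X. agree n u v \<longrightarrow> \<bar>f u - f v\<bar> < e"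
proof (rule ccontr)
  assume "\<not> ?thesis"
  then have "\<forall>n. \<exists>u v. u \<in> X \<and> v \<in> X \<and> agree n u v \<and> e \<le> \<bar>f u - f v\<bar>" by (meson not_less)
  then obtain u v where uv: "\<And>n. u n \<in> X" "\<And>n. v n \<in> X" "\<And>n. agree n (u n) (v n)" "\<And>n. e \<le> \<bar>f (u n) - f (v n)\<bar>"
    by metis
  obtain r x where r: "strict_mono r" "x \<in> X" "\<forall>n. eventually (\<lambda>j. \<forall>k<n. u (r j) k = x k) sequentially"
    using X_seq_compact[of u, OF uv(1)] by blast
  have "openin (shift_top G) {y \<in> topspace (shift_top G). f y \<in> ball (f x) (e / 2)}"
    by (rule openin_continuous_map_preimage[OF f]) simp
  moreover have "x \<in> {y \<in> topspace (shift_top G). f y \<in> ball (f x) (e / 2)}"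
    using r(2) e by (simp add: topspace_shift_top)
  ultimately obtain n where "\<forall>v\<in>X. (\<forall>k<n. v k = x k) \<longrightarrow> v \<in> {y \<in> topspace (shift_top G). f y \<in> ball (f x) (e / 2)}"
    unfolding openin_shift_top_iff by blast
  then have n: "\<bar>f x - f y\<bar> < e / 2" if "y \<in> X" "agree n y x" for y
    using that by (auto simp: agree_def dist_real_def)
  have "eventually (\<lambda>j. (\<forall>k<n. u (r j) k = x k) \<and> n \<le> j) sequentially"
    using r(3)[rule_format] eventually_ge_at_top by (rule eventually_conj)
  then obtain j where j: "\<forall>k<n. u (r j) k = x k" "n \<le> j"
    using eventually_happens'[OF sequentially_bot] by blast
  have nr: "n \<le> r j" using j(2) strict_mono_imp_increasing[OF r(1), of j] by linarith
  have 1: "agree n (u (r j)) x" using j(1) by (simp add: agree_def)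
  have 2: "agree n (v (r j)) x" using 1 agree_mono[OF uv(3) nr] by (simp add: agree_def)
  have "\<bar>f (u (r j)) - f (v (r j))\<bar> < e"
    using n[OF uv(1) 1] n[OF uv(2) 2] by linarith
  then show False using uv(4)[of "r j"] by simp
qed

definition rep :: "'e list \<Rightarrow> nat \<Rightarrow> 'e" where
  "rep w = (SOME u. u \<in> cylinder G w)"

lemma rep_in_cylinder: "w \<in> words G n \<Longrightarrow> rep w \<in> cylinder G w"
  unfolding rep_def using cylinder_ne[of w n] some_in_eq[of "cylinder G w"] by simp

definition step_approx :: "((nat \<Rightarrow> 'e) \<Rightarrow> real) \<Rightarrow> nat \<Rightarrow> (nat \<Rightarrow> 'e) \<Rightarrow> real" where
  "step_approx f n u = (\<Sum>w\<in>words G n. f (rep w) * indicator (cylinder G w) u)"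

lemma abs_diff_step_approx:
  assumes n: "\<And>u v. u \<in> X \<Longrightarrow> v \<in> X \<Longrightarrow> agree n u v \<Longrightarrow> \<bar>f u - f v\<bar> < e" and u: "u \<in> X"
  shows "\<bar>f u - step_approx f n u\<bar> < e"
proof -
  define w where "w = map u [0..<n]"
  have w: "w \<in> words G n" using prefix_in_words[OF u] by (simp add: w_def)
  have ind: "indicator (cylinder G w') u = (if w' = w then 1 else 0 :: real)" if "w' \<in> words G n" for w'
  proof -
    have l: "length w' = n" using that by (simp add: words_def)
    have "w' = w" if "u \<in> cylinder G w'"
      using that l by (intro nth_equalityI) (auto simp: cylinder_def w_def)
    moreover have "u \<in> cylinder G w" using u by (simp add: cylinder_def w_def)
    ultimately have "u \<in> cylinder G w' \<longleftrightarrow> w' = w" by blast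
    then show ?thesis by (simp add: indicator_def)
  qed
  have "step_approx f n u = (\<Sum>w'\<in>words G n. if w' = w then f (rep w') else 0)"
    unfolding step_approx_def by (intro sum.cong) (auto simp: ind)
  also have "\<dots> = f (rep w)" using w finite_words[of n] by simp
  finally have "step_approx f n u = f (rep w)" .
  moreover have "rep w \<in> X" "agree n u (rep w)" using rep_in_cylinder[OF w] by (auto simp: cylinder_def agree_def w_def)
  ultimately show ?thesis using n[OF u] by simp
qed

lemma continuous_bounded:
  assumes f: "continuous_map (shift_top G) euclideanreal f"
  shows "\<exists>B. \<forall>u\<in>X. \<bar>f u\<bar> \<le> B"
proof -
  obtain n where n: "\<And>u v. u \<in> X \<Longrightarrow> v \<in> X \<Longrightarrow> agree n u v \<Longrightarrow> \<bar>f u - f v\<bar> < 1"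
    using continuous_uniform[OF f, of 1] by auto
  have "\<bar>f u\<bar> \<le> (\<Sum>w\<in>words G n. \<bar>f (rep w)\<bar>) + 1" if u: "u \<in> X" for u
  proof -
    have "\<bar>step_approx f n u\<bar> \<le> (\<Sum>w\<in>words G n. \<bar>f (rep w)\<bar>)"
      unfolding step_approx_def
      by (rule order_trans[OF sum_abs]) (auto intro!: sum_mono simp: abs_mult indicator_def)
    then show ?thesis using abs_diff_step_approx[of n f 1, OF n u] by linarith
  qed
  then show ?thesis by blast
qed

lemma continuous_measurable:
  assumes f: "continuous_map (shift_top G) euclideanreal f"
  shows "f \<in> borel_measurable (shift_borel G)"
proof (rule borel_measurableI)
  fix S :: "real set" assume "open S"
  then have "openin (shift_top G) {y \<in> topspace (shift_top G). f y \<in> S}"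
    by (intro openin_continuous_map_preimage[OF f]) simp
  moreover have "f -` S \<inter> space (shift_borel G) = {y \<in> topspace (shift_top G). f y \<in> S}"
    by (auto simp: space_shift_borel topspace_shift_top)
  moreover have "{A. openin (shift_top G) A} \<subseteq> Pow X" by (auto simp: openin_shift_top_iff)
  ultimately show "f -` S \<inter> space (shift_borel G) \<in> sets (shift_borel G)"
    by (simp add: shift_borel_def)
qed

lemma shift_probs_measurable:
  fixes f :: "(nat \<Rightarrow> 'e) \<Rightarrow> real"
  assumes "M \<in> shift_probs G" "f \<in> borel_measurable (shift_borel G)"
  shows "f \<in> borel_measurable M"
proof -
  have "borel_measurable M = (borel_measurable (shift_borel G) :: ((nat \<Rightarrow> 'e) \<Rightarrow> real) set)"
    using assms(1) by (intro measurable_cong_sets) (auto simp: shift_probs_def)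
  then show ?thesis using assms(2) by simp
qed

lemma integral_step_approx:
  assumes M: "M \<in> shift_probs G"
  shows "integrable M (step_approx f n)"
    and "integral\<^sup>L M (step_approx f n) = (\<Sum>w\<in>words G n. f (rep w) * measure M (cylinder G w))"
proof -
  interpret prob_space M using M by (simp add: shift_probs_def)
  have c: "cylinder G w \<in> sets M" for w using local_in_sets[OF M cylinder_local] .
  have sa: "step_approx f n = (\<lambda>u. \<Sum>w\<in>words G n. f (rep w) * indicator (cylinder G w) u)"
    by (simp add: fun_eq_iff step_approx_def)
  have i: "integrable M (\<lambda>u. f (rep w) * indicator (cylinder G w) u)" for w
    by (rule integrable_mult_right, rule integrable_real_indicator[OF c]) (simp add: less_top[symmetric])
  show "integrable M (step_approx f n)" unfolding sa by (intro Bochner_Integration.integrable_sum i)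
  show "integral\<^sup>L M (step_approx f n) = (\<Sum>w\<in>words G n. f (rep w) * measure M (cylinder G w))"
  proof -
    have "integral\<^sup>L M (indicator (cylinder G w)) = measure M (cylinder G w)" for w
      using Int_absorb2[OF sets.sets_into_space[OF c[of w]]] by simp
    then show ?thesis
      unfolding sa Bochner_Integration.integral_sum[OF i] by (simp only: integral_mult_right_zero)
  qed
qed

lemma integral_step_approx_le:
  assumes M: "M \<in> shift_probs G" and f: "continuous_map (shift_top G) euclideanreal f"
    and n: "\<And>u v. u \<in> X \<Longrightarrow> v \<in> X \<Longrightarrow> agree n u v \<Longrightarrow> \<bar>f u - f v\<bar> < e"
  shows "\<bar>integral\<^sup>L M f - integral\<^sup>L M (step_approx f n)\<bar> \<le> e"
proof -
  interpret prob_space M using M by (simp add: shift_probs_def)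
  obtain B where B: "\<forall>u\<in>X. \<bar>f u\<bar> \<le> B" using continuous_bounded[OF f] by blast
  have "integrable M f"
    by (rule integrable_const_bound[where B = B])
      (use B shift_probs_space[OF M] shift_probs_measurable[OF M continuous_measurable[OF f]] in auto)
  moreover note integral_step_approx(1)[OF M, of f n]
  ultimately have "integral\<^sup>L M f - integral\<^sup>L M (step_approx f n) = (LINT u|M. f u - step_approx f n u)"
    and i: "integrable M (\<lambda>u. f u - step_approx f n u)" by simp_all
  then have "\<bar>integral\<^sup>L M f - integral\<^sup>L M (step_approx f n)\<bar> \<le> (LINT u|M. \<bar>f u - step_approx f n u\<bar>)"
    by simp
  also have "\<dots> \<le> (LINT u|M. e)"
    by (rule integral_mono) (use i abs_diff_step_approx[of n f e, OF n] shift_probs_space[OF M] in \<open>auto simp: less_imp_le\<close>)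
  also have "\<dots> = e" by (simp add: prob_space)
  finally show ?thesis .
qed

lemma tendsto_integral:
  fixes M :: "nat \<Rightarrow> (nat \<Rightarrow> 'e) measure"
  assumes M: "\<And>j. M j \<in> shift_probs G" and N: "N \<in> shift_probs G"
    and lim: "\<And>A. A \<in> local_sets \<Longrightarrow> (\<lambda>j. measure (M j) A) \<longlonglongrightarrow> measure N A"
    and f: "continuous_map (shift_top G) euclideanreal f"
  shows "(\<lambda>j. integral\<^sup>L (M j) f) \<longlonglongrightarrow> integral\<^sup>L N f"
proof (rule tendstoI)
  fix e :: real assume e: "0 < e"
  obtain n where n: "\<And>u v. u \<in> X \<Longrightarrow> v \<in> X \<Longrightarrow> agree n u v \<Longrightarrow> \<bar>f u - f v\<bar> < e / 3"
    using continuous_uniform[OF f, of "e / 3"] e by auto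
  have "(\<lambda>j. \<Sum>w\<in>words G n. f (rep w) * measure (M j) (cylinder G w)) \<longlonglongrightarrow> (\<Sum>w\<in>words G n. f (rep w) * measure N (cylinder G w))"
    by (intro tendsto_intros lim cylinder_local)
  then have "(\<lambda>j. integral\<^sup>L (M j) (step_approx f n)) \<longlonglongrightarrow> integral\<^sup>L N (step_approx f n)"
    by (simp add: integral_step_approx(2)[OF M] integral_step_approx(2)[OF N])
  then have "eventually (\<lambda>j. dist (integral\<^sup>L (M j) (step_approx f n)) (integral\<^sup>L N (step_approx f n)) < e / 3) sequentially"
    using e by (intro tendstoD) auto
  then show "eventually (\<lambda>j. dist (integral\<^sup>L (M j) f) (integral\<^sup>L N f) < e) sequentially"
  proof eventually_elim
    case (elim j)
    have "\<bar>integral\<^sup>L (M j) f - integral\<^sup>L (M j) (step_approx f n)\<bar> \<le> e / 3"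
      "\<bar>integral\<^sup>L N f - integral\<^sup>L N (step_approx f n)\<bar> \<le> e / 3"
      using integral_step_approx_le[OF _ f n] M N by auto
    then show ?case using elim e unfolding dist_real_def by argo
  qed
qed

lemma topspace_weak_top: "topspace (weak_top G) = shift_probs G"
proof
  show "topspace (weak_top G) \<subseteq> shift_probs G" unfolding weak_top_def topology_generated_by_topspace by auto
  have "continuous_map (shift_top G) euclideanreal (\<lambda>_. 0)" by simp
  then have "{M \<in> shift_probs G. integral\<^sup>L M (\<lambda>_. 0) \<in> (UNIV :: real set)} \<in>
     {{M \<in> shift_probs G. integral\<^sup>L M f \<in> W} | f W. continuous_map (shift_top G) euclideanreal f \<and> open W}"
    by blast
  then show "shift_probs G \<subseteq> topspace (weak_top G)" unfolding weak_top_def topology_generated_by_topspace by auto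
qed

text \<open>Convergence on local sets gives convergence of the integrals of continuous functions,
  hence eventual membership in the generating sets of the weak topology; finite intersections and
  unions preserve this. Continuity of \<open>U\<close> is used only through such convergent
  sequences.\<close>

lemma tendsto_continuous_weak:
  fixes M :: "nat \<Rightarrow> (nat \<Rightarrow> 'e) measure" and U :: "(nat \<Rightarrow> 'e) measure \<Rightarrow> 'x :: metric_space"
  assumes M: "\<And>j. M j \<in> shift_probs G" and N: "N \<in> shift_probs G"
    and lim: "\<And>A. A \<in> local_sets \<Longrightarrow> (\<lambda>j. measure (M j) A) \<longlonglongrightarrow> measure N A"
    and U: "continuous_map (weak_top G) euclidean U"
  shows "(\<lambda>j. U (M j)) \<longlonglongrightarrow> U N"
proof -
  have "limitin (weak_top G) M N sequentially"
    unfolding limitin_def topspace_weak_top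
  proof (intro conjI N allI impI)
    fix S assume S: "openin (weak_top G) S \<and> N \<in> S"
    have "generate_topology_on {{M \<in> shift_probs G. integral\<^sup>L M f \<in> W} | f W. continuous_map (shift_top G) euclideanreal f \<and> open W} S"
      using S unfolding weak_top_def openin_topology_generated_by_iff by simp
    then have "N \<in> S \<longrightarrow> eventually (\<lambda>j. M j \<in> S) sequentially"
    proof (induction rule: generate_topology_on.induct)
      case (Int a b)
      then show ?case by (auto intro: eventually_conj)
    next
      case (UN K)
      show ?case
      proof
        assume "N \<in> \<Union>K"
        then obtain k where "k \<in> K" "N \<in> k" by blast
        then have "eventually (\<lambda>j. M j \<in> k) sequentially" using UN by blast
        then show "eventually (\<lambda>j. M j \<in> \<Union>K) sequentially" by eventually_elim (use \<open>k \<in> K\<close> in blast)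
      qed
    next
      case (Basis s)
      then obtain f W where s: "s = {M \<in> shift_probs G. integral\<^sup>L M f \<in> W}"
        and f: "continuous_map (shift_top G) euclideanreal f" and W: "open W" by blast
      show ?case
      proof
        assume "N \<in> s"
        then have "integral\<^sup>L N f \<in> W" using s by simp
        then have "eventually (\<lambda>j. integral\<^sup>L (M j) f \<in> W) sequentially"
          by (rule topological_tendstoD[OF tendsto_integral[OF M N _ f] W, rotated]) (rule lim)
        then show "eventually (\<lambda>j. M j \<in> s) sequentially"
          by eventually_elim (use s M in simp)
      qed
    qed simp
    then show "eventually (\<lambda>j. M j \<in> S) sequentially" using S by simp
  qed
  from continuous_map_limit[OF U this] show ?thesis by (simp add: comp_def)
qed

lemma continuous_weak_bounded:
  fixes U :: "(nat \<Rightarrow> 'e) measure \<Rightarrow> 'x :: real_normed_vector"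
  assumes U: "continuous_map (weak_top G) euclidean U"
  shows "\<exists>B. \<forall>M\<in>shift_probs G. norm (U M) \<le> B"
proof (rule ccontr)
  assume "\<not> ?thesis"
  then have "\<forall>n::nat. \<exists>M\<in>shift_probs G. real n < norm (U M)" by (meson not_le)
  then obtain M where M: "\<And>n. M n \<in> shift_probs G" "\<And>n. real n < norm (U (M n))" by metis
  obtain r N where r: "strict_mono r" "N \<in> shift_probs G"
    "\<And>A. A \<in> local_sets \<Longrightarrow> (\<lambda>j. measure (M (r j)) A) \<longlonglongrightarrow> measure N A"
    using probs_seq_compact[of M, OF M(1)] by metis
  have "(\<lambda>j. U (M (r j))) \<longlonglongrightarrow> U N" by (rule tendsto_continuous_weak[OF M(1) r(2,3) U])
  then have "Bseq (\<lambda>j. U (M (r j)))" by (intro convergent_imp_Bseq convergentI)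
  then obtain K where K: "\<And>j. norm (U (M (r j))) \<le> K" by (auto simp: Bseq_def)
  obtain j :: nat where "K \<le> real j" using real_arch_simple by blast
  also have "real j \<le> real (r j)" using strict_mono_imp_increasing[OF r(1), of j] by simp
  also have "\<dots> < norm (U (M (r j)))" by (rule M(2))
  finally show False using K[of j] by simp
qed

section \<open>Empirical measures and their dependence on the tail of a string\<close>

lemma measurable_orbit:
  "u \<in> X \<Longrightarrow> (\<lambda>k. (shift ^^ k) u) \<in> measurable (uniform_count_measure {..<n}) (shift_borel G)"
  using funpow_shift_in[of u]
  by (auto simp: measurable_def space_shift_borel sets_uniform_count_measure space_uniform_count_measure)

text \<open>The values of a measure built by \<open>measure_of\<close> are those of the given
  function only once that function is known to be countably additive. Recognising the image of the
  uniform measure on \<open>{..<n}\<close> settles this for all later uses.\<close>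

lemma empirical_eq_distr:
  assumes n: "0 < n" and u: "u \<in> X"
  shows "empirical G n u = distr (uniform_count_measure {..<n}) (shift_borel G) (\<lambda>k. (shift ^^ k) u)"
proof -
  define Q where "Q = distr (uniform_count_measure {..<n}) (shift_borel G) (\<lambda>k. (shift ^^ k) u)"
  note meas = measurable_orbit[OF u, of n]
  have sp: "space Q = X" "sets Q = sets (shift_borel G)" by (simp_all add: Q_def space_shift_borel)
  have "Q = measure_of (space Q) (sets Q) (emeasure Q)" by (rule measure_of_of_measure[symmetric])
  also have "\<dots> = measure_of X (sets (shift_borel G)) (emeasure Q)" by (simp add: sp)
  also have "\<dots> = empirical G n u"
    unfolding empirical_def
  proof (rule measure_of_eq)
    show "sets (shift_borel G) \<subseteq> Pow X" using sets.space_closed[of "shift_borel G"] by (simp add: space_shift_borel)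
    fix A assume "A \<in> sigma_sets X (sets (shift_borel G))"
    then have A: "A \<in> sets (shift_borel G)"
      using sets.sigma_sets_eq[of "shift_borel G"] by (simp add: space_shift_borel)
    have "emeasure Q A = emeasure (uniform_count_measure {..<n}) {k\<in>{..<n}. (shift ^^ k) u \<in> A}"
      unfolding Q_def using emeasure_distr[OF meas A]
      by (simp add: space_uniform_count_measure vimage_def Int_def conj_commute)
    also have "\<dots> = ennreal (real (card {k\<in>{..<n}. (shift ^^ k) u \<in> A}) / real n)"
      by (subst emeasure_uniform_count_measure) auto
    also have "\<dots> = ennreal (1 / real n) * ennreal (real (card {k\<in>{..<n}. (shift ^^ k) u \<in> A}))"
      by (simp flip: ennreal_mult')
    also have "ennreal (real (card {k\<in>{..<n}. (shift ^^ k) u \<in> A})) = (\<Sum>k<n. indicator A ((shift ^^ k) u))"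
      by (simp add: indicator_def sum.If_cases Int_def ennreal_of_nat_eq_real_of_nat)
    also have "\<dots> = (\<Sum>k<n. emeasure (return (shift_borel G) ((shift ^^ k) u)) A)"
      using A by simp
    finally show "emeasure Q A = ennreal (1 / real n) * (\<Sum>k<n. emeasure (return (shift_borel G) ((shift ^^ k) u)) A)" .
  qed
  finally show ?thesis by (simp add: Q_def)
qed

lemma empirical_in_probs:
  assumes "0 < n" "u \<in> X" shows "empirical G n u \<in> shift_probs G"
proof -
  note meas = measurable_orbit[OF assms(2), of n]
  have "prob_space (uniform_count_measure {..<n})" using assms(1) by (intro prob_space_uniform_count_measure) auto
  then show ?thesis
    unfolding empirical_eq_distr[OF assms] shift_probs_def using prob_space.prob_space_distr[OF _ meas] by simp
qed

lemma integral_empirical: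
  assumes "0 < n" "u \<in> X" "f \<in> borel_measurable (shift_borel G)"
  shows "integral\<^sup>L (empirical G n u) f = birkhoff f n u / real n"
proof -
  note meas = measurable_orbit[OF assms(2), of n]
  show ?thesis
    unfolding empirical_eq_distr[OF assms(1,2)]
    by (subst integral_distr[OF meas assms(3)]) (simp add: integral_uniform_count_measure birkhoff_def)
qed

lemma measure_empirical:
  assumes "0 < n" "u \<in> X" "A \<in> local_sets"
  shows "measure (empirical G n u) A = (\<Sum>k<n. indicator A ((shift ^^ k) u)) / real n"
proof -
  have E: "empirical G n u \<in> shift_probs G" using assms by (intro empirical_in_probs)
  then interpret prob_space "empirical G n u" by (simp add: shift_probs_def)
  have A: "A \<in> sets (empirical G n u)" by (rule local_in_sets[OF E assms(3)])
  then have "A \<in> sets (shift_borel G)" using E by (simp add: shift_probs_def)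
  then have "integral\<^sup>L (empirical G n u) (indicator A) = birkhoff (indicator A) n u / real n"
    using assms by (intro integral_empirical) auto
  then show ?thesis using A sets.sets_into_space[OF A] by (simp add: birkhoff_def Int_absorb2)
qed

text \<open>The first \<open>m\<close> letters of the k-th shift lie within the common word as long
  as \<open>k + m \<le> n\<close>, so at most the last \<open>m\<close> of the \<open>n\<close>
  point masses can be separated by \<open>A\<close>.\<close>

lemma measure_empirical_diff:
  assumes n: "0 < n" and w: "w \<in> words G n" "u \<in> cylinder G w" "v \<in> cylinder G w"
    and A: "A \<in> local_sets" "\<And>u v. u \<in> X \<Longrightarrow> v \<in> X \<Longrightarrow> agree m u v \<Longrightarrow> u \<in> A \<longleftrightarrow> v \<in> A"
  shows "\<bar>measure (empirical G n u) A - measure (empirical G n v) A\<bar> \<le> real m / real n"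
proof -
  have uv: "u \<in> X" "v \<in> X" using w by (auto simp: cylinder_def)
  have l: "length w = n" using w by (simp add: words_def)
  have "\<bar>(\<Sum>k<n. indicator A ((shift ^^ k) u)) - (\<Sum>k<n. indicator A ((shift ^^ k) v) :: real)\<bar>
    \<le> (\<Sum>k<n. \<bar>indicator A ((shift ^^ k) u) - indicator A ((shift ^^ k) v)\<bar>)"
    unfolding sum_subtractf[symmetric] by (rule sum_abs)
  also have "\<dots> \<le> (\<Sum>k<n. indicator {n - m..<n} k)"
  proof (rule sum_mono)
    fix k assume k: "k \<in> {..<n}"
    show "\<bar>indicator A ((shift ^^ k) u) - indicator A ((shift ^^ k) v)\<bar> \<le> (indicator {n - m..<n} k :: real)"
    proof (cases "k + m \<le> n")
      case True
      have "agree m ((shift ^^ k) u) ((shift ^^ k) v)"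
        using w True by (auto simp: agree_def funpow_shift cylinder_def l)
      then have "(shift ^^ k) u \<in> A \<longleftrightarrow> (shift ^^ k) v \<in> A"
        using A(2) funpow_shift_in uv by blast
      then show ?thesis by (simp add: indicator_def)
    next
      case False
      then have "k \<in> {n - m..<n}" using k by auto
      then show ?thesis by (simp add: indicator_def)
    qed
  qed
  also have "\<dots> = (\<Sum>k\<in>{n - m..<n}. 1 :: real)"
    by (rule sum.mono_neutral_cong_right) auto
  also have "\<dots> \<le> real m" by simp
  finally show ?thesis
    unfolding measure_empirical[OF n uv(1) A(1)] measure_empirical[OF n uv(2) A(1)] diff_divide_distrib[symmetric]
    using n by (simp add: divide_right_mono)
qed

text \<open>Otherwise two sequences of empirical measures from common cylinders would have
  \<open>U\<close> values at distance at least \<open>e\<close>. Along a convergent subsequence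
  their measures of each local set differ by O(1/n), so both have the same weak limit.\<close>

lemma continuous_weak_oscillation:
  fixes U :: "(nat \<Rightarrow> 'e) measure \<Rightarrow> 'x :: metric_space"
  assumes U: "continuous_map (weak_top G) euclidean U" and e: "0 < e"
  shows "\<exists>N>0. \<forall>n\<ge>N. \<forall>w\<in>words G n. \<forall>u\<in>cylinder G w. \<forall>v\<in>cylinder G w.
    dist (U (empirical G n u)) (U (empirical G n v)) < e"
proof (rule ccontr)
  assume "\<not> ?thesis"
  then have "\<forall>N. \<exists>n w u v. Suc N \<le> n \<and> w \<in> words G n \<and> u \<in> cylinder G w \<and> v \<in> cylinder G w \<and>
      e \<le> dist (U (empirical G n u)) (U (empirical G n v))"
    by (meson not_less zero_less_Suc)
  then obtain n w u v where n: "\<And>j. Suc j \<le> n j" and w: "\<And>j. w j \<in> words G (n j)"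
    and u: "\<And>j. u j \<in> cylinder G (w j)" and v: "\<And>j. v j \<in> cylinder G (w j)"
    and ge: "\<And>j. e \<le> dist (U (empirical G (n j) (u j))) (U (empirical G (n j) (v j)))"
    by metis
  have n0: "0 < n j" for j using n[of j] by simp
  have uX: "u j \<in> X" "v j \<in> X" for j using u[of j] v[of j] by (auto simp: cylinder_def)
  define M where "M j = empirical G (n j) (u j)" for j
  define V where "V j = empirical G (n j) (v j)" for j
  have M: "M j \<in> shift_probs G" and V: "V j \<in> shift_probs G" for j
    unfolding M_def V_def by (intro empirical_in_probs n0 uX)+
  obtain r N where r: "strict_mono r" "N \<in> shift_probs G"
    "\<And>A. A \<in> local_sets \<Longrightarrow> (\<lambda>j. measure (M (r j)) A) \<longlonglongrightarrow> measure N A"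
    using probs_seq_compact[of M, OF M] by metis
  have lV: "(\<lambda>j. measure (V (r j)) A) \<longlonglongrightarrow> measure N A" if A: "A \<in> local_sets" for A
  proof -
    obtain m where m: "\<And>u v. u \<in> X \<Longrightarrow> v \<in> X \<Longrightarrow> agree m u v \<Longrightarrow> u \<in> A \<longleftrightarrow> v \<in> A"
      using local_setsE[OF A] by metis
    have "(\<lambda>j. measure (M (r j)) A - measure (V (r j)) A) \<longlonglongrightarrow> 0"
    proof (rule Lim_null_comparison)
      show "eventually (\<lambda>j. norm (measure (M (r j)) A - measure (V (r j)) A) \<le> real m * inverse (real (Suc j))) sequentially"
      proof (rule always_eventually, rule allI)
        fix j
        have "Suc j \<le> n (r j)" using n[of "r j"] strict_mono_imp_increasing[OF r(1), of j] by linarith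
        have "norm (measure (M (r j)) A - measure (V (r j)) A) \<le> real m / real (n (r j))"
          unfolding M_def V_def real_norm_def by (rule measure_empirical_diff[OF n0 w u v A m])
        also have "\<dots> \<le> real m / real (Suc j)"
          using \<open>Suc j \<le> n (r j)\<close> by (intro divide_left_mono) auto
        finally show "norm (measure (M (r j)) A - measure (V (r j)) A) \<le> real m * inverse (real (Suc j))"
          by (simp add: divide_inverse)
      qed
      show "(\<lambda>j. real m * inverse (real (Suc j))) \<longlonglongrightarrow> 0"
        using tendsto_mult_right_zero[OF LIMSEQ_inverse_real_of_nat] by simp
    qed
    from tendsto_diff[OF r(3)[OF A] this] show ?thesis by simp
  qed
  have "(\<lambda>j. U (M (r j))) \<longlonglongrightarrow> U N" "(\<lambda>j. U (V (r j))) \<longlonglongrightarrow> U N"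
    by (rule tendsto_continuous_weak[OF M r(2,3) U] tendsto_continuous_weak[OF V r(2) lV U]; assumption)+
  then have "(\<lambda>j. dist (U (M (r j))) (U (V (r j)))) \<longlonglongrightarrow> dist (U N) (U N)" by (rule tendsto_dist)
  then have "eventually (\<lambda>j. dist (U (M (r j))) (U (V (r j))) < e) sequentially"
    by (rule order_tendstoD) (use e in simp)
  then obtain j where "dist (U (M (r j))) (U (V (r j))) < e" using eventually_happens'[OF sequentially_bot] by blast
  then show False using ge[of "r j"] by (simp add: M_def V_def)
qed

lemma lip_shift_continuous:
  assumes "lip_shift G \<beta> C f" "0 < \<beta>" "\<beta> < 1"
  shows "continuous_map (shift_top G) euclideanreal f"
proof -
  have C: "0 \<le> C" and lip: "\<And>u v. u \<in> X \<Longrightarrow> v \<in> X \<Longrightarrow> \<bar>f u - f v\<bar> \<le> C * shift_dist \<beta> u v"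
    using assms(1) by (auto simp: lip_shift_def)
  have "openin (shift_top G) {u \<in> X. f u \<in> W}" if W: "open W" for W
    unfolding openin_shift_top_iff
  proof (intro conjI ballI)
    fix u assume "u \<in> {u \<in> X. f u \<in> W}"
    then have u: "u \<in> X" "f u \<in> W" by auto
    obtain e where e: "0 < e" "ball (f u) e \<subseteq> W" using W u(2) open_contains_ball by blast
    have "0 < e / (C + 1)" using e C by simp
    then obtain n where n: "\<beta> ^ n < e / (C + 1)" using real_arch_pow_inv assms(3) by blast
    have "f v \<in> W" if "v \<in> X" "\<forall>k<n. v k = u k" for v
    proof -
      have "\<bar>f u - f v\<bar> \<le> C * shift_dist \<beta> u v" using lip u that by blast
      also have "\<dots> \<le> C * \<beta> ^ n" using that C by (intro mult_left_mono shift_dist_agree assms(2,3)) auto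
      also have "\<dots> \<le> (C + 1) * \<beta> ^ n" using assms(2) by (intro mult_right_mono) auto
      also have "\<dots> < e" using n C by (simp add: field_simps)
      finally show ?thesis using e(2) by (auto simp: dist_real_def)
    qed
    then show "\<exists>n. \<forall>v\<in>X. (\<forall>k<n. v k = u k) \<longrightarrow> v \<in> {u \<in> X. f u \<in> W}" using that by blast
  qed auto
  then show ?thesis by (auto simp: continuous_map_def topspace_shift_top)
qed

lemma lip_shift_neg_bound:
  assumes "lip_shift G \<beta> C f" "0 < \<beta>" "\<beta> < 1" and neg: "\<And>u. u \<in> X \<Longrightarrow> f u < 0"
  shows "\<exists>c>0. \<forall>u\<in>X. f u \<le> - c"
proof (rule ccontr)
  assume "\<not> ?thesis"
  then have "\<forall>n. \<exists>u\<in>X. - inverse (real (Suc n)) < f u"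
    by (meson inverse_positive_iff_positive not_le of_nat_0_less_iff zero_less_Suc)
  then obtain u where u: "\<And>n. u n \<in> X" "\<And>n. - inverse (real (Suc n)) < f (u n)" by metis
  obtain r v where r: "strict_mono r" "v \<in> X" "\<forall>n. eventually (\<lambda>j. \<forall>k<n. u (r j) k = v k) sequentially"
    using X_seq_compact[of u, OF u(1)] by blast
  define e where "e = - f v / 2"
  have e: "0 < e" using neg[OF r(2)] by (simp add: e_def)
  obtain n where n: "\<And>u v. u \<in> X \<Longrightarrow> v \<in> X \<Longrightarrow> agree n u v \<Longrightarrow> \<bar>f u - f v\<bar> < e"
    using continuous_uniform[OF lip_shift_continuous[OF assms(1-3)] e] by auto
  obtain N where N: "inverse (real (Suc N)) < e" using reals_Archimedean[OF e] by auto
  have "eventually (\<lambda>j. (\<forall>k<n. u (r j) k = v k) \<and> N \<le> j) sequentially"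
    using r(3)[rule_format] eventually_ge_at_top by (rule eventually_conj)
  then obtain j where j: "\<forall>k<n. u (r j) k = v k" "N \<le> j"
    using eventually_happens'[OF sequentially_bot] by blast
  have "N \<le> r j" using j(2) strict_mono_imp_increasing[OF r(1), of j] by linarith
  then have "inverse (real (Suc (r j))) \<le> inverse (real (Suc N))" by (intro le_imp_inverse_le) auto
  then have "- e < f (u (r j))" using u(2)[of "r j"] N by linarith
  moreover have "\<bar>f (u (r j)) - f v\<bar> < e" using n[OF u(1) r(2)] j(1) by (simp add: agree_def)
  ultimately show False by (simp add: e_def)
qed

end


section \<open>The zeta-functions\<close>

lemma conv_radius_antimono:
  fixes f g :: "nat \<Rightarrow> complex"
  assumes "\<And>n. norm (f n) \<le> norm (g n)"
  shows "conv_radius g \<le> conv_radius f"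
proof (rule conv_radius_geI_ex)
  fix r :: real assume r: "0 < r" "ereal r < conv_radius g"
  have "summable (\<lambda>n. norm (g n * of_real r ^ n))"
    by (rule abs_summable_in_conv_radius) (use r in simp)
  then have "summable (\<lambda>n. f n * of_real r ^ n)"
    by (rule summable_comparison_test[rotated])
       (use assms r in \<open>auto simp: norm_mult norm_power intro!: mult_right_mono\<close>)
  then show "\<exists>z. norm z = r \<and> summable (\<lambda>n. f n * z ^ n)"
    using r by (intro exI[of _ "of_real r"]) auto
qed

text \<open>The continuity of \<open>U\<close> is represented by its two consequences
  \<open>B\<close> and \<open>osc\<close>, and that of \<open>\<phi>\<close> by explicit constants,
  so that the comparison of the series is free of topology.\<close>

locale zeta = shift_graph G for G :: "('v, 'e) pre_digraph" +
  fixes \<beta> C c F B :: real and \<phi> :: "(nat \<Rightarrow> 'e) \<Rightarrow> real" and U :: "(nat \<Rightarrow> 'e) measure \<Rightarrow> 'x :: real_inner"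
  assumes \<beta>: "0 < \<beta>" "\<beta> < 1" and \<phi>_lip: "lip_shift G \<beta> C \<phi>"
    and c: "0 < c" and \<phi>_neg: "\<And>u. u \<in> X \<Longrightarrow> \<phi> u \<le> - c" and F: "\<And>u. u \<in> X \<Longrightarrow> \<bar>\<phi> u\<bar> \<le> F"
    and B: "\<And>n u. 0 < n \<Longrightarrow> u \<in> X \<Longrightarrow> norm (U (empirical G n u)) \<le> B"
    and osc: "\<And>e. 0 < e \<Longrightarrow> \<exists>N>0. \<forall>n\<ge>N. \<forall>w\<in>words G n. \<forall>u\<in>cylinder G w. \<forall>v\<in>cylinder G w.
      dist (U (empirical G n u)) (U (empirical G n v)) < e"
begin

definition Uhat :: "nat \<Rightarrow> (nat \<Rightarrow> 'e) \<Rightarrow> 'x" where "Uhat n u = U (empirical G n u)"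
definition supq :: "'x \<Rightarrow> nat \<Rightarrow> 'e list \<Rightarrow> real" where "supq q n w = (SUP u\<in>cylinder G w. inner q (Uhat n u))"
definition supb :: "nat \<Rightarrow> 'e list \<Rightarrow> real" where "supb n w = (SUP u\<in>cylinder G w. birkhoff \<phi> n u)"
definition Z :: "'x \<Rightarrow> real \<Rightarrow> nat \<Rightarrow> real" where
  "Z q s n = (\<Sum>w\<in>words G n. exp ((supq q n w + s) * supb n w))"
abbreviation \<tau> where "\<tau> \<equiv> tau G U \<phi>"

section \<open>Suprema over cylinders\<close>

lemma F0: "0 \<le> F"
proof -
  obtain u where "u \<in> X" using X_ne by auto
  then show ?thesis using F[of u] by linarith
qed

lemma cyl_X: "u \<in> cylinder G w \<Longrightarrow> u \<in> X"
  by (simp add: cylinder_def)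

lemma words_ne: "words G n \<noteq> {}"
proof -
  obtain u where "u \<in> X" using X_ne by auto
  then show ?thesis using prefix_in_words[of u n] by auto
qed

lemma card_words: "card (words G n) \<le> card (arcs G) ^ n"
proof -
  have "words G n \<subseteq> {w. set w \<subseteq> arcs G \<and> length w = n}" by (auto simp: words_def)
  from card_mono[OF finite_lists_length_eq[OF finite_arcs] this] show ?thesis
    by (simp add: card_lists_length_eq)
qed

lemma birkhoff_bounds:
  assumes "u \<in> X" shows "- (real n * F) \<le> birkhoff \<phi> n u" "birkhoff \<phi> n u \<le> - (real n * c)"
  using abs_birkhoff_le[of \<phi> F u n, OF F assms] birkhoff_le[of \<phi> "- c" u n, OF \<phi>_neg assms] by auto

lemma supb_upper: "u \<in> cylinder G w \<Longrightarrow> birkhoff \<phi> n u \<le> supb n w"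
  unfolding supb_def
  by (rule cSUP_upper) (use birkhoff_bounds(2) cyl_X in \<open>auto intro!: bdd_aboveI2\<close>)

lemma supb_bounds:
  assumes "w \<in> words G n" shows "- (real n * F) \<le> supb n w" "supb n w \<le> - (real n * c)"
proof -
  obtain u where u: "u \<in> cylinder G w" using cylinder_ne[OF assms] by auto
  show "- (real n * F) \<le> supb n w" using supb_upper[OF u, of n] birkhoff_bounds(1)[OF cyl_X[OF u], of n] by linarith
  show "supb n w \<le> - (real n * c)"
    unfolding supb_def by (rule cSUP_least[OF cylinder_ne[OF assms]]) (use birkhoff_bounds(2) cyl_X in blast)
qed

lemma supb_nonpos: "w \<in> words G n \<Longrightarrow> supb n w \<le> 0"
  using supb_bounds(2)[of w n] c by (smt (verit) mult_nonneg_nonneg of_nat_0_le_iff)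

definition distort :: real where "distort = C / (1 - \<beta>)"

lemma distort0: "0 \<le> distort"
  using \<phi>_lip \<beta> by (simp add: distort_def lip_shift_def)

lemma supb_distort:
  assumes w: "w \<in> words G n" and u: "u \<in> cylinder G w"
  shows "supb n w \<le> birkhoff \<phi> n u + distort"
  unfolding supb_def
proof (rule cSUP_least[OF cylinder_ne[OF w]])
  fix v assume v: "v \<in> cylinder G w"
  have "length w = n" using w by (simp add: words_def)
  then show "birkhoff \<phi> n v \<le> birkhoff \<phi> n u + distort"
    using birkhoff_cylinder_distortion[OF \<phi>_lip \<beta> v u] by (simp add: distort_def abs_le_iff)
qed

lemma inner_Uhat: "0 < n \<Longrightarrow> u \<in> X \<Longrightarrow> \<bar>inner q (Uhat n u)\<bar> \<le> norm q * B"
  unfolding Uhat_def using Cauchy_Schwarz_ineq2[of q "U (empirical G n u)"] B[of n u]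
    mult_left_mono[of "norm (U (empirical G n u))" B "norm q"] by force

lemma supq_upper: "0 < n \<Longrightarrow> u \<in> cylinder G w \<Longrightarrow> inner q (Uhat n u) \<le> supq q n w"
  unfolding supq_def
  by (rule cSUP_upper) (use inner_Uhat cyl_X in \<open>auto intro!: bdd_aboveI2[where M = "norm q * B"] simp: abs_le_iff\<close>)

lemma supq_least:
  assumes "w \<in> words G n" "\<And>u. u \<in> cylinder G w \<Longrightarrow> inner q (Uhat n u) \<le> x"
  shows "supq q n w \<le> x"
  unfolding supq_def by (rule cSUP_least[OF cylinder_ne[OF assms(1)] assms(2)])

lemma supq_bounds:
  assumes "0 < n" "w \<in> words G n" shows "\<bar>supq q n w\<bar> \<le> norm q * B"
proof -
  obtain u where u: "u \<in> cylinder G w" using cylinder_ne[OF assms(2)] by auto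
  have "supq q n w \<le> norm q * B"
    by (rule supq_least[OF assms(2)]) (use inner_Uhat[OF assms(1) cyl_X] in \<open>auto simp: abs_le_iff\<close>)
  then show ?thesis
    using supq_upper[OF assms(1) u, of q] inner_Uhat[OF assms(1) cyl_X[OF u], of q] by (simp add: abs_le_iff)
qed

text \<open>\<open>N\<close> is independent of \<open>q\<close>, which enters only through the
  factor \<open>norm q\<close>. This allows finitely many or varying \<open>q\<close> to be compared
  at the same word.\<close>

lemma supq_osc:
  assumes "0 < e"
  shows "\<exists>N>0. \<forall>n\<ge>N. \<forall>w\<in>words G n. \<forall>u\<in>cylinder G w. \<forall>q. supq q n w \<le> inner q (Uhat n u) + norm q * e"
proof -
  obtain N where N: "0 < N" "\<And>n w u v. N \<le> n \<Longrightarrow> w \<in> words G n \<Longrightarrow> u \<in> cylinder G w \<Longrightarrow> v \<in> cylinder G w \<Longrightarrow>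
      dist (U (empirical G n u)) (U (empirical G n v)) < e" using osc[OF assms] by blast
  have "supq q n w \<le> inner q (Uhat n u) + norm q * e"
    if n: "N \<le> n" and w: "w \<in> words G n" and u: "u \<in> cylinder G w" for n w u q
  proof (rule supq_least[OF w])
    fix v assume v: "v \<in> cylinder G w"
    have "norm (Uhat n v - Uhat n u) \<le> e" using N(2)[OF n w v u] by (simp add: Uhat_def dist_norm)
    then have "norm q * norm (Uhat n v - Uhat n u) \<le> norm q * e" by (intro mult_left_mono) auto
    then have "inner q (Uhat n v - Uhat n u) \<le> norm q * e"
      using norm_cauchy_schwarz[of q "Uhat n v - Uhat n u"] by linarith
    then show "inner q (Uhat n v) \<le> inner q (Uhat n u) + norm q * e" by (simp add: inner_diff_right)
  qed
  then show ?thesis using N(1) by blast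
qed

section \<open>The coarse zeta-function and convexity of its abscissa\<close>

lemma Z_nonneg: "0 \<le> Z q s n"
  by (simp add: Z_def sum_nonneg)

lemma Z_antimono: "s \<le> s' \<Longrightarrow> Z q s' n \<le> Z q s n"
  unfolding Z_def using supb_nonpos by (intro sum_mono) (auto intro!: mult_right_mono_neg)

lemma coarse_term_of_real: "coarse_term G U \<phi> q (of_real s) n = of_real (Z q s n)"
  unfolding coarse_term_def Z_def supq_def supb_def Uhat_def of_real_sum
  by (intro sum.cong) (simp_all flip: of_real_add of_real_mult exp_of_real)

lemma norm_coarse_term: "norm (coarse_term G U \<phi> q s n) \<le> Z q (Re s) n"
  unfolding coarse_term_def Z_def supq_def supb_def Uhat_def
  by (rule order_trans[OF norm_sum]) (auto intro!: sum_mono simp: norm_exp_eq_Re)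

text \<open>The moduli of the terms at complex \<open>s\<close> are dominated by the terms at
  \<open>Re s\<close>. The single term of length 0, where the empirical measure has no meaning, does
  not affect summability of \<open>Z\<close>.\<close>

lemma summable_coarse_iff:
  "(\<forall>s. t < Re s \<longrightarrow> summable (\<lambda>n. coarse_term G U \<phi> q s (Suc n))) \<longleftrightarrow> (\<forall>s>t. summable (Z q s))"
proof (intro iffI allI impI)
  fix s assume a: "\<forall>s. t < Re s \<longrightarrow> summable (\<lambda>n. coarse_term G U \<phi> q s (Suc n))" and s: "t < s"
  have "summable (\<lambda>n. complex_of_real (Z q s (Suc n)))"
    using a[rule_format, of "of_real s"] s by (simp add: coarse_term_of_real)
  then show "summable (Z q s)" by (simp add: summable_complex_of_real summable_Suc_iff)
next
  fix s assume a: "\<forall>s>t. summable (Z q s)" and s: "t < Re s"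
  have "summable (\<lambda>n. Z q (Re s) (Suc n))" using a s by (simp add: summable_Suc_iff)
  then show "summable (\<lambda>n. coarse_term G U \<phi> q s (Suc n))"
    by (rule summable_comparison_test[rotated]) (use norm_coarse_term in auto)
qed

lemma Z_summable_large: "\<exists>s0. \<forall>s\<ge>s0. summable (Z q s)"
proof -
  define K where "K = real (card (arcs G)) + 1"
  \<comment> \<open>Chosen so that a word of length \<open>n\<close> weighs at most
    \<open>exp (- (n * ln (2 * K)))\<close>, while there are at most \<open>K ^ n\<close>
    words.\<close>
  define s0 where "s0 = norm q * B + ln (2 * K) / c"
  have K: "1 \<le> K" by (simp add: K_def)
  have "summable (Z q s0)"
  proof (rule summable_comparison_test)
    show "summable (\<lambda>n. (1 / 2 :: real) ^ n)" by (simp add: summable_geometric)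
    have "Z q s0 n \<le> (1 / 2) ^ n" if n: "0 < n" for n
    proof -
      have "Z q s0 n \<le> (\<Sum>w\<in>words G n. exp (- (real n * ln (2 * K))))"
        unfolding Z_def
      proof (rule sum_mono)
        fix w assume w: "w \<in> words G n"
        have "ln (2 * K) / c \<le> supq q n w + s0"
          using supq_bounds[OF n w, of q] by (simp add: s0_def abs_le_iff)
        then have "(supq q n w + s0) * supb n w \<le> (ln (2 * K) / c) * supb n w"
          using supb_nonpos[OF w] by (intro mult_right_mono_neg)
        also have "\<dots> \<le> (ln (2 * K) / c) * (- (real n * c))"
          using supb_bounds(2)[OF w] K c by (intro mult_left_mono) auto
        also have "\<dots> = - (real n * ln (2 * K))" using c by simp
        finally show "exp ((supq q n w + s0) * supb n w) \<le> exp (- (real n * ln (2 * K)))" by simp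
      qed
      also have "\<dots> = real (card (words G n)) * (1 / (2 * K)) ^ n"
        using K by (simp add: exp_minus exp_of_nat_mult power_one_over inverse_eq_divide)
      also have "\<dots> \<le> K ^ n * (1 / (2 * K)) ^ n"
      proof (rule mult_right_mono)
        have "real (card (words G n)) \<le> real (card (arcs G) ^ n)" using card_words[of n] by (simp only: of_nat_le_iff)
        also have "\<dots> \<le> K ^ n" unfolding of_nat_power by (rule power_mono) (simp_all add: K_def)
        finally show "real (card (words G n)) \<le> K ^ n" .
      qed (use K in simp)
      also have "\<dots> = (1 / 2) ^ n" using K by (simp flip: power_mult_distrib)
      finally show ?thesis .
    qed
    then show "\<exists>N. \<forall>n\<ge>N. norm (Z q s0 n) \<le> (1 / 2) ^ n" using Z_nonneg by (intro exI[of _ 1]) auto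
  qed
  moreover have "summable (Z q s)" if "summable (Z q s0)" "s0 \<le> s" for s
    by (rule summable_comparison_test[OF _ that(1)]) (use Z_antimono[OF that(2)] Z_nonneg in auto)
  ultimately show ?thesis by blast
qed

lemma Z_not_summable_small: "s \<le> - (norm q * B) \<Longrightarrow> \<not> summable (Z q s)"
proof
  assume s: "s \<le> - (norm q * B)" and "summable (Z q s)"
  then have "Z q s \<longlonglongrightarrow> 0" by (intro summable_LIMSEQ_zero)
  then have "eventually (\<lambda>n. Z q s n < 1 \<and> 0 < n) sequentially"
    by (intro eventually_conj order_tendstoD eventually_gt_at_top) auto
  then obtain n where n: "Z q s n < 1" "0 < n" using eventually_happens'[OF sequentially_bot] by blast
  obtain w where w: "w \<in> words G n" using words_ne by auto
  have "supq q n w + s \<le> 0" using supq_bounds[OF n(2) w, of q] s by (simp add: abs_le_iff)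
  then have "0 \<le> (supq q n w + s) * supb n w" using supb_nonpos[OF w] by (rule mult_nonpos_nonpos)
  then have "1 \<le> exp ((supq q n w + s) * supb n w)" by simp
  also have "\<dots> \<le> Z q s n" unfolding Z_def by (rule member_le_sum[OF w]) (auto simp: finite_words)
  finally show False using n by simp
qed

text \<open>\<open>tau\<close> is extracted by \<open>real_of_ereal\<close>, so the abscissa must
  first be shown to be finite. The two growth bounds on \<open>Z\<close> enclose it; monotonicity in
  \<open>s\<close> then gives convergence above and divergence below.\<close>

lemma abscissa:
  shows "coarse_abscissa G U \<phi> q = ereal (\<tau> q)"
    and "\<tau> q < s \<Longrightarrow> summable (Z q s)"
    and "s < \<tau> q \<Longrightarrow> \<not> summable (Z q s)"
    and "(\<And>s. t < s \<Longrightarrow> summable (Z q s)) \<Longrightarrow> \<tau> q \<le> t"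
proof -
  define S where "S = {t. \<forall>s>t. summable (Z q s)}"
  obtain s0 where s0: "\<forall>s\<ge>s0. summable (Z q s)" using Z_summable_large by blast
  have ne: "S \<noteq> {}" using s0 by (auto simp: S_def intro!: exI[of _ s0])
  have lb: "- (norm q * B) \<le> t" if "t \<in> S" for t
    using that Z_not_summable_small[of "- (norm q * B)" q] by (force simp: S_def not_le)
  have bdd: "bdd_below S" using lb by (rule bdd_belowI)
  have "coarse_abscissa G U \<phi> q = Inf (ereal ` S)"
    by (simp add: coarse_abscissa_def summable_coarse_iff S_def)
  also have "\<dots> = ereal (Inf S)"
  proof (rule Inf_eqI)
    show "ereal (Inf S) \<le> i" if "i \<in> ereal ` S" for i using that cInf_lower[OF _ bdd] by auto
    fix y assume y: "\<And>i. i \<in> ereal ` S \<Longrightarrow> y \<le> i"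
    show "y \<le> ereal (Inf S)"
    proof (cases y)
      case (real x)
      then have "x \<le> a" if "a \<in> S" for a using y[of "ereal a"] that by auto
      then have "x \<le> Inf S" by (rule cInf_greatest[OF ne])
      then show ?thesis using real by simp
    next
      case PInf
      obtain a where "a \<in> S" using ne by auto
      then show ?thesis using y[of "ereal a"] PInf by auto
    qed simp
  qed
  finally have 1: "coarse_abscissa G U \<phi> q = ereal (Inf S)" .
  then have \<tau>: "\<tau> q = Inf S" by (simp add: tau_def)
  show "coarse_abscissa G U \<phi> q = ereal (\<tau> q)" using 1 \<tau> by simp
  show "summable (Z q s)" if "\<tau> q < s"
  proof -
    have "Inf S < s" using that \<tau> by simp
    then obtain t where "t \<in> S" "t < s" using cInf_lessD[OF ne] by blast
    then show ?thesis by (simp add: S_def)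
  qed
  show *: "\<tau> q \<le> t" if "\<And>s. t < s \<Longrightarrow> summable (Z q s)" for t
    unfolding \<tau> using that by (intro cInf_lower[OF _ bdd]) (simp add: S_def)
  show "\<not> summable (Z q s)" if "s < \<tau> q"
  proof
    assume sm: "summable (Z q s)"
    have "summable (Z q s')" if "s < s'" for s'
      by (rule summable_comparison_test[OF _ sm]) (use Z_antimono[of s s'] that Z_nonneg in auto)
    then have "\<tau> q \<le> s" by (rule *)
    then show False using that by simp
  qed
qed

text \<open>The Birkhoff sum in the exponent is negative, so a lower bound for
  \<open>supq q n w\<close> is needed, while suprema are convex in \<open>q\<close> and bound it
  from the other side. Small oscillation on cylinders repairs this: all three suprema are compared
  with the value at one point, and the loss is absorbed into \<open>s\<close>.\<close>

lemma convex_tau: "convex_on UNIV \<tau>"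
proof (rule convex_onI)
  fix l :: real and q0 q1 :: 'x
  assume l: "0 < l" "l < 1"
  define q where "q = (1 - l) *\<^sub>R q0 + l *\<^sub>R q1"
  have "\<tau> q \<le> (1 - l) * \<tau> q0 + l * \<tau> q1 + \<epsilon>" if \<epsilon>: "0 < \<epsilon>" for \<epsilon>
  proof (rule abscissa(4))
    fix s assume s: "(1 - l) * \<tau> q0 + l * \<tau> q1 + \<epsilon> < s"
    define s0 where "s0 = \<tau> q0 + \<epsilon> / 2"
    define s1 where "s1 = \<tau> q1 + \<epsilon> / 2"
    have ss: "(1 - l) * s0 + l * s1 + \<epsilon> / 2 \<le> s" 
    proof -
      have "(1 - l) * s0 + l * s1 = (1 - l) * \<tau> q0 + l * \<tau> q1 + \<epsilon> / 2" by (simp add: s0_def s1_def field_simps)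
      then show ?thesis using s by simp
    qed
    have sm: "summable (\<lambda>n. (1 - l) * Z q0 s0 n + l * Z q1 s1 n)"
      using \<epsilon> by (intro summable_add summable_mult abscissa(2)) (auto simp: s0_def s1_def)
    define k where "k = norm q0 + norm q1 + 1"
    have k: "0 < k" by (simp add: k_def add_nonneg_pos)
    \<comment> \<open>The oscillation terms of \<open>q0\<close> and \<open>q1\<close> together then
      cost at most \<open>\<epsilon> / 2\<close>; the other half places \<open>s0\<close> and
      \<open>s1\<close> above the two abscissas.\<close>
    define e where "e = \<epsilon> / (2 * k)"
    have e0: "0 < e" using \<epsilon> k by (simp add: e_def)
    have e1: "(norm q0 + norm q1) * e \<le> \<epsilon> / 2"
    proof -
      have "(norm q0 + norm q1) * e \<le> k * e" unfolding k_def using e0 by (intro mult_right_mono) auto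
      also have "\<dots> = \<epsilon> / 2" using k by (simp add: e_def)
      finally show ?thesis .
    qed
    obtain N where N: "0 < N" "\<forall>n\<ge>N. \<forall>w\<in>words G n. \<forall>u\<in>cylinder G w. \<forall>q. supq q n w \<le> inner q (Uhat n u) + norm q * e"
      using supq_osc[OF e0] by blast
    have "Z q s n \<le> (1 - l) * Z q0 s0 n + l * Z q1 s1 n" if n: "N \<le> n" for n
      unfolding Z_def sum_distrib_left sum.distrib[symmetric]
    proof (rule sum_mono)
      fix w assume w: "w \<in> words G n"
      have n0: "0 < n" using n N(1) by linarith
      obtain u where u: "u \<in> cylinder G w" using cylinder_ne[OF w] by auto
      define x0 where "x0 = (supq q0 n w + s0) * supb n w"
      define x1 where "x1 = (supq q1 n w + s1) * supb n w"
      have "(1 - l) * supq q0 n w \<le> (1 - l) * inner q0 (Uhat n u) + norm q0 * e"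
      proof -
        have "(1 - l) * supq q0 n w \<le> (1 - l) * (inner q0 (Uhat n u) + norm q0 * e)"
          using N(2) n w u l by (intro mult_left_mono) auto
        moreover have "(1 - l) * (norm q0 * e) \<le> 1 * (norm q0 * e)" using l e0 by (intro mult_right_mono) auto
        ultimately show ?thesis by (simp add: distrib_left)
      qed
      moreover have "l * supq q1 n w \<le> l * inner q1 (Uhat n u) + norm q1 * e"
      proof -
        have "l * supq q1 n w \<le> l * (inner q1 (Uhat n u) + norm q1 * e)"
          using N(2) n w u l by (intro mult_left_mono) auto
        moreover have "l * (norm q1 * e) \<le> 1 * (norm q1 * e)" using l e0 by (intro mult_right_mono) auto
        ultimately show ?thesis by (simp add: distrib_left)
      qed
      moreover have "inner q (Uhat n u) = (1 - l) * inner q0 (Uhat n u) + l * inner q1 (Uhat n u)"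
        by (simp add: q_def inner_add_left)
      ultimately have "(1 - l) * supq q0 n w + l * supq q1 n w \<le> inner q (Uhat n u) + \<epsilon> / 2"
        using e1 by (simp add: distrib_right)
      also have "\<dots> \<le> supq q n w + \<epsilon> / 2" using supq_upper[OF n0 u, of q] by simp
      finally have "(1 - l) * (supq q0 n w + s0) + l * (supq q1 n w + s1) \<le> supq q n w + s"
        using ss by (simp add: distrib_left)
      then have "(supq q n w + s) * supb n w \<le> ((1 - l) * (supq q0 n w + s0) + l * (supq q1 n w + s1)) * supb n w"
        using supb_nonpos[OF w] by (rule mult_right_mono_neg)
      also have "\<dots> = (1 - l) * x0 + l * x1" by (simp add: x0_def x1_def algebra_simps)
      finally have "exp ((supq q n w + s) * supb n w) \<le> exp ((1 - l) * x0 + l * x1)" by simp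
      also have "\<dots> \<le> (1 - l) * exp x0 + l * exp x1"
        using convex_onD[OF exp_convex, of l x0 x1] l by simp
      finally show "exp ((supq q n w + s) * supb n w)
        \<le> (1 - l) * exp ((supq q0 n w + s0) * supb n w) + l * exp ((supq q1 n w + s1) * supb n w)"
        by (simp add: x0_def x1_def)
    qed
    then show "summable (Z q s)"
      by (intro summable_comparison_test[OF _ sm] exI[of _ N]) (use Z_nonneg in auto)
  qed
  then show "\<tau> ((1 - l) *\<^sub>R q0 + l *\<^sub>R q1) \<le> (1 - l) * \<tau> q0 + l * \<tau> q1"
    unfolding q_def by (rule field_le_epsilon)
qed simp

section \<open>The fine zeta-function and the equation that determines its exponent\<close>

definition good :: "'x \<Rightarrow> real \<Rightarrow> nat \<Rightarrow> 'e list set" where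
  "good \<alpha> r n = {w\<in>words G n. (\<lambda>u. U (empirical G n u)) ` cylinder G w \<subseteq> ball \<alpha> r}"

definition supe :: "real \<Rightarrow> nat \<Rightarrow> 'e list \<Rightarrow> real" where
  "supe t n w = (SUP u\<in>cylinder G w. exp (birkhoff (\<lambda>u. t * \<phi> u) n u))"

definition Y :: "'x \<Rightarrow> real \<Rightarrow> real \<Rightarrow> nat \<Rightarrow> real" where
  "Y \<alpha> r t n = (\<Sum>w\<in>good \<alpha> r n. supe t n w)"

definition radius :: "'x \<Rightarrow> real \<Rightarrow> real \<Rightarrow> ereal" where
  "radius \<alpha> r t = fine_radius G U (ball \<alpha> r) (\<lambda>u. t * \<phi> u)"

lemma fine_coeff_eq: "fine_coeff G U (ball \<alpha> r) (\<lambda>u. t * \<phi> u) n = (if n = 0 then 0 else complex_of_real (Y \<alpha> r t n / real n))"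
  by (simp add: fine_coeff_def Y_def good_def supe_def)

lemma good_words: "w \<in> good \<alpha> r n \<Longrightarrow> w \<in> words G n"
  using finite_words[of n] by (auto simp: good_def)

lemma birkhoff_mult: "birkhoff (\<lambda>u. t * \<phi> u) n u = t * birkhoff \<phi> n u"
  by (simp add: birkhoff_def sum_distrib_left)

lemma abs_t_birkhoff: "u \<in> X \<Longrightarrow> \<bar>t * birkhoff \<phi> n u\<bar> \<le> real n * (\<bar>t\<bar> * F)"
  using mult_left_mono[OF abs_birkhoff_le[of \<phi> F u n, OF F], of "\<bar>t\<bar>"] by (simp add: abs_mult mult_ac)

lemma supe_upper: "u \<in> cylinder G w \<Longrightarrow> exp (t * birkhoff \<phi> n u) \<le> supe t n w"
  unfolding supe_def birkhoff_mult
  by (rule cSUP_upper)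
     (use abs_t_birkhoff cyl_X in \<open>auto intro!: bdd_aboveI2[where M = "exp (real n * (\<bar>t\<bar> * F))"] simp: abs_le_iff\<close>)

lemma supe_least:
  assumes "w \<in> words G n" "\<And>u. u \<in> cylinder G w \<Longrightarrow> exp (t * birkhoff \<phi> n u) \<le> x"
  shows "supe t n w \<le> x"
  unfolding supe_def birkhoff_mult by (rule cSUP_least[OF cylinder_ne[OF assms(1)] assms(2)])

lemma supe_nonneg: "w \<in> words G n \<Longrightarrow> 0 \<le> supe t n w"
proof -
  assume w: "w \<in> words G n"
  obtain u where u: "u \<in> cylinder G w" using cylinder_ne[OF w] by auto
  show ?thesis using order_trans[OF _ supe_upper[OF u]] by (metis exp_ge_zero)
qed

lemma Y_nonneg: "0 \<le> Y \<alpha> r t n"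
  unfolding Y_def by (intro sum_nonneg supe_nonneg good_words)

lemma supe_change:
  assumes h: "0 \<le> h" and w: "w \<in> words G n"
  shows "supe (t + h) n w \<le> exp (- (h * c)) ^ n * supe t n w"
    and "supe t n w \<le> exp (h * F) ^ n * supe (t + h) n w"
proof -
  show "supe (t + h) n w \<le> exp (- (h * c)) ^ n * supe t n w"
  proof (rule supe_least[OF w])
    fix u assume u: "u \<in> cylinder G w"
    have "h * birkhoff \<phi> n u \<le> h * (- (real n * c))" using birkhoff_bounds(2)[OF cyl_X[OF u]] h by (rule mult_left_mono)
    then have "exp ((t + h) * birkhoff \<phi> n u) \<le> exp (real n * - (h * c)) * exp (t * birkhoff \<phi> n u)"
      by (simp add: algebra_simps flip: exp_add)
    also have "\<dots> \<le> exp (real n * - (h * c)) * supe t n w" by (intro mult_left_mono supe_upper u) auto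
    finally show "exp ((t + h) * birkhoff \<phi> n u) \<le> exp (- (h * c)) ^ n * supe t n w"
      by (simp only: exp_of_nat_mult)
  qed
  show "supe t n w \<le> exp (h * F) ^ n * supe (t + h) n w"
  proof (rule supe_least[OF w])
    fix u assume u: "u \<in> cylinder G w"
    have "h * (- (real n * F)) \<le> h * birkhoff \<phi> n u" using birkhoff_bounds(1)[OF cyl_X[OF u]] h by (rule mult_left_mono)
    then have "exp (t * birkhoff \<phi> n u) \<le> exp (real n * (h * F)) * exp ((t + h) * birkhoff \<phi> n u)"
      by (simp add: algebra_simps flip: exp_add)
    also have "\<dots> \<le> exp (real n * (h * F)) * supe (t + h) n w" by (intro mult_left_mono supe_upper u) auto
    finally show "exp (t * birkhoff \<phi> n u) \<le> exp (h * F) ^ n * supe (t + h) n w"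
      by (simp only: exp_of_nat_mult)
  qed
qed

lemma Y_change:
  assumes h: "0 \<le> h"
  shows "Y \<alpha> r (t + h) n \<le> exp (- (h * c)) ^ n * Y \<alpha> r t n"
    and "Y \<alpha> r t n \<le> exp (h * F) ^ n * Y \<alpha> r (t + h) n"
  unfolding Y_def sum_distrib_left by (intro sum_mono supe_change[OF h] good_words; assumption)+

text \<open>Raising \<open>t\<close> by \<open>h\<close> multiplies the coefficient of order
  \<open>n\<close> by a factor between \<open>exp (- (h * F)) ^ n\<close> and
  \<open>exp (- (h * c)) ^ n\<close>, and geometric factors merely rescale the radius of
  convergence.\<close>

lemma radius_change:
  assumes h: "0 \<le> h"
  shows "ereal (exp (h * c)) * radius \<alpha> r t \<le> radius \<alpha> r (t + h)"
    and "radius \<alpha> r (t + h) \<le> ereal (exp (h * F)) * radius \<alpha> r t"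
proof -
  have div: "R / ereal (norm (complex_of_real (exp (- x)))) = ereal (exp x) * R" for R :: ereal and x
  proof -
    have n: "norm (complex_of_real (exp (- x))) = exp (- x)" by (simp only: norm_of_real abs_exp_cancel)
    show ?thesis unfolding n by (simp add: divide_ereal_def exp_minus mult.commute)
  qed
  define f where "f t = fine_coeff G U (ball \<alpha> r) (\<lambda>u. t * \<phi> u)" for t
  have R: "radius \<alpha> r t = conv_radius (f t)" for t by (simp add: radius_def fine_radius_def f_def)
  have nf: "norm (f t n) = (if n = 0 then 0 else Y \<alpha> r t n / real n)" for t n
    using Y_nonneg[of \<alpha> r t n] by (simp add: f_def fine_coeff_eq norm_divide del: of_real_divide)
  have "ereal (exp (h * c)) * radius \<alpha> r t = conv_radius (\<lambda>n. of_real (exp (- (h * c))) ^ n * f t n)"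
    unfolding R by (subst conv_radius_mult_power) (simp_all only: div, simp)
  also have "\<dots> \<le> radius \<alpha> r (t + h)"
    unfolding R
  proof (rule conv_radius_antimono)
    fix n show "norm (f (t + h) n) \<le> norm (of_real (exp (- (h * c))) ^ n * f t n)"
      unfolding norm_mult norm_power nf using Y_change(1)[OF h, of \<alpha> r t n]
      by (simp add: divide_right_mono)
  qed
  finally show "ereal (exp (h * c)) * radius \<alpha> r t \<le> radius \<alpha> r (t + h)" .
  have "radius \<alpha> r (t + h) = ereal (exp (h * F)) * conv_radius (\<lambda>n. of_real (exp (h * F)) ^ n * f (t + h) n)"
  proof -
    have "R = ereal E * (R / ereal E)" if "0 < E" for R :: ereal and E
      using that by (cases R) auto
    from this[of "exp (h * F)" "conv_radius (f (t + h))"] show ?thesis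
      unfolding R by (subst conv_radius_mult_power) (simp_all only: norm_of_real abs_exp_cancel exp_gt_zero exp_not_eq_zero of_real_eq_0_iff not_False_eq_True)
  qed
  also have "\<dots> \<le> ereal (exp (h * F)) * radius \<alpha> r t"
    unfolding R
  proof (intro ereal_mult_left_mono conv_radius_antimono)
    fix n show "norm (f t n) \<le> norm (of_real (exp (h * F)) ^ n * f (t + h) n)"
      unfolding norm_mult norm_power nf using Y_change(2)[OF h, of \<alpha> r t n]
      by (simp add: divide_right_mono)
  qed simp
  finally show "radius \<alpha> r (t + h) \<le> ereal (exp (h * F)) * radius \<alpha> r t" .
qed

text \<open>The lower bound is uniform in \<open>r\<close>, so it survives the upper limit and
  excludes the value 0, at which the logarithm in \<open>L_unique\<close> would lose its
  meaning.\<close>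

lemma radius_pos: "\<exists>x>0. \<forall>r. ereal x \<le> radius \<alpha> r t"
proof -
  define K where "K = (real (card (arcs G)) + 1) * exp (\<bar>t\<bar> * F)"
  have K: "0 < K" by (simp add: K_def add_nonneg_pos)
  have nn: "norm (complex_of_real (1 / (2 * K))) = 1 / (2 * K)"
    unfolding norm_of_real using K by simp
  have "ereal (1 / (2 * K)) \<le> radius \<alpha> r t" for r
  proof -
    have "summable (\<lambda>n. fine_coeff G U (ball \<alpha> r) (\<lambda>u. t * \<phi> u) n * of_real (1 / (2 * K)) ^ n)"
    proof (rule summable_comparison_test)
      show "summable (\<lambda>n. (1 / 2 :: real) ^ n)" by (simp add: summable_geometric)
      have "norm (fine_coeff G U (ball \<alpha> r) (\<lambda>u. t * \<phi> u) n * of_real (1 / (2 * K)) ^ n) \<le> (1 / 2) ^ n" for n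
      proof (cases "n = 0")
        case False
        have "Y \<alpha> r t n \<le> (\<Sum>w\<in>good \<alpha> r n. exp (real n * (\<bar>t\<bar> * F)))"
          unfolding Y_def
        proof (rule sum_mono)
          fix w assume "w \<in> good \<alpha> r n"
          then show "supe t n w \<le> exp (real n * (\<bar>t\<bar> * F))"
            by (intro supe_least good_words) (use abs_t_birkhoff cyl_X in \<open>auto simp: abs_le_iff\<close>)
        qed
        also have "\<dots> \<le> real (card (words G n)) * exp (real n * (\<bar>t\<bar> * F))"
          using card_mono[OF finite_words, of "good \<alpha> r n" n] good_words by (auto intro!: mult_right_mono)
        also have "\<dots> \<le> (real (card (arcs G)) + 1) ^ n * exp (real n * (\<bar>t\<bar> * F))"
        proof (rule mult_right_mono)
          have "real (card (words G n)) \<le> real (card (arcs G) ^ n)" using card_words[of n] by (simp only: of_nat_le_iff)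
          also have "\<dots> \<le> (real (card (arcs G)) + 1) ^ n" unfolding of_nat_power by (rule power_mono) simp_all
          finally show "real (card (words G n)) \<le> (real (card (arcs G)) + 1) ^ n" .
        qed simp
        also have "\<dots> = K ^ n" by (simp only: K_def power_mult_distrib exp_of_nat_mult)
        finally have YK: "Y \<alpha> r t n \<le> K ^ n" .
        have "norm (fine_coeff G U (ball \<alpha> r) (\<lambda>u. t * \<phi> u) n) \<le> Y \<alpha> r t n"
          using False Y_nonneg[of \<alpha> r t n] by (simp add: fine_coeff_eq norm_divide divide_le_eq mult_le_cancel_left1 del: of_real_divide)
        then have "norm (fine_coeff G U (ball \<alpha> r) (\<lambda>u. t * \<phi> u) n * of_real (1 / (2 * K)) ^ n) \<le> K ^ n * (1 / (2 * K)) ^ n"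
          unfolding norm_mult norm_power nn using YK K by (intro mult_mono) auto
        also have "\<dots> = (1 / 2) ^ n" using K by (simp flip: power_mult_distrib)
        finally show ?thesis .
      qed (simp add: fine_coeff_eq)
      then show "\<exists>N. \<forall>n\<ge>N. norm (fine_coeff G U (ball \<alpha> r) (\<lambda>u. t * \<phi> u) n * of_real (1 / (2 * K)) ^ n) \<le> (1 / 2) ^ n" by blast
    qed
    then have "ereal (norm (complex_of_real (1 / (2 * K)))) \<le> radius \<alpha> r t"
      unfolding radius_def fine_radius_def by (rule conv_radius_geI)
    then show ?thesis unfolding nn .
  qed
  moreover have "0 < 1 / (2 * K)" using K by simp
  ultimately show ?thesis by blast
qed

abbreviation L where "L \<equiv> fine_limsup G U \<phi>"

lemma L_eq: "L \<alpha> t = Limsup (at_right 0) (\<lambda>r. radius \<alpha> r t)"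
  by (simp add: fine_limsup_def radius_def)

lemma L_change:
  assumes h: "0 \<le> h"
  shows "ereal (exp (h * c)) * L \<alpha> t \<le> L \<alpha> (t + h)" and "L \<alpha> (t + h) \<le> ereal (exp (h * F)) * L \<alpha> t"
  unfolding L_eq
  by (subst Limsup_ereal_mult_left[symmetric]; auto intro!: Limsup_mono always_eventually radius_change[OF h])+

lemma L_pos: "0 < L \<alpha> t"
proof -
  obtain x where x: "0 < x" "\<And>r. ereal x \<le> radius \<alpha> r t" using radius_pos by blast
  have "ereal x \<le> L \<alpha> t" unfolding L_eq by (intro le_Limsup always_eventually allI x) simp
  then show ?thesis using x(1) by (metis ereal_less(2) less_le_trans)
qed

lemma L_gt_1: "L \<alpha> f = 1 \<Longrightarrow> f < t \<Longrightarrow> 1 < L \<alpha> t"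
proof -
  assume f: "L \<alpha> f = 1" "f < t"
  have "ereal 1 < ereal (exp ((t - f) * c))" using f(2) c by simp
  also have "\<dots> \<le> L \<alpha> (f + (t - f))" using L_change(1)[of "t - f" \<alpha> f] f by simp
  finally show ?thesis by (simp add: one_ereal_def)
qed

text \<open>One finite value makes all values finite by \<open>L_change\<close>. The logarithm of
  \<open>L \<alpha> t\<close> then has difference quotients in \<open>t\<close> between
  \<open>c > 0\<close> and \<open>F\<close>, so it is continuous, takes both signs and vanishes
  exactly once.\<close>

lemma L_unique:
  assumes "\<exists>t. L \<alpha> t \<noteq> \<infinity>" shows "\<exists>!t. L \<alpha> t = 1"
proof -
  obtain t0 where t0: "L \<alpha> t0 \<noteq> \<infinity>" using assms by blast
  have fin: "L \<alpha> t \<noteq> \<infinity>" for t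
  proof (cases "t0 \<le> t")
    case True
    have "L \<alpha> t \<le> ereal (exp ((t - t0) * F)) * L \<alpha> t0" using L_change(2)[of "t - t0" \<alpha> t0] True by simp
    also have "\<dots> < \<infinity>" using t0 L_pos[of \<alpha> t0] by (cases "L \<alpha> t0") auto
    finally show ?thesis by auto
  next
    case False
    have "ereal (exp ((t0 - t) * c)) * L \<alpha> t \<le> L \<alpha> t0" using L_change(1)[of "t0 - t" \<alpha> t] False by simp
    then show ?thesis using t0 by auto
  qed
  define g where "g t = ln (real_of_ereal (L \<alpha> t))" for t
  have Lg: "L \<alpha> t = ereal (exp (g t))" for t
    using fin[of t] L_pos[of \<alpha> t] unfolding g_def by (cases "L \<alpha> t") auto
  have g: "h * c \<le> g (t + h) - g t" "g (t + h) - g t \<le> h * F" if "0 \<le> h" for t h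
    using L_change[OF that, of \<alpha> t] unfolding Lg by (auto simp flip: exp_add)
  have L1: "L \<alpha> t = 1 \<longleftrightarrow> g t = 0" for t unfolding Lg by (simp add: one_ereal_def)
  have lips: "\<bar>g x - g y\<bar> \<le> F * \<bar>x - y\<bar>" for x y
  proof (cases "y \<le> x")
    case True
    then have "0 \<le> (x - y) * c" using c by simp
    then have "\<bar>g x - g y\<bar> \<le> (x - y) * F" using g[of "x - y" y] True by simp
    then show ?thesis using True by (simp add: mult.commute)
  next
    case False
    then have "0 \<le> (y - x) * c" using c by simp
    then have "\<bar>g x - g y\<bar> \<le> (y - x) * F" using g[of "y - x" x] False by simp
    then show ?thesis using False by (simp add: mult.commute)
  qed
  have "F-lipschitz_on UNIV g" unfolding lipschitz_on_def using lips F0 by (simp add: dist_real_def)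
  then have cont: "continuous_on UNIV g" by (rule lipschitz_on_continuous_on)
  define d where "d = \<bar>g t0\<bar> / c"
  have d: "0 \<le> d" "d * c = \<bar>g t0\<bar>" using c by (auto simp: d_def)
  have "0 \<le> g (t0 + d)" using g(1)[OF d(1), of t0] d(2) by linarith
  moreover have "g (t0 - d) \<le> 0" using g(1)[OF d(1), of "t0 - d"] d(2) by simp
  ultimately obtain t where "g t = 0"
    using IVT'[of g "t0 - d" 0 "t0 + d"] d(1) continuous_on_subset[OF cont subset_UNIV] by auto
  moreover have "x = y" if "g x = 0" "g y = 0" for x y
  proof (rule ccontr)
    assume "x \<noteq> y"
    then consider "x < y" | "y < x" by linarith
    then show False
    proof cases
      case 1
      then have "0 < (y - x) * c" using c by simp
      then show False using g(1)[of "y - x" x] 1 that by simp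
    next
      case 2
      then have "0 < (x - y) * c" using c by simp
      then show False using g(1)[of "x - y" y] 2 that by simp
    qed
  qed
  ultimately show ?thesis unfolding L1 by blast
qed

section \<open>Comparison of the fine with the coarse series\<close>

text \<open>For negative \<open>t\<close> the supremum of the exponential is governed by the
  smallest Birkhoff sum and not by \<open>supb\<close>. Bounded distortion makes all Birkhoff sums
  on a cylinder interchangeable, so both signs are covered.\<close>

lemma supe_vs_supb:
  assumes w: "w \<in> words G n"
  shows "supe t n w \<le> exp (\<bar>t\<bar> * distort) * exp (t * supb n w)"
    and "exp (t * supb n w) \<le> exp (\<bar>t\<bar> * distort) * supe t n w"
proof -
  have d: "\<bar>t * birkhoff \<phi> n u - t * supb n w\<bar> \<le> \<bar>t\<bar> * distort" if u: "u \<in> cylinder G w" for u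
  proof -
    have "\<bar>birkhoff \<phi> n u - supb n w\<bar> \<le> distort" using supb_upper[OF u, of n] supb_distort[OF w u] by linarith
    then show ?thesis unfolding right_diff_distrib[symmetric] abs_mult by (rule mult_left_mono) simp
  qed
  show "supe t n w \<le> exp (\<bar>t\<bar> * distort) * exp (t * supb n w)"
    by (rule supe_least[OF w]) (use d in \<open>force simp: abs_le_iff simp flip: exp_add\<close>)
  obtain u where u: "u \<in> cylinder G w" using cylinder_ne[OF w] by auto
  have "exp (t * supb n w) \<le> exp (\<bar>t\<bar> * distort) * exp (t * birkhoff \<phi> n u)"
    using d[OF u] by (simp add: abs_le_iff flip: exp_add)
  also have "\<dots> \<le> exp (\<bar>t\<bar> * distort) * supe t n w" by (intro mult_left_mono supe_upper u) simp
  finally show "exp (t * supb n w) \<le> exp (\<bar>t\<bar> * distort) * supe t n w" .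
qed

lemma good_inner:
  assumes n: "0 < n" and w: "w \<in> good \<alpha> r n" and u: "u \<in> cylinder G w"
  shows "\<bar>inner q (Uhat n u) - inner q \<alpha>\<bar> \<le> norm q * r"
proof -
  have "dist \<alpha> (Uhat n u) < r" using w u by (auto simp: good_def Uhat_def)
  then have "norm (Uhat n u - \<alpha>) \<le> r" by (simp add: dist_norm norm_minus_commute)
  then have "norm q * norm (Uhat n u - \<alpha>) \<le> norm q * r" by (rule mult_left_mono) simp
  then show ?thesis using Cauchy_Schwarz_ineq2[of q "Uhat n u - \<alpha>"] by (simp add: inner_diff_right)
qed

text \<open>On a good word \<open>supq q n w + s\<close> is at most \<open>t\<close>; since
  \<open>supb n w\<close> is not positive, the fine coefficients are dominated by a multiple of the
  convergent coarse series.\<close>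

lemma radius_ge_1:
  assumes s: "\<tau> q < s" and t: "inner q \<alpha> + norm q * r + s \<le> t"
  shows "1 \<le> radius \<alpha> r t"
proof -
  have sm: "summable (\<lambda>n. exp (\<bar>t\<bar> * distort) * Z q s n)" by (intro summable_mult abscissa(2) s)
  have "summable (\<lambda>n. fine_coeff G U (ball \<alpha> r) (\<lambda>u. t * \<phi> u) n * 1 ^ n)"
  proof (rule summable_comparison_test[OF _ sm], intro exI allI impI)
    fix n :: nat assume n: "1 \<le> n"
    have "Y \<alpha> r t n \<le> (\<Sum>w\<in>good \<alpha> r n. exp (\<bar>t\<bar> * distort) * exp ((supq q n w + s) * supb n w))"
      unfolding Y_def
    proof (rule sum_mono)
      fix w assume w: "w \<in> good \<alpha> r n"
      have "supq q n w \<le> inner q \<alpha> + norm q * r"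
      proof (rule supq_least[OF good_words[OF w]])
        fix u assume "u \<in> cylinder G w"
        then show "inner q (Uhat n u) \<le> inner q \<alpha> + norm q * r" using good_inner[OF _ w, of u q] n by linarith
      qed
      then have "t * supb n w \<le> (supq q n w + s) * supb n w"
        using supb_nonpos[OF good_words[OF w]] t by (intro mult_right_mono_neg) auto
      then show "supe t n w \<le> exp (\<bar>t\<bar> * distort) * exp ((supq q n w + s) * supb n w)"
        using order_trans[OF supe_vs_supb(1)[OF good_words[OF w], of t]] by simp
    qed
    also have "\<dots> \<le> (\<Sum>w\<in>words G n. exp (\<bar>t\<bar> * distort) * exp ((supq q n w + s) * supb n w))"
      using good_words by (intro sum_mono2 finite_words) auto
    finally have Y: "Y \<alpha> r t n \<le> exp (\<bar>t\<bar> * distort) * Z q s n" by (simp add: Z_def sum_distrib_left)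
    have "Y \<alpha> r t n / real n \<le> Y \<alpha> r t n" using n Y_nonneg[of \<alpha> r t n] by (simp add: divide_le_eq mult_le_cancel_left1)
    then show "norm (fine_coeff G U (ball \<alpha> r) (\<lambda>u. t * \<phi> u) n * 1 ^ n) \<le> exp (\<bar>t\<bar> * distort) * Z q s n"
      using n Y Y_nonneg[of \<alpha> r t n] by (simp add: fine_coeff_eq del: of_real_divide)
  qed
  then have "ereal (norm (1 :: complex)) \<le> radius \<alpha> r t" unfolding radius_def fine_radius_def by (rule conv_radius_geI)
  then show ?thesis by (simp add: one_ereal_def)
qed

text \<open>If \<open>f\<close> exceeded \<open>inner \<alpha> q + \<tau> q\<close> by
  \<open>\<delta>\<close>, then for small balls the radius would already be at least 1 at
  \<open>f - \<delta> / 2\<close>, and the strict growth of \<open>L\<close> would lift its value at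
  \<open>f\<close> above 1.\<close>

lemma le_legendre:
  assumes f: "L \<alpha> f = 1" shows "ereal f \<le> legendre \<tau> \<alpha>"
  unfolding legendre_def
proof (rule INF_greatest)
  fix q
  show "ereal f \<le> ereal (inner \<alpha> q + \<tau> q)"
  proof (rule ccontr)
    assume "\<not> ?thesis"
    then have lt: "inner q \<alpha> + \<tau> q < f" by (simp add: inner_commute)
    define \<delta> where "\<delta> = f - (inner q \<alpha> + \<tau> q)"
    have \<delta>: "0 < \<delta>" using lt by (simp add: \<delta>_def)
    have "((\<lambda>r. norm q * r) \<longlongrightarrow> norm q * 0) (at_right 0)" by (intro tendsto_intros)
    then have "eventually (\<lambda>r. norm q * r < \<delta> / 4) (at_right 0)" by (rule order_tendstoD) (use \<delta> in simp)
    then have "eventually (\<lambda>r. 1 \<le> radius \<alpha> r (f - \<delta> / 2)) (at_right 0)"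
    proof eventually_elim
      case (elim r)
      show ?case by (rule radius_ge_1[of q "\<tau> q + \<delta> / 4"]) (use elim \<delta> in \<open>auto simp: \<delta>_def field_simps\<close>)
    qed
    then have "1 \<le> L \<alpha> (f - \<delta> / 2)" unfolding L_eq by (intro le_Limsup) auto
    have "ereal 1 < ereal (exp (\<delta> / 2 * c)) * 1" using \<delta> c by simp
    also have "\<dots> \<le> ereal (exp (\<delta> / 2 * c)) * L \<alpha> (f - \<delta> / 2)"
      by (rule ereal_mult_left_mono[OF \<open>1 \<le> L \<alpha> (f - \<delta> / 2)\<close>]) simp
    also have "\<dots> \<le> L \<alpha> f" using L_change(1)[of "\<delta> / 2" \<alpha> "f - \<delta> / 2"] \<delta> by simp
    finally show False using f by (simp add: one_ereal_def)
  qed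
qed

text \<open>The factor \<open>1 / n\<close> of the fine series is harmless beyond radius 1: for
  \<open>x > 1\<close> eventually \<open>n < x ^ n\<close>, so convergence at \<open>x\<close> would
  make \<open>Y\<close> summable.\<close>

lemma radius_le_1:
  assumes "\<not> summable (Y \<alpha> r t)" shows "radius \<alpha> r t \<le> 1"
proof -
  have "conv_radius (fine_coeff G U (ball \<alpha> r) (\<lambda>u. t * \<phi> u)) \<le> 1"
  proof (rule conv_radius_leI_ex')
    fix x :: real assume x: "0 < x" "1 < ereal x"
    show "\<not> summable (\<lambda>n. fine_coeff G U (ball \<alpha> r) (\<lambda>u. t * \<phi> u) n * of_real x ^ n)"
    proof
      assume sm: "summable (\<lambda>n. fine_coeff G U (ball \<alpha> r) (\<lambda>u. t * \<phi> u) n * complex_of_real x ^ n)"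
      have e: "fine_coeff G U (ball \<alpha> r) (\<lambda>u. t * \<phi> u) n * complex_of_real x ^ n
          = complex_of_real (if n = 0 then 0 else Y \<alpha> r t n / real n * x ^ n)" for n
        by (simp add: fine_coeff_eq)
      have sm': "summable (\<lambda>n. if n = 0 then 0 else Y \<alpha> r t n / real n * x ^ n)"
        using sm unfolding e summable_complex_of_real .
      have "1 < x" using x(2) by (simp add: one_ereal_def)
      then have "(\<lambda>n. real n / x ^ n) \<longlonglongrightarrow> 0" using lim_n_over_pown[of x] by simp
      then have "eventually (\<lambda>n. real n / x ^ n < 1 \<and> 0 < n) sequentially"
        by (intro eventually_conj order_tendstoD eventually_gt_at_top) auto
      then have "eventually (\<lambda>n. norm (Y \<alpha> r t n) \<le> (if n = 0 then 0 else Y \<alpha> r t n / real n * x ^ n)) sequentially"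
      proof eventually_elim
        case (elim n)
        then have "1 \<le> x ^ n / real n" using x(1) by (simp add: field_simps)
        then have "Y \<alpha> r t n * 1 \<le> Y \<alpha> r t n * (x ^ n / real n)" by (intro mult_left_mono Y_nonneg)
        then show ?case using elim Y_nonneg[of \<alpha> r t n] by simp
      qed
      then have "summable (Y \<alpha> r t)" by (rule summable_comparison_test_ev[OF _ sm'])
      then show False using assms by simp
    qed
  qed simp
  then show ?thesis by (simp add: radius_def fine_radius_def)
qed

end

locale zeta_euclidean = zeta G \<beta> C c F B \<phi> U
  for G :: "('v, 'e) pre_digraph" and \<beta> C c F B :: real and \<phi> :: "(nat \<Rightarrow> 'e) \<Rightarrow> real"
    and U :: "(nat \<Rightarrow> 'e) measure \<Rightarrow> 'x :: euclidean_space"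
begin

text \<open>
  A word outside \<open>good \<alpha> r n\<close> deviates from \<open>\<alpha>\<close> by at least \<open>r / DIM\<close> in one of the coordinate directions \<open>v\<close>;
  tilting \<open>q\<close> by a small multiple of \<open>- v\<close> makes it summable at a parameter below \<open>\<tau> q\<close>.
\<close>

lemma bad_summable:
  assumes D: "GDERIV \<tau> q :> - \<alpha>" and r: "0 < r" and \<eta>: "0 < \<eta>"
  obtains \<delta> where "0 < \<delta>" "\<delta> \<le> \<eta>"
    "summable (\<lambda>n. \<Sum>w\<in>words G n - good \<alpha> r n. exp ((supq q n w + (\<tau> q - \<delta>)) * supb n w))"
proof -
  \<comment> \<open>The \<open>2 * DIM('x)\<close> signed coordinate directions. If all of them saw
    less than \<open>r / DIM('x)\<close>, the sum of the absolute coordinates, which bounds the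
    norm, would stay below \<open>r\<close>.\<close>
  define V where "V = Basis \<union> uminus ` (Basis :: 'x set)"
  have finV: "finite V" by (simp add: V_def)
  have V1: "norm v = 1" if "v \<in> V" for v using that by (auto simp: V_def)
  define \<rho> where "\<rho> = r / DIM('x)"
  have \<rho>: "0 < \<rho>" using r by (simp add: \<rho>_def)
  have dir: "\<exists>v\<in>V. \<rho> \<le> inner v x" if "r \<le> norm x" for x :: 'x
  proof (rule ccontr)
    assume "\<not> ?thesis"
    then have lt: "inner v x < \<rho>" if "v \<in> V" for v using that by force
    have "\<bar>inner x b\<bar> < \<rho>" if "b \<in> Basis" for b
      using lt[of b] lt[of "- b"] that by (auto simp: V_def inner_commute abs_less_iff)
    then have "(\<Sum>b\<in>Basis. \<bar>inner x b\<bar>) < (\<Sum>b\<in>(Basis :: 'x set). \<rho>)" by (intro sum_strict_mono) auto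
    also have "\<dots> = r" by (simp add: \<rho>_def)
    finally show False using norm_le_l1[of x] that by linarith
  qed
  have "(\<tau> has_derivative (\<lambda>y. inner y (- \<alpha>))) (at q)"
    using D unfolding gderiv_def .
  moreover have "0 < \<rho> / 4" using \<rho> by simp
  ultimately obtain d where d: "0 < d" "\<And>y. norm (y - q) < d \<Longrightarrow>
      norm (\<tau> y - \<tau> q - inner (y - q) (- \<alpha>)) \<le> \<rho> / 4 * norm (y - q)"
    unfolding has_derivative_at_alt by blast
  define h where "h = d / 2"
  have h: "0 < h" "h < d" using d(1) by (auto simp: h_def)
  have tilt: "\<tau> (q - h *\<^sub>R v) \<le> \<tau> q + h * inner v \<alpha> + h * \<rho> / 4" if v: "v \<in> V" for v
  proof -
    have "\<bar>\<tau> (q - h *\<^sub>R v) - \<tau> q - h * inner v \<alpha>\<bar> \<le> h * \<rho> / 4"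
      using d(2)[of "q - h *\<^sub>R v"] V1[OF v] h by (simp add: mult.commute)
    then have "\<tau> (q - h *\<^sub>R v) - \<tau> q - h * inner v \<alpha> \<le> h * \<rho> / 4" by (rule order_trans[OF abs_ge_self])
    then show ?thesis by argo
  qed
  \<comment> \<open>The deviation yields a gain of \<open>h * \<rho>\<close>. One quarter pays for
    the linearisation of \<open>\<tau>\<close>, one for staying above the abscissa at the tilted
    point, one for the oscillation on cylinders; the last quarter remains for
    \<open>\<delta>\<close>.\<close>
  define \<delta> where "\<delta> = min \<eta> (h * \<rho> / 4)"
  have \<delta>: "0 < \<delta>" "\<delta> \<le> \<eta>" "\<delta> \<le> h * \<rho> / 4" using \<eta> h \<rho> by (auto simp: \<delta>_def)
  define k where "k = norm q + h + 1"
  have k: "0 < k" using h by (simp add: k_def add_nonneg_pos)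
  define e where "e = h * \<rho> / (4 * k)"
  have e: "0 < e" "k * e = h * \<rho> / 4" using h \<rho> k by (auto simp: e_def)
  obtain N where N: "0 < N" "\<forall>n\<ge>N. \<forall>w\<in>words G n. \<forall>u\<in>cylinder G w. \<forall>q. supq q n w \<le> inner q (Uhat n u) + norm q * e"
    using supq_osc[OF e(1)] by blast
  define s where "s v = \<tau> (q - h *\<^sub>R v) + h * \<rho> / 4" for v
  have sm: "summable (\<lambda>n. \<Sum>v\<in>V. Z (q - h *\<^sub>R v) (s v) n)"
    by (intro summable_sum abscissa(2)) (use h \<rho> in \<open>simp add: s_def\<close>)
  have "summable (\<lambda>n. \<Sum>w\<in>words G n - good \<alpha> r n. exp ((supq q n w + (\<tau> q - \<delta>)) * supb n w))"
  proof (rule summable_comparison_test[OF _ sm], intro exI allI impI)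
    fix n assume n: "N \<le> n"
    have n0: "0 < n" using n N(1) by linarith
    have "(\<Sum>w\<in>words G n - good \<alpha> r n. exp ((supq q n w + (\<tau> q - \<delta>)) * supb n w))
      \<le> (\<Sum>w\<in>words G n - good \<alpha> r n. \<Sum>v\<in>V. exp ((supq (q - h *\<^sub>R v) n w + s v) * supb n w))"
    proof (rule sum_mono)
      fix w assume "w \<in> words G n - good \<alpha> r n"
      then have w: "w \<in> words G n" and "w \<notin> good \<alpha> r n" by auto
      then have "\<not> (\<lambda>u. U (empirical G n u)) ` cylinder G w \<subseteq> ball \<alpha> r" unfolding good_def by simp
      then obtain u where u: "u \<in> cylinder G w" "Uhat n u \<notin> ball \<alpha> r" unfolding Uhat_def by blast
      then have "r \<le> norm (Uhat n u - \<alpha>)" by (simp add: dist_norm norm_minus_commute)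
      then obtain v where v: "v \<in> V" "\<rho> \<le> inner v (Uhat n u - \<alpha>)" using dir by blast
      have "norm (q - h *\<^sub>R v) \<le> norm q + norm (h *\<^sub>R v)" by (rule norm_triangle_ineq4)
      then have "norm (q - h *\<^sub>R v) \<le> k" using V1[OF v(1)] h by (simp add: k_def)
      then have "norm (q - h *\<^sub>R v) * e \<le> h * \<rho> / 4" unfolding e(2)[symmetric] using e(1) by (intro mult_right_mono) auto
      then have "supq (q - h *\<^sub>R v) n w \<le> inner (q - h *\<^sub>R v) (Uhat n u) + h * \<rho> / 4"
        using N(2)[rule_format, OF n w u(1), of "q - h *\<^sub>R v"] by linarith
      also have "\<dots> = inner q (Uhat n u) - h * inner v (Uhat n u) + h * \<rho> / 4" by (simp add: inner_diff_left)
      also have "\<dots> \<le> supq q n w - h * (inner v \<alpha> + \<rho>) + h * \<rho> / 4"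
      proof -
        have "h * (inner v \<alpha> + \<rho>) \<le> h * inner v (Uhat n u)"
          using v(2) h(1) by (intro mult_left_mono) (simp_all add: inner_diff_right)
        then show ?thesis using supq_upper[OF n0 u(1), of q] by linarith
      qed
      finally have "supq (q - h *\<^sub>R v) n w + s v \<le> supq q n w + (\<tau> q - \<delta>)"
        using tilt[OF v(1)] \<delta>(3) unfolding s_def distrib_left by argo
      then have "(supq q n w + (\<tau> q - \<delta>)) * supb n w \<le> (supq (q - h *\<^sub>R v) n w + s v) * supb n w"
        using supb_nonpos[OF w] by (rule mult_right_mono_neg)
      then have "exp ((supq q n w + (\<tau> q - \<delta>)) * supb n w) \<le> exp ((supq (q - h *\<^sub>R v) n w + s v) * supb n w)" by simp
      also have "\<dots> \<le> (\<Sum>v\<in>V. exp ((supq (q - h *\<^sub>R v) n w + s v) * supb n w))"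
        by (rule member_le_sum[OF v(1)]) (auto simp: finV)
      finally show "exp ((supq q n w + (\<tau> q - \<delta>)) * supb n w) \<le> (\<Sum>v\<in>V. exp ((supq (q - h *\<^sub>R v) n w + s v) * supb n w))" .
    qed
    also have "\<dots> \<le> (\<Sum>w\<in>words G n. \<Sum>v\<in>V. exp ((supq (q - h *\<^sub>R v) n w + s v) * supb n w))"
      by (intro sum_mono2 finite_words) (auto intro!: sum_nonneg)
    also have "\<dots> = (\<Sum>v\<in>V. Z (q - h *\<^sub>R v) (s v) n)" unfolding Z_def by (rule sum.swap)
    finally show "norm (\<Sum>w\<in>words G n - good \<alpha> r n. exp ((supq q n w + (\<tau> q - \<delta>)) * supb n w))
      \<le> (\<Sum>v\<in>V. Z (q - h *\<^sub>R v) (s v) n)"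
      by (simp add: sum_nonneg)
  qed
  then show thesis by (rule that[OF \<delta>(1,2)])
qed

text \<open>For such \<open>t\<close> the good words dominate the coarse series at a parameter
  slightly below \<open>\<tau> q\<close>. If their fine sum converged, then together with the bad
  words the whole coarse series would converge below its abscissa.\<close>

lemma radius_le_1_below:
  assumes D: "GDERIV \<tau> q :> - \<alpha>" and r: "0 < r" and t: "t + norm q * r < inner q \<alpha> + \<tau> q"
  shows "radius \<alpha> r t \<le> 1"
proof (rule radius_le_1, rule notI)
  assume sm: "summable (Y \<alpha> r t)"
  obtain \<delta> where \<delta>: "0 < \<delta>" "\<delta> \<le> inner q \<alpha> + \<tau> q - (t + norm q * r)"
    and bad: "summable (\<lambda>n. \<Sum>w\<in>words G n - good \<alpha> r n. exp ((supq q n w + (\<tau> q - \<delta>)) * supb n w))"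
  proof (rule bad_summable[OF D r])
    show "0 < inner q \<alpha> + \<tau> q - (t + norm q * r)" using t by simp
  qed
  have good: "summable (\<lambda>n. \<Sum>w\<in>good \<alpha> r n. exp ((supq q n w + (\<tau> q - \<delta>)) * supb n w))"
  proof (rule summable_comparison_test[OF _ summable_mult[OF sm, of "exp (\<bar>t\<bar> * distort)"]], intro exI allI impI)
    fix n :: nat assume n: "1 \<le> n"
    have "(\<Sum>w\<in>good \<alpha> r n. exp ((supq q n w + (\<tau> q - \<delta>)) * supb n w)) \<le> (\<Sum>w\<in>good \<alpha> r n. exp (\<bar>t\<bar> * distort) * supe t n w)"
    proof (rule sum_mono)
      fix w assume w: "w \<in> good \<alpha> r n"
      obtain u where u: "u \<in> cylinder G w" using cylinder_ne[OF good_words[OF w]] by auto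
      have n0: "0 < n" using n by simp
      have "inner q \<alpha> - norm q * r \<le> supq q n w"
        using good_inner[OF n0 w u, of q] supq_upper[OF n0 u, of q] by (simp add: abs_le_iff)
      then have "t \<le> supq q n w + (\<tau> q - \<delta>)" using \<delta>(2) by linarith
      then have "(supq q n w + (\<tau> q - \<delta>)) * supb n w \<le> t * supb n w"
        using supb_nonpos[OF good_words[OF w]] by (rule mult_right_mono_neg)
      then have "exp ((supq q n w + (\<tau> q - \<delta>)) * supb n w) \<le> exp (t * supb n w)" by simp
      also have "\<dots> \<le> exp (\<bar>t\<bar> * distort) * supe t n w" by (rule supe_vs_supb(2)[OF good_words[OF w]])
      finally show "exp ((supq q n w + (\<tau> q - \<delta>)) * supb n w) \<le> exp (\<bar>t\<bar> * distort) * supe t n w" .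
    qed
    then show "norm (\<Sum>w\<in>good \<alpha> r n. exp ((supq q n w + (\<tau> q - \<delta>)) * supb n w)) \<le> exp (\<bar>t\<bar> * distort) * Y \<alpha> r t n"
      by (simp add: Y_def sum_distrib_left sum_nonneg)
  qed
  have "summable (\<lambda>n. (\<Sum>w\<in>words G n - good \<alpha> r n. exp ((supq q n w + (\<tau> q - \<delta>)) * supb n w))
      + (\<Sum>w\<in>good \<alpha> r n. exp ((supq q n w + (\<tau> q - \<delta>)) * supb n w)))"
    by (rule summable_add[OF bad good])
  moreover have "(\<Sum>w\<in>words G n - good \<alpha> r n. exp ((supq q n w + (\<tau> q - \<delta>)) * supb n w))
      + (\<Sum>w\<in>good \<alpha> r n. exp ((supq q n w + (\<tau> q - \<delta>)) * supb n w)) = Z q (\<tau> q - \<delta>) n" for n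
    unfolding Z_def using good_words by (intro sum.subset_diff[symmetric] finite_words) auto
  ultimately have "summable (Z q (\<tau> q - \<delta>))" by simp
  then show False using abscissa(3)[of "\<tau> q - \<delta>" q] \<delta>(1) by simp
qed

text \<open>\<open>L\<close> is at most 1 below \<open>t0 = inner q \<alpha> + \<tau> q\<close>,
  which supplies the finiteness asked for by \<open>L_unique\<close>. Strict growth then forces
  \<open>f \<ge> t0\<close>, while \<open>t0\<close> is a competitor in the infimum that defines the
  Legendre transform.\<close>

lemma eq_legendre:
  assumes D: "GDERIV \<tau> q :> - \<alpha>"
  shows "\<exists>!t. L \<alpha> t = 1" and "L \<alpha> f = 1 \<Longrightarrow> ereal f = legendre \<tau> \<alpha>"
proof -
  define t0 where "t0 = inner q \<alpha> + \<tau> q"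
  have below: "L \<alpha> t \<le> 1" if t: "t < t0" for t
  proof -
    have "((\<lambda>r. t + norm q * r) \<longlongrightarrow> t + norm q * 0) (at_right 0)" by (intro tendsto_intros)
    then have "eventually (\<lambda>r. t + norm q * r < t0) (at_right 0)" by (rule order_tendstoD) (use t in simp)
    then have "eventually (\<lambda>r. t + norm q * r < t0 \<and> 0 < r) (at_right 0)"
      using eventually_at_right_less[of 0] by (rule eventually_conj)
    then have "eventually (\<lambda>r. radius \<alpha> r t \<le> 1) (at_right 0)"
      by eventually_elim (use radius_le_1_below[OF D] in \<open>simp add: t0_def\<close>)
    then show ?thesis unfolding L_eq by (rule Limsup_bounded)
  qed
  have "L \<alpha> (t0 - 1) \<noteq> \<infinity>" using below[of "t0 - 1"] by auto
  then show "\<exists>!t. L \<alpha> t = 1" by (intro L_unique exI)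
  assume f: "L \<alpha> f = 1"
  have "t0 \<le> f"
  proof (rule ccontr)
    assume "\<not> t0 \<le> f"
    then have "1 < L \<alpha> ((f + t0) / 2)" "L \<alpha> ((f + t0) / 2) \<le> 1"
      by (auto intro!: L_gt_1[OF f] below)
    then show False by simp
  qed
  moreover have "ereal f \<le> legendre \<tau> \<alpha>" by (rule le_legendre[OF f])
  moreover have "legendre \<tau> \<alpha> \<le> ereal (inner \<alpha> q + \<tau> q)" unfolding legendre_def by (rule INF_lower) simp
  then have "legendre \<tau> \<alpha> \<le> ereal t0" by (simp add: t0_def inner_commute)
  then have "legendre \<tau> \<alpha> \<le> ereal f" by (rule order_trans) (simp add: \<open>t0 \<le> f\<close>)
  ultimately show "ereal f = legendre \<tau> \<alpha>" by (intro antisym)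
qed

end


section \<open>Comparison with the transfer operator\<close>

context shift_graph
begin

lemma zeta_intro:
  fixes U :: "(nat \<Rightarrow> 'e) measure \<Rightarrow> 'x :: real_inner"
  assumes \<beta>: "0 < \<beta>" "\<beta> < 1" and \<phi>: "lip_shift G \<beta> C \<phi>" and neg: "\<forall>u\<in>X. \<phi> u < 0"
    and U: "continuous_map (weak_top G) euclidean U"
  shows "\<exists>c F B. zeta G \<beta> C c F B \<phi> U"
proof -
  obtain c where c: "0 < c" "\<forall>u\<in>X. \<phi> u \<le> - c" using lip_shift_neg_bound[OF \<phi> \<beta>] neg by blast
  obtain F where F: "\<And>u. u \<in> X \<Longrightarrow> \<bar>\<phi> u\<bar> \<le> F" by (rule lip_shift_bounded[OF \<phi> \<beta>]) blast
  obtain B where B: "\<forall>M\<in>shift_probs G. norm (U M) \<le> B" using continuous_weak_bounded[OF U] by blast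
  have "zeta G \<beta> C c F B \<phi> U"
  proof unfold_locales
    show "\<exists>N>0. \<forall>n\<ge>N. \<forall>w\<in>words G n. \<forall>u\<in>cylinder G w. \<forall>v\<in>cylinder G w.
        dist (U (empirical G n u)) (U (empirical G n v)) < e" if "0 < e" for e
      by (rule continuous_weak_oscillation[OF U that])
  qed (use \<beta> \<phi> c F B empirical_in_probs in auto)
  then show ?thesis by blast
qed

text \<open>For a quotient of integrals, \<open>Uhat\<close> times the Birkhoff sum of
  \<open>\<phi>\<close> is the Birkhoff sum of \<open>\<psi>\<close>. The coarse exponent therefore
  differs by a bounded amount from the Birkhoff sum of \<open>q * \<psi> + s * \<phi>\<close>, and
  \<open>tau\<close> is the critical parameter of the transfer operator.\<close>

lemma real_analytic_tau:
  fixes U :: "(nat \<Rightarrow> 'e) measure \<Rightarrow> real"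
  assumes \<beta>: "0 < \<beta>" "\<beta> < 1" and \<phi>: "lip_shift G \<beta> C\<phi> \<phi>" and \<psi>: "lip_shift G \<beta> C\<psi> \<psi>"
    and neg: "\<forall>u\<in>X. \<phi> u < 0" and U: "continuous_map (weak_top G) euclidean U"
    and eq: "\<forall>M\<in>shift_probs G. U M = integral\<^sup>L M \<psi> / integral\<^sup>L M \<phi>"
  shows "real_analytic (tau G U \<phi>)"
proof -
  obtain c F B where "zeta G \<beta> C\<phi> c F B \<phi> U" using zeta_intro[OF \<beta> \<phi> neg U] by blast
  then interpret z: zeta G \<beta> C\<phi> c F B \<phi> U .
  define D\<psi> where "D\<psi> = C\<psi> / (1 - \<beta>)"
  have D\<psi>: "0 \<le> D\<psi>" using \<psi> \<beta> by (simp add: D\<psi>_def lip_shift_def)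
  define D\<phi> where "D\<phi> = z.distort"
  have D\<phi>: "0 \<le> D\<phi>" by (simp add: D\<phi>_def z.distort0)
  have Uhat: "z.Uhat n u = birkhoff \<psi> n u / birkhoff \<phi> n u" if "0 < n" "u \<in> X" for n u
    using eq[rule_format, OF empirical_in_probs[OF that]] that(1)
    by (simp add: z.Uhat_def integral_empirical[OF that] continuous_measurable lip_shift_continuous[OF \<phi> \<beta>] lip_shift_continuous[OF \<psi> \<beta>])
  \<comment> \<open>Three contributions: the O(1/n) oscillation of \<open>Uhat\<close> times a
    Birkhoff sum of order \<open>n\<close>, and the distortion of \<open>\<phi>\<close> multiplied
    by \<open>q * Uhat\<close> and by \<open>s\<close>.\<close>
  define K where "K q s = \<bar>q\<bar> * (D\<psi> + B * D\<phi>) / c * F + \<bar>q\<bar> * B * D\<phi> + \<bar>s\<bar> * D\<phi>" for q s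
  have close: "\<bar>(z.supq q n w + s) * z.supb n w - birkhoff (\<lambda>u. q * \<psi> u + s * \<phi> u) n u\<bar> \<le> K q s"
    if n: "0 < n" and w: "w \<in> words G n" and u: "u \<in> cylinder G w" for q s n w u
  proof -
    have uX: "u \<in> X" using u by (simp add: cylinder_def)
    have l: "length w = n" using w by (simp add: words_def)
    have B0: "0 \<le> B" using order_trans[OF norm_ge_zero z.B[OF n uX]] .
    have nc: "0 < real n * c" using n z.c by simp
    have ph: "birkhoff \<phi> n v \<le> - (real n * c)" if "v \<in> X" for v using z.birkhoff_bounds(2)[OF that] .
    have Ub: "\<bar>z.Uhat n v\<bar> \<le> B" if "v \<in> X" for v using z.B[OF n that] by (simp add: z.Uhat_def)
    have diff: "\<bar>z.Uhat n v - z.Uhat n u\<bar> \<le> (D\<psi> + B * D\<phi>) / (real n * c)" if v: "v \<in> cylinder G w" for v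
    proof -
      have vX: "v \<in> X" using v by (simp add: cylinder_def)
      have nz: "birkhoff \<phi> n u \<noteq> 0" "birkhoff \<phi> n v \<noteq> 0" using ph[OF uX] ph[OF vX] nc by auto
      \<comment> \<open>Multiplying by the denominator at \<open>v\<close> leaves bounded
        differences only; dividing by its size, which is at least \<open>n * c\<close>, yields the
        rate 1/n.\<close>
      have "(z.Uhat n v - z.Uhat n u) * birkhoff \<phi> n v
        = (birkhoff \<psi> n v - birkhoff \<psi> n u) + z.Uhat n u * (birkhoff \<phi> n u - birkhoff \<phi> n v)"
        using nz by (simp add: Uhat[OF n uX] Uhat[OF n vX] field_simps)
      also have "\<bar>\<dots>\<bar> \<le> D\<psi> + B * D\<phi>"
      proof (rule order_trans[OF abs_triangle_ineq add_mono])
        show "\<bar>birkhoff \<psi> n v - birkhoff \<psi> n u\<bar> \<le> D\<psi>"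
          using birkhoff_cylinder_distortion[OF \<psi> \<beta> v u] by (simp add: l D\<psi>_def)
        have "\<bar>birkhoff \<phi> n u - birkhoff \<phi> n v\<bar> \<le> D\<phi>"
          using birkhoff_cylinder_distortion[OF \<phi> \<beta> u v] by (simp add: l D\<phi>_def z.distort_def)
        then show "\<bar>z.Uhat n u * (birkhoff \<phi> n u - birkhoff \<phi> n v)\<bar> \<le> B * D\<phi>"
          unfolding abs_mult using Ub[OF uX] B0 by (intro mult_mono) auto
      qed
      finally have "\<bar>z.Uhat n v - z.Uhat n u\<bar> * \<bar>birkhoff \<phi> n v\<bar> \<le> D\<psi> + B * D\<phi>" by (simp only: abs_mult)
      moreover have "\<bar>z.Uhat n v - z.Uhat n u\<bar> * (real n * c) \<le> \<bar>z.Uhat n v - z.Uhat n u\<bar> * \<bar>birkhoff \<phi> n v\<bar>"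
        using ph[OF vX] nc by (intro mult_left_mono) auto
      ultimately show ?thesis using nc by (simp only: pos_le_divide_eq)
    qed
    have "\<bar>z.supq q n w - q * z.Uhat n u\<bar> \<le> \<bar>q\<bar> * ((D\<psi> + B * D\<phi>) / (real n * c))"
    proof -
      have "z.supq q n w \<le> q * z.Uhat n u + \<bar>q\<bar> * ((D\<psi> + B * D\<phi>) / (real n * c))"
      proof (rule z.supq_least[OF w])
        fix v assume v: "v \<in> cylinder G w"
        have "q * z.Uhat n v - q * z.Uhat n u \<le> \<bar>q\<bar> * \<bar>z.Uhat n v - z.Uhat n u\<bar>"
          unfolding right_diff_distrib[symmetric] abs_mult[symmetric] by (rule abs_ge_self)
        also have "\<dots> \<le> \<bar>q\<bar> * ((D\<psi> + B * D\<phi>) / (real n * c))" by (intro mult_left_mono diff v) simp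
        finally show "inner q (z.Uhat n v) \<le> q * z.Uhat n u + \<bar>q\<bar> * ((D\<psi> + B * D\<phi>) / (real n * c))" by simp
      qed
      moreover have "q * z.Uhat n u \<le> z.supq q n w" using z.supq_upper[OF n u, of q] by simp
      moreover have "0 \<le> \<bar>q\<bar> * ((D\<psi> + B * D\<phi>) / (real n * c))" using D\<psi> B0 D\<phi> nc by simp
      ultimately show ?thesis by linarith
    qed
    moreover have "\<bar>z.supb n w\<bar> \<le> real n * F"
      using z.supb_bounds[OF w] nc by linarith
    ultimately have 1: "\<bar>(z.supq q n w - q * z.Uhat n u) * z.supb n w\<bar> \<le> \<bar>q\<bar> * ((D\<psi> + B * D\<phi>) / (real n * c)) * (real n * F)"
      unfolding abs_mult using D\<psi> B0 D\<phi> nc by (intro mult_mono) auto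
    have s\<phi>: "\<bar>z.supb n w - birkhoff \<phi> n u\<bar> \<le> D\<phi>"
      using z.supb_upper[OF u, of n] z.supb_distort[OF w u] D\<phi> by (simp add: D\<phi>_def)
    have "\<bar>q * z.Uhat n u\<bar> \<le> \<bar>q\<bar> * B" unfolding abs_mult using Ub[OF uX] by (rule mult_left_mono) simp
    then have 2: "\<bar>(q * z.Uhat n u) * (z.supb n w - birkhoff \<phi> n u)\<bar> \<le> \<bar>q\<bar> * B * D\<phi>"
      unfolding abs_mult[of "q * z.Uhat n u"] using s\<phi> B0 by (intro mult_mono) auto
    have 3: "\<bar>s * (z.supb n w - birkhoff \<phi> n u)\<bar> \<le> \<bar>s\<bar> * D\<phi>"
      unfolding abs_mult using s\<phi> by (rule mult_left_mono) simp
    have "birkhoff \<phi> n u \<noteq> 0" using ph[OF uX] nc by auto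
    then have U\<phi>: "z.Uhat n u * birkhoff \<phi> n u = birkhoff \<psi> n u" by (simp add: Uhat[OF n uX])
    have "(z.supq q n w + s) * z.supb n w - birkhoff (\<lambda>u. q * \<psi> u + s * \<phi> u) n u
      = (z.supq q n w - q * z.Uhat n u) * z.supb n w + (q * z.Uhat n u) * (z.supb n w - birkhoff \<phi> n u)
        + s * (z.supb n w - birkhoff \<phi> n u)"
      unfolding birkhoff_linear U\<phi>[symmetric] by (simp add: algebra_simps)
    moreover have "\<bar>q\<bar> * ((D\<psi> + B * D\<phi>) / (real n * c)) * (real n * F) = \<bar>q\<bar> * (D\<psi> + B * D\<phi>) / c * F"
      using n z.c by simp
    ultimately show ?thesis using 1 2 3 unfolding K_def by linarith
  qed
  have le1: "tr1 (\<lambda>u. q * \<psi> u + s * \<phi> u) n x \<le> exp (K q s) * z.Z q s n" if n: "0 < n" for q s n x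
  proof -
    have "tr1 (\<lambda>u. q * \<psi> u + s * \<phi> u) n x \<le> (\<Sum>w\<in>pre n x. exp (K q s) * exp ((z.supq q n w + s) * z.supb n w))"
      unfolding trans_def
    proof (rule sum_mono)
      fix w assume "w \<in> pre n x"
      then have w: "length w = n" "prepend w x \<in> X" by (auto simp: pre_def)
      have "w \<in> words G n" using prepend_in_words[OF w(2)] w(1) by simp
      moreover have "prepend w x \<in> cylinder G w" using w by (simp add: cylinder_def prepend_def)
      ultimately show "exp (birkhoff (\<lambda>u. q * \<psi> u + s * \<phi> u) n (prepend w x)) * 1
          \<le> exp (K q s) * exp ((z.supq q n w + s) * z.supb n w)"
        using close[OF n, of w "prepend w x" q s] by (simp add: abs_le_iff flip: exp_add)
    qed
    also have "\<dots> \<le> (\<Sum>w\<in>words G n. exp (K q s) * exp ((z.supq q n w + s) * z.supb n w))"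
      by (intro sum_mono2 finite_words) (auto simp: pre_def dest: prepend_in_words)
    finally show ?thesis by (simp add: z.Z_def sum_distrib_left)
  qed
  \<comment> \<open>\<open>st e\<close> may follow the arc \<open>e\<close>, so every word
    \<open>w\<close> is a branch at \<open>st (last w)\<close>. Finitely many base points thus
    account for all words.\<close>
  obtain st where st: "\<And>e. e \<in> arcs G \<Longrightarrow> st e \<in> X \<and> tail G (st e 0) = head G e"
    using ex_start[OF head_in_verts] by metis
  have le2: "z.Z q s n \<le> exp (K q s) * (\<Sum>e\<in>arcs G. tr1 (\<lambda>u. q * \<psi> u + s * \<phi> u) n (st e))" if n: "0 < n" for q s n
  proof -
    define f where "f = (\<lambda>u. q * \<psi> u + s * \<phi> u)"
    define a where "a w e = (if w \<in> pre n (st e) then exp (birkhoff f n (prepend w (st e))) else 0)" for w e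
    have "z.Z q s n \<le> (\<Sum>w\<in>words G n. exp (K q s) * (\<Sum>e\<in>arcs G. a w e))"
      unfolding z.Z_def
    proof (rule sum_mono)
      fix w assume w: "w \<in> words G n"
      then have l: "length w = n" and ne: "w \<noteq> []" using n by (auto simp: words_def)
      have e: "last w \<in> arcs G" using w last_in_set[OF ne] by (auto simp: words_def)
      have sX: "st (last w) \<in> X" "tail G (st (last w) 0) = head G (last w)" using st[OF e] by auto
      have p: "prepend w (st (last w)) \<in> X" using prepend_in_iff[OF sX(1) ne] w l sX(2) by simp
      then have "prepend w (st (last w)) \<in> cylinder G w" by (simp add: cylinder_def prepend_def)
      then have "exp ((z.supq q n w + s) * z.supb n w) \<le> exp (K q s) * exp (birkhoff f n (prepend w (st (last w))))"
        using close[OF n w, of "prepend w (st (last w))" q s] by (simp add: f_def abs_le_iff flip: exp_add)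
      also have "exp (birkhoff f n (prepend w (st (last w)))) = a w (last w)" using p l by (simp add: a_def pre_def)
      also have "a w (last w) \<le> (\<Sum>e\<in>arcs G. a w e)" by (rule member_le_sum[OF e]) (auto simp: a_def)
      finally show "exp ((z.supq q n w + s) * z.supb n w) \<le> exp (K q s) * (\<Sum>e\<in>arcs G. a w e)" by simp
    qed
    also have "\<dots> = exp (K q s) * (\<Sum>e\<in>arcs G. \<Sum>w\<in>words G n. a w e)"
      unfolding sum_distrib_left[symmetric] by (subst sum.swap) simp
    also have "(\<Sum>e\<in>arcs G. \<Sum>w\<in>words G n. a w e) = (\<Sum>e\<in>arcs G. tr1 f n (st e))"
    proof (rule sum.cong[OF refl])
      fix e
      have "pre n (st e) \<subseteq> words G n" by (auto simp: pre_def dest: prepend_in_words)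
      then have "words G n \<inter> {w. w \<in> pre n (st e)} = pre n (st e)" by auto
      then show "(\<Sum>w\<in>words G n. a w e) = tr1 f n (st e)"
        unfolding a_def trans_def by (simp add: sum.If_cases[OF finite_words])
    qed
    finally show ?thesis by (simp add: f_def)
  qed
  show ?thesis
  proof (rule real_analytic_critical_parameter[OF \<beta> \<psi> \<phi> z.c z.\<phi>_neg])
    fix q s x assume "tau G U \<phi> q < s"
    then have "summable (z.Z q s)" by (rule z.abscissa(2))
    then have "summable (\<lambda>n. exp (K q s) * z.Z q s n)" by (rule summable_mult)
    then show "summable (\<lambda>n. tr1 (\<lambda>u. q * \<psi> u + s * \<phi> u) n x)"
      by (rule summable_comparison_test[rotated]) (use le1 in \<open>auto simp: trans_nonneg intro!: exI[of _ 1]\<close>)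
  next
    fix q s x assume s: "s < tau G U \<phi> q" and x: "x \<in> X"
    show "\<not> summable (\<lambda>n. tr1 (\<lambda>u. q * \<psi> u + s * \<phi> u) n x)"
    proof
      assume sm: "summable (\<lambda>n. tr1 (\<lambda>u. q * \<psi> u + s * \<phi> u) n x)"
      \<comment> \<open>The Harnack inequality carries convergence from the single point
        \<open>x\<close> over to all base points \<open>st e\<close>.\<close>
      obtain A where A: "1 \<le> A" "\<And>n y z. y \<in> X \<Longrightarrow> z \<in> X \<Longrightarrow> tr1 (\<lambda>u. q * \<psi> u + s * \<phi> u) n y \<le> A * tr1 (\<lambda>u. q * \<psi> u + s * \<phi> u) n z"
        by (rule tr1_ratio[OF lip_shift_linear[OF \<psi> \<phi> \<beta>(1)] \<beta>]) blast
      have "summable (\<lambda>n. exp (K q s) * (\<Sum>e\<in>arcs G. A * tr1 (\<lambda>u. q * \<psi> u + s * \<phi> u) n x))"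
        by (intro summable_mult summable_sum sm)
      then have "summable (z.Z q s)"
      proof (rule summable_comparison_test[rotated], intro exI allI impI)
        fix n :: nat assume n: "1 \<le> n"
        have "z.Z q s n \<le> exp (K q s) * (\<Sum>e\<in>arcs G. tr1 (\<lambda>u. q * \<psi> u + s * \<phi> u) n (st e))" using le2 n by simp
        also have "\<dots> \<le> exp (K q s) * (\<Sum>e\<in>arcs G. A * tr1 (\<lambda>u. q * \<psi> u + s * \<phi> u) n x)"
          using A(2) st x by (intro mult_left_mono sum_mono) auto
        finally show "norm (z.Z q s n) \<le> exp (K q s) * (\<Sum>e\<in>arcs G. A * tr1 (\<lambda>u. q * \<psi> u + s * \<phi> u) n x)"
          using z.Z_nonneg[of q s n] by simp
      qed
      then show False using z.abscissa(3)[OF s] by simp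
    qed
  qed
qed

end

theorem theorem1p1:
  fixes G :: "('v, 'e) pre_digraph"
    and \<gamma> :: real
    and \<phi> :: "(nat \<Rightarrow> 'e) \<Rightarrow> real"
  assumes "fin_digraph G" and "strongly_connected G" and "arcs G \<noteq> {}"
    and "0 < \<gamma>" and "\<gamma> < 1"
    and "hoelder G \<gamma> \<phi>"
    and "\<forall>u \<in> shift_space G. \<phi> u < 0"
  shows
    "(\<forall>U :: (nat \<Rightarrow> 'e) measure \<Rightarrow> 'x::real_inner.
        continuous_map (weak_top G) euclidean U \<longrightarrow>
          (\<forall>q. \<bar>coarse_abscissa G U \<phi> q\<bar> \<noteq> \<infinity>) \<and>
          convex_on UNIV (tau G U \<phi>) \<and>
          (\<forall>\<alpha>. ((\<exists>t. fine_limsup G U \<phi> \<alpha> t \<noteq> \<infinity>) \<longrightarrow> (\<exists>!t. fine_limsup G U \<phi> \<alpha> t = 1)) \<and>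
               (\<forall>f. fine_limsup G U \<phi> \<alpha> f = 1 \<longrightarrow> ereal f \<le> legendre (tau G U \<phi>) \<alpha>))) \<and>
     (\<forall>U :: (nat \<Rightarrow> 'e) measure \<Rightarrow> real.
        continuous_map (weak_top G) euclidean U \<longrightarrow>
        (\<exists>\<psi>. hoelder G \<gamma> \<psi> \<and>
             (\<forall>\<mu> \<in> shift_probs G. U \<mu> = integral\<^sup>L \<mu> \<psi> / integral\<^sup>L \<mu> \<phi>)) \<longrightarrow>
          real_analytic (tau G U \<phi>)) \<and>
     (\<forall>U :: (nat \<Rightarrow> 'e) measure \<Rightarrow> real ^ 'm.
        continuous_map (weak_top G) euclidean U \<longrightarrow>
        (\<forall>\<alpha> q. (GDERIV (tau G U \<phi>) q :> - \<alpha>) \<longrightarrow>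
          (\<exists>!t. fine_limsup G U \<phi> \<alpha> t = 1) \<and>
          (\<forall>f. fine_limsup G U \<phi> \<alpha> f = 1 \<longrightarrow> ereal f = legendre (tau G U \<phi>) \<alpha>)))"
proof -
  interpret shift_graph G
    using assms(1-3) by (intro shift_graph.intro shift_graph_axioms.intro)
  obtain \<beta> C where \<beta>: "0 < \<beta>" "\<beta> < 1" and \<phi>: "lip_shift G \<beta> C \<phi>"
    by (rule hoelder_imp_lip[OF assms(6,4,5)])
  note neg = assms(7)
  show ?thesis
  proof (intro conjI[of "\<forall>U. _ U"] conjI allI impI)
    fix U :: "(nat \<Rightarrow> 'e) measure \<Rightarrow> 'x" and q \<alpha> f
    assume "continuous_map (weak_top G) euclidean U"
    then obtain c F B where "zeta G \<beta> C c F B \<phi> U" using zeta_intro[OF \<beta> \<phi> neg] by blast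
    then interpret z: zeta G \<beta> C c F B \<phi> U .
    show "\<bar>coarse_abscissa G U \<phi> q\<bar> \<noteq> \<infinity>" by (simp add: z.abscissa(1))
    show "convex_on UNIV (tau G U \<phi>)" by (rule z.convex_tau)
    show "\<exists>!t. fine_limsup G U \<phi> \<alpha> t = 1" if "\<exists>t. fine_limsup G U \<phi> \<alpha> t \<noteq> \<infinity>" by (rule z.L_unique[OF that])
    show "ereal f \<le> legendre (tau G U \<phi>) \<alpha>" if "fine_limsup G U \<phi> \<alpha> f = 1" by (rule z.le_legendre[OF that])
  next
    fix U :: "(nat \<Rightarrow> 'e) measure \<Rightarrow> real"
    assume U: "continuous_map (weak_top G) euclidean U"
    assume "\<exists>\<psi>. hoelder G \<gamma> \<psi> \<and> (\<forall>M\<in>shift_probs G. U M = integral\<^sup>L M \<psi> / integral\<^sup>L M \<phi>)"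
    then obtain \<psi> where \<psi>: "hoelder G \<gamma> \<psi>" "\<forall>M\<in>shift_probs G. U M = integral\<^sup>L M \<psi> / integral\<^sup>L M \<phi>" by blast
    obtain \<beta>' C' where \<beta>': "0 < \<beta>'" "\<beta>' < 1" and \<psi>': "lip_shift G \<beta>' C' \<psi>"
      by (rule hoelder_imp_lip[OF \<psi>(1) assms(4,5)])
    \<comment> \<open>The Hoelder exponents of \<open>\<phi>\<close> and \<open>\<psi>\<close> may
      differ; the larger ratio serves both functions.\<close>
    have m: "0 < max \<beta> \<beta>'" "max \<beta> \<beta>' < 1" using \<beta> \<beta>' by auto
    show "real_analytic (tau G U \<phi>)"
      by (rule real_analytic_tau[OF m lip_shift_mono[OF \<phi> \<beta>(1)] lip_shift_mono[OF \<psi>' \<beta>'(1)] neg U \<psi>(2)]) auto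
  next
    fix U :: "(nat \<Rightarrow> 'e) measure \<Rightarrow> real ^ 'm" and \<alpha> q f
    assume "continuous_map (weak_top G) euclidean U" and D: "GDERIV (tau G U \<phi>) q :> - \<alpha>"
    then obtain c F B where "zeta G \<beta> C c F B \<phi> U" using zeta_intro[OF \<beta> \<phi> neg] by blast
    then interpret z: zeta_euclidean G \<beta> C c F B \<phi> U by (rule zeta_euclidean.intro)
    show "\<exists>!t. fine_limsup G U \<phi> \<alpha> t = 1" by (rule z.eq_legendre(1)[OF D])
    show "ereal f = legendre (tau G U \<phi>) \<alpha>" if "fine_limsup G U \<phi> \<alpha> f = 1" by (rule z.eq_legendre(2)[OF D that])
  qed
qed

end
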